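(* Let $n\ge 1$ and let $G$ be a finite subgroup of $\mathrm{Aut}(\mathbb{B}^n)$. Then there exist an integer $N$ and a rational proper map $f:\mathbb{B}^n\to\mathbb{B}^N$ for which $\Gamma_f=G$. When $G$ is a finite subgroup of $\mathbf{U}(n)$, the map $f$ may be chosen to be a polynomial map.
   Context: $\mathbb{B}^n$ is the open unit ball of $\mathbb{C}^n$, $\mathrm{Aut}(\mathbb{B}^n)$ is its group of holomorphic automorphisms, and $\mathbf{U}(n)\leqslant \mathrm{Aut}(\mathbb{B}^n)$ is the unitary group. A rational (polynomial) proper map $f:\mathbb{B}^n\to\mathbb{B}^N$ is a proper holomorphic map whose components are rational functions (polynomials) of $z\in\mathbb{C}^n$. The Hermitian invariant group of a rational proper map $f:\mathbb{B}^n\to\mathbb{B}^N$ is $$\Gamma_f=\{\gamma\in\mathrm{Aut}(\mathbb{B}^n):\ \text{there is } \psi\in\mathrm{Aut}(\mathbb{B}^N)\text{ with } f\circ\gamma=\psi\circ f\}.$$ *)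

theory Defs
  imports "HOL-Analysis.Analysis" "HOL-Algebra.Bij"
begin

text \<open>
  The dimension of the target ball is existentially quantified in the theorem, so it cannot be a
  type. As in \<^const>\<open>Euclidean_space\<close>, a point of complex \<open>n\<close>-space is a sequence that vanishes
  from index \<open>n\<close> on; topological notions refer to the product topology on sequences, which on
  this subspace is the Euclidean topology.
\<close>

definition cspace :: "nat \<Rightarrow> (nat \<Rightarrow> complex) set"
  where "cspace n = {z. \<forall>i\<ge>n. z i = 0}"

definition cnorm :: "nat \<Rightarrow> (nat \<Rightarrow> complex) \<Rightarrow> real"
  where "cnorm n z = sqrt (\<Sum>i<n. (cmod (z i))\<^sup>2)"

definition uball :: "nat \<Rightarrow> (nat \<Rightarrow> complex) set"
  where "uball n = {z \<in> cspace n. cnorm n z < 1}"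


subsection \<open>Holomorphic maps\<close>

text \<open>
  Complex Frechet differentiability at each point, formulated as in
  the library's \<open>has_derivative\<close>, with the complex-linear form \<open>v \<mapsto> \<Sum>i<n. a i * v i\<close> as
  derivative. It is only used for \<open>S\<close> open in \<open>cspace n\<close>.
\<close>

definition holomorphic_fun_on :: "nat \<Rightarrow> (nat \<Rightarrow> complex) set \<Rightarrow> ((nat \<Rightarrow> complex) \<Rightarrow> complex) \<Rightarrow> bool"
  where "holomorphic_fun_on n S g \<longleftrightarrow>
    (\<forall>z\<in>S. \<exists>a :: nat \<Rightarrow> complex.
      ((\<lambda>w. (g w - g z - (\<Sum>i<n. a i * (w i - z i))) /\<^sub>R cnorm n (\<lambda>i. w i - z i)) \<longlongrightarrow> 0)
        (at z within S))"

definition holomorphic_map_on ::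
    "nat \<Rightarrow> nat \<Rightarrow> (nat \<Rightarrow> complex) set \<Rightarrow> ((nat \<Rightarrow> complex) \<Rightarrow> nat \<Rightarrow> complex) \<Rightarrow> bool"
  where "holomorphic_map_on n N S F \<longleftrightarrow>
    F \<in> S \<rightarrow> cspace N \<and> (\<forall>j<N. holomorphic_fun_on n S (\<lambda>z. F z j))"


subsection \<open>Automorphisms of the ball and the unitary group\<close>

text \<open>
  As in \<^const>\<open>BijGroup\<close>, automorphisms are extensional functions, so that maps
  which agree on the ball are equal. The product is composition.
\<close>

definition Aut_ball :: "nat \<Rightarrow> ((nat \<Rightarrow> complex) \<Rightarrow> nat \<Rightarrow> complex) set"
  where "Aut_ball n = {\<gamma> \<in> Bij (uball n).
    holomorphic_map_on n n (uball n) \<gamma> \<and>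
    holomorphic_map_on n n (uball n) (inv_into (uball n) \<gamma>)}"

definition Aut_group :: "nat \<Rightarrow> ((nat \<Rightarrow> complex) \<Rightarrow> nat \<Rightarrow> complex) monoid"
  where "Aut_group n = BijGroup (uball n) \<lparr>carrier := Aut_ball n\<rparr>"

definition unitary_matrix :: "nat \<Rightarrow> (nat \<Rightarrow> nat \<Rightarrow> complex) \<Rightarrow> bool"
  where "unitary_matrix n U \<longleftrightarrow>
    (\<forall>i<n. \<forall>j<n. (\<Sum>k<n. cnj (U k i) * U k j) = (if i = j then 1 else 0) \<and>
                  (\<Sum>k<n. U i k * cnj (U j k)) = (if i = j then 1 else 0))"

definition matrix_map :: "nat \<Rightarrow> (nat \<Rightarrow> nat \<Rightarrow> complex) \<Rightarrow> (nat \<Rightarrow> complex) \<Rightarrow> nat \<Rightarrow> complex"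
  where "matrix_map n U z = (\<lambda>i. if i < n then \<Sum>k<n. U i k * z k else 0)"

definition unitary_ball :: "nat \<Rightarrow> ((nat \<Rightarrow> complex) \<Rightarrow> nat \<Rightarrow> complex) set"
  where "unitary_ball n = {restrict (matrix_map n U) (uball n) | U. unitary_matrix n U}"


subsection \<open>Rational and polynomial proper maps, Hermitian invariant group\<close>

definition proper_holomorphic_map :: "nat \<Rightarrow> nat \<Rightarrow> ((nat \<Rightarrow> complex) \<Rightarrow> nat \<Rightarrow> complex) \<Rightarrow> bool"
  where "proper_holomorphic_map n N f \<longleftrightarrow>
    holomorphic_map_on n N (uball n) f \<and>
    proper_map (top_of_set (uball n)) (top_of_set (uball N)) f"

text \<open>The finite set \<open>A\<close> consists of the exponents \<open>\<alpha>\<close> of the monomials that occur.\<close>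

definition polynomial_fun_on :: "nat \<Rightarrow> (nat \<Rightarrow> complex) set \<Rightarrow> ((nat \<Rightarrow> complex) \<Rightarrow> complex) \<Rightarrow> bool"
  where "polynomial_fun_on n S g \<longleftrightarrow>
    (\<exists>(A :: (nat \<Rightarrow> nat) set) c. finite A \<and>
      (\<forall>z\<in>S. g z = (\<Sum>\<alpha>\<in>A. c \<alpha> * (\<Prod>i<n. z i ^ \<alpha> i))))"

definition rational_fun_on :: "nat \<Rightarrow> (nat \<Rightarrow> complex) set \<Rightarrow> ((nat \<Rightarrow> complex) \<Rightarrow> complex) \<Rightarrow> bool"
  where "rational_fun_on n S g \<longleftrightarrow>
    (\<exists>p q. polynomial_fun_on n S p \<and> polynomial_fun_on n S q \<and>
      (\<forall>z\<in>S. q z \<noteq> 0 \<and> g z = p z / q z))"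

definition rational_proper_map :: "nat \<Rightarrow> nat \<Rightarrow> ((nat \<Rightarrow> complex) \<Rightarrow> nat \<Rightarrow> complex) \<Rightarrow> bool"
  where "rational_proper_map n N f \<longleftrightarrow>
    proper_holomorphic_map n N f \<and> (\<forall>j<N. rational_fun_on n (uball n) (\<lambda>z. f z j))"

definition polynomial_proper_map :: "nat \<Rightarrow> nat \<Rightarrow> ((nat \<Rightarrow> complex) \<Rightarrow> nat \<Rightarrow> complex) \<Rightarrow> bool"
  where "polynomial_proper_map n N f \<longleftrightarrow>
    proper_holomorphic_map n N f \<and> (\<forall>j<N. polynomial_fun_on n (uball n) (\<lambda>z. f z j))"

definition hermitian_invariant_group ::
    "nat \<Rightarrow> nat \<Rightarrow> ((nat \<Rightarrow> complex) \<Rightarrow> nat \<Rightarrow> complex) \<Rightarrow> ((nat \<Rightarrow> complex) \<Rightarrow> nat \<Rightarrow> complex) set"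
  where "hermitian_invariant_group n N f =
    {\<gamma> \<in> Aut_ball n. \<exists>\<psi>\<in>Aut_ball N. \<forall>z\<in>uball n. f (\<gamma> z) = \<psi> (f z)}"


subsection \<open>Consistency of the definitions\<close>

lemma norm_le_cnorm: "i < n \<Longrightarrow> cmod (v i) \<le> cnorm n v"
  unfolding cnorm_def by (rule real_le_rsqrt) (auto intro: member_le_sum)

lemma cnorm_nonneg [simp]: "0 \<le> cnorm n v"
  by (simp add: cnorm_def sum_nonneg)

lemma cnorm_diff_eq_0_iff:
  assumes "w \<in> cspace n" "z \<in> cspace n"
  shows "cnorm n (\<lambda>i. w i - z i) = 0 \<longleftrightarrow> w = z"
proof
  assume 0: "cnorm n (\<lambda>i. w i - z i) = 0"
  have "w i = z i" for i
  proof (cases "i < n")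
    case True
    then show ?thesis
      using norm_le_cnorm[of i n "\<lambda>i. w i - z i"] 0 by simp
  next
    case False
    then show ?thesis using assms by (simp add: cspace_def)
  qed
  then show "w = z" by blast
qed (simp add: cnorm_def)

lemma uball_subset: "uball n \<subseteq> cspace n"
  by (auto simp: uball_def)

text \<open>Caratheodory's form of differentiability, convenient for the chain rule.\<close>

lemma holomorphic_fun_on_slopes:
  assumes S: "S \<subseteq> cspace n"
  shows "holomorphic_fun_on n S g \<longleftrightarrow>
    (\<forall>z\<in>S. \<exists>(a :: nat \<Rightarrow> complex) b.
       (\<forall>i<n. ((\<lambda>w. b w i) \<longlongrightarrow> a i) (at z within S)) \<and>
       (\<forall>w\<in>S. g w - g z = (\<Sum>i<n. b w i * (w i - z i))))"
  unfolding holomorphic_fun_on_def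
proof (intro ball_cong refl iffI; elim exE conjE)
  fix z a
  assume z: "z \<in> S"
  define r where "r w = g w - g z - (\<Sum>i<n. a i * (w i - z i))" for w
  define d where "d w = cnorm n (\<lambda>i. w i - z i)" for w
  assume "((\<lambda>w. (g w - g z - (\<Sum>i<n. a i * (w i - z i))) /\<^sub>R cnorm n (\<lambda>i. w i - z i)) \<longlongrightarrow> 0)
            (at z within S)"
  then have lim: "((\<lambda>w. r w /\<^sub>R d w) \<longlongrightarrow> 0) (at z within S)"
    by (simp add: r_def d_def)
  define b where "b w i = a i + r w * cnj (w i - z i) / of_real ((d w)\<^sup>2)" for w i
  have "((\<lambda>w. b w i) \<longlongrightarrow> a i) (at z within S)" if i: "i < n" for i
  proof -
    have "((\<lambda>w. r w * cnj (w i - z i) / of_real ((d w)\<^sup>2)) \<longlongrightarrow> 0) (at z within S)"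
    proof (rule Lim_null_comparison[OF _ tendsto_norm_zero[OF lim]], rule always_eventually, rule allI)
      fix w
      have "cmod (w i - z i) \<le> d w" "0 \<le> d w"
        using norm_le_cnorm[OF i, of "\<lambda>i. w i - z i"] by (simp_all add: d_def)
      then have "cmod (r w) * cmod (w i - z i) \<le> cmod (r w) * d w"
        by (simp add: mult_left_mono)
      with \<open>0 \<le> d w\<close> show "cmod (r w * cnj (w i - z i) / of_real ((d w)\<^sup>2)) \<le> norm (r w /\<^sub>R d w)"
        by (cases "d w = 0")
          (auto simp: norm_mult norm_divide norm_power power2_eq_square divide_simps
             simp flip: complex_cnj_diff)
    qed
    then show ?thesis unfolding b_def by (rule tendsto_add[OF tendsto_const, where b = 0, simplified])
  qed
  moreover have "g w - g z = (\<Sum>i<n. b w i * (w i - z i))" if w: "w \<in> S" for w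
  proof (cases "w = z")
    case False
    then have d: "d w \<noteq> 0"
      using w z S cnorm_diff_eq_0_iff unfolding d_def by blast
    have "(\<Sum>i<n. (w i - z i) * cnj (w i - z i)) = of_real ((d w)\<^sup>2)"
      unfolding d_def cnorm_def complex_norm_square[symmetric] by (simp add: sum_nonneg)
    moreover have "(\<Sum>i<n. b w i * (w i - z i)) = (\<Sum>i<n. a i * (w i - z i)) +
        r w / of_real ((d w)\<^sup>2) * (\<Sum>i<n. (w i - z i) * cnj (w i - z i))"
      unfolding b_def sum_distrib_left sum.distrib[symmetric]
      by (intro sum.cong refl) (simp only: ring_distribs diff_divide_distrib times_divide_eq_left times_divide_eq_right mult_ac)
    ultimately show ?thesis using d by (simp add: r_def)
  qed simp
  ultimately show "\<exists>a b. (\<forall>i<n. ((\<lambda>w. b w i) \<longlongrightarrow> a i) (at z within S)) \<and>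
       (\<forall>w\<in>S. g w - g z = (\<Sum>i<n. b w i * (w i - z i)))"
    by blast
next
  fix z a b
  assume z: "z \<in> S" and b: "\<forall>i<n. ((\<lambda>w. b w i) \<longlongrightarrow> a i) (at z within S)"
    and eq: "\<forall>w\<in>S. g w - g z = (\<Sum>i<n. b w i * (w i - z i))"
  have "((\<lambda>w. \<Sum>i<n. cmod (b w i - a i)) \<longlongrightarrow> (\<Sum>i<n. 0)) (at z within S)"
    by (intro tendsto_sum tendsto_norm_zero LIM_zero) (use b in auto)
  then have lim: "((\<lambda>w. \<Sum>i<n. cmod (b w i - a i)) \<longlongrightarrow> 0) (at z within S)"
    by simp
  show "\<exists>a. ((\<lambda>w. (g w - g z - (\<Sum>i<n. a i * (w i - z i))) /\<^sub>R cnorm n (\<lambda>i. w i - z i)) \<longlongrightarrow> 0)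
            (at z within S)"
  proof (rule exI[of _ a], rule Lim_null_comparison[OF _ lim])
    have "norm ((g w - g z - (\<Sum>i<n. a i * (w i - z i))) /\<^sub>R cnorm n (\<lambda>i. w i - z i))
            \<le> (\<Sum>i<n. cmod (b w i - a i))" if w: "w \<in> S" for w
    proof (cases "cnorm n (\<lambda>i. w i - z i) = 0")
      case False
      then have d: "cnorm n (\<lambda>i. w i - z i) > 0"
        using cnorm_nonneg[of n "\<lambda>i. w i - z i"] by linarith
      have "g w - g z - (\<Sum>i<n. a i * (w i - z i)) = (\<Sum>i<n. (b w i - a i) * (w i - z i))"
        unfolding bspec[OF eq w] left_diff_distrib sum_subtractf ..
      also have "cmod \<dots> \<le> (\<Sum>i<n. cmod (b w i - a i) * cnorm n (\<lambda>i. w i - z i))"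
        by (intro sum_norm_le) (auto simp: norm_mult intro!: mult_left_mono norm_le_cnorm[of _ n "\<lambda>i. w i - z i"])
      finally show ?thesis
        using d by (simp add: sum_distrib_right[symmetric] divide_simps)
    qed (simp add: sum_nonneg)
    then show "\<forall>\<^sub>F w in at z within S.
        norm ((g w - g z - (\<Sum>i<n. a i * (w i - z i))) /\<^sub>R cnorm n (\<lambda>i. w i - z i))
            \<le> (\<Sum>i<n. cmod (b w i - a i))"
      by (simp add: eventually_at_filter)
  qed
qed

lemma holomorphic_fun_on_slopesE:
  assumes "S \<subseteq> cspace n" "holomorphic_fun_on n S g" "z \<in> S"
  obtains a b where "\<forall>i<n. ((\<lambda>w. b w i) \<longlongrightarrow> a i) (at z within S)"
    "\<forall>w\<in>S. g w - g z = (\<Sum>i<n. b w i * (w i - z i))"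
proof -
  have *: "\<exists>a b. (\<forall>i<n. ((\<lambda>w. b w i) \<longlongrightarrow> a i) (at z within S)) \<and>
       (\<forall>w\<in>S. g w - g z = (\<Sum>i<n. b w i * (w i - z i)))"
    by (rule bspec[OF iffD1[OF holomorphic_fun_on_slopes[OF assms(1)] assms(2)] assms(3)])
  show thesis by (rule exE[OF *], erule exE, erule conjE, rule that)
qed

lemma holomorphic_fun_on_imp_continuous_on:
  assumes S: "S \<subseteq> cspace n" and g: "holomorphic_fun_on n S g"
  shows "continuous_on S g"
  unfolding continuous_on_def
proof
  fix z assume z: "z \<in> S"
  obtain a b where b': "\<forall>i<n. ((\<lambda>w. b w i) \<longlongrightarrow> a i) (at z within S)"
    and eq': "\<forall>w\<in>S. g w - g z = (\<Sum>i<n. b w i * (w i - z i))"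
    by (rule holomorphic_fun_on_slopesE[OF S g z])
  note b = b'[rule_format] and eq = eq'[rule_format]
  have coord: "((\<lambda>w. w i) \<longlongrightarrow> z i) (at z within S)" for i
  proof -
    have "continuous_on S (\<lambda>w :: nat \<Rightarrow> complex. w i)"
      by (rule continuous_on_subset[OF continuous_on_product_coordinates]) simp
    with z show ?thesis by (simp add: continuous_on_def)
  qed
  have "((\<lambda>w. g z + (\<Sum>i<n. b w i * (w i - z i))) \<longlongrightarrow> g z + (\<Sum>i<n. a i * (z i - z i))) (at z within S)"
    by (intro tendsto_intros b coord) auto
  then have "((\<lambda>w. g z + (\<Sum>i<n. b w i * (w i - z i))) \<longlongrightarrow> g z) (at z within S)"
    by simp
  then show "(g \<longlongrightarrow> g z) (at z within S)"
    by (rule Lim_transform_within[where d = 1]) (auto simp flip: eq)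
qed

lemma holomorphic_map_on_imp_continuous_on:
  assumes S: "S \<subseteq> cspace n" and F: "holomorphic_map_on n N S F"
  shows "continuous_on S F"
proof (rule continuous_on_coordinatewise_then_product)
  fix j
  show "continuous_on S (\<lambda>z. F z j)"
  proof (cases "j < N")
    case True
    then show ?thesis
      using F holomorphic_fun_on_imp_continuous_on[OF S] by (simp add: holomorphic_map_on_def)
  next
    case False
    then have "F z j = 0" if "z \<in> S" for z
      using F that False by (auto simp: holomorphic_map_on_def cspace_def Pi_def)
    then show ?thesis
      by (simp cong: continuous_on_cong_simp)
  qed
qed

lemma holomorphic_map_on_compose:
  assumes S: "S \<subseteq> cspace n" and T: "T \<subseteq> cspace m"
    and F: "holomorphic_map_on n m S F" and G: "holomorphic_map_on m N T G" and ST: "F ` S \<subseteq> T"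
  shows "holomorphic_map_on n N S (\<lambda>z. G (F z))"
proof -
  have "holomorphic_fun_on n S (\<lambda>z. G (F z) j)" if j: "j < N" for j
    unfolding holomorphic_fun_on_slopes[OF S]
  proof
    fix z assume z: "z \<in> S"
    have "F z \<in> T" using z ST by blast
    have Gj: "holomorphic_fun_on m T (\<lambda>w. G w j)"
      using G j by (simp add: holomorphic_map_on_def)
    obtain a b where b0: "\<forall>k<m. ((\<lambda>w. b w k) \<longlongrightarrow> a k) (at (F z) within T)"
      and beq0: "\<forall>w\<in>T. G w j - G (F z) j = (\<Sum>k<m. b w k * (w k - F z k))"
      by (rule holomorphic_fun_on_slopesE[OF T Gj \<open>F z \<in> T\<close>])
    note b = b0[rule_format] and beq = beq0[rule_format]
    have "\<exists>p. k < m \<longrightarrow> (\<forall>i<n. ((\<lambda>w. snd p w i) \<longlongrightarrow> fst p i) (at z within S)) \<and>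
        (\<forall>w\<in>S. F w k - F z k = (\<Sum>i<n. snd p w i * (w i - z i)))" for k
    proof (cases "k < m")
      case True
      then have Fk: "holomorphic_fun_on n S (\<lambda>w. F w k)"
        using F by (simp add: holomorphic_map_on_def)
      obtain a b where "\<forall>i<n. ((\<lambda>w. b w i) \<longlongrightarrow> a i) (at z within S)"
        "\<forall>w\<in>S. F w k - F z k = (\<Sum>i<n. b w i * (w i - z i))"
        by (rule holomorphic_fun_on_slopesE[OF S Fk z])
      then show ?thesis by (intro exI[of _ "(a, b)"]) simp
    qed simp
    then obtain p where p: "\<And>k. k < m \<longrightarrow>
        (\<forall>i<n. ((\<lambda>w. snd (p k) w i) \<longlongrightarrow> fst (p k) i) (at z within S)) \<and>
        (\<forall>w\<in>S. F w k - F z k = (\<Sum>i<n. snd (p k) w i * (w i - z i)))"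
      using choice[of "\<lambda>k p. k < m \<longrightarrow>
        (\<forall>i<n. ((\<lambda>w. snd p w i) \<longlongrightarrow> fst p i) (at z within S)) \<and>
        (\<forall>w\<in>S. F w k - F z k = (\<Sum>i<n. snd p w i * (w i - z i)))"] by blast
    define a' c where "a' k = fst (p k)" and "c k = snd (p k)" for k
    have c: "((\<lambda>w. c k w i) \<longlongrightarrow> a' k i) (at z within S)" if "k < m" "i < n" for k i
      using p[of k] that by (simp add: a'_def c_def)
    have ceq: "F w k - F z k = (\<Sum>i<n. c k w i * (w i - z i))" if "k < m" "w \<in> S" for k w
      using p[of k] that by (simp add: c_def)
    define b' where "b' w k = (if w = F z then a k else b w k)" for w k
    have b'eq: "G w j - G (F z) j = (\<Sum>k<m. b' w k * (w k - F z k))" if "w \<in> T" for w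
      unfolding beq[OF that] by (intro sum.cong refl) (auto simp: b'_def)
    have Fz: "(F \<longlongrightarrow> F z) (at z within S)"
      using holomorphic_map_on_imp_continuous_on[OF S F] z by (simp add: continuous_on_def)
    have b': "((\<lambda>w. b' (F w) k) \<longlongrightarrow> a k) (at z within S)" if k: "k < m" for k
    proof -
      have "((\<lambda>w. b' w k) \<longlongrightarrow> a k) (at (F z) within T)"
        by (rule Lim_transform_within[OF b[OF k], where d = 1]) (auto simp: b'_def)
      then have "continuous (at (F z) within T) (\<lambda>w. b' w k)"
        by (simp add: continuous_within b'_def)
      then have "continuous (at (F z) within F ` S) (\<lambda>w. b' w k)"
        by (rule continuous_within_subset[OF _ ST])
      moreover have "continuous (at z within S) F"
        using Fz by (simp add: continuous_within)
      ultimately have "continuous (at z within S) ((\<lambda>w. b' w k) \<circ> F)"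
        by (rule continuous_within_compose[rotated])
      then show ?thesis by (simp add: continuous_within o_def b'_def)
    qed
    show "\<exists>a b. (\<forall>i<n. ((\<lambda>w. b w i) \<longlongrightarrow> a i) (at z within S)) \<and>
       (\<forall>w\<in>S. G (F w) j - G (F z) j = (\<Sum>i<n. b w i * (w i - z i)))"
    proof (intro exI conjI allI impI ballI)
      show "((\<lambda>w. \<Sum>k<m. b' (F w) k * c k w i) \<longlongrightarrow> (\<Sum>k<m. a k * a' k i)) (at z within S)"
        if "i < n" for i
        by (intro tendsto_intros b' c that) auto
      fix w assume w: "w \<in> S"
      then have "G (F w) j - G (F z) j = (\<Sum>k<m. b' (F w) k * (\<Sum>i<n. c k w i * (w i - z i)))"
        using b'eq[of "F w"] ST ceq by auto
      also have "\<dots> = (\<Sum>k<m. \<Sum>i<n. b' (F w) k * c k w i * (w i - z i))"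
        by (simp add: sum_distrib_left mult.assoc)
      also have "\<dots> = (\<Sum>i<n. \<Sum>k<m. b' (F w) k * c k w i * (w i - z i))"
        by (rule sum.swap)
      finally show "G (F w) j - G (F z) j = (\<Sum>i<n. (\<Sum>k<m. b' (F w) k * c k w i) * (w i - z i))"
        by (simp add: sum_distrib_right)
    qed
  qed
  then show ?thesis
    using F G ST by (auto simp: holomorphic_map_on_def)
qed

lemma holomorphic_map_on_cong:
  assumes "\<And>z. z \<in> S \<Longrightarrow> F z = F' z"
  shows "holomorphic_map_on n N S F \<longleftrightarrow> holomorphic_map_on n N S F'"
proof -
  have "holomorphic_fun_on n S (\<lambda>z. F z j) \<longleftrightarrow> holomorphic_fun_on n S (\<lambda>z. F' z j)" for j
    unfolding holomorphic_fun_on_def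
    by (intro ball_cong refl ex_cong1 Lim_cong_within) (auto simp: assms)
  then show ?thesis
    using assms by (auto simp: holomorphic_map_on_def Pi_def)
qed

lemma holomorphic_map_on_matrix_map: "holomorphic_map_on n n S (matrix_map n U)"
proof -
  have "holomorphic_fun_on n S (\<lambda>z. matrix_map n U z j)" if "j < n" for j
    unfolding holomorphic_fun_on_def
    by (intro ballI exI[of _ "U j"]) (simp add: that matrix_map_def algebra_simps sum_subtractf)
  then show ?thesis
    by (auto simp: holomorphic_map_on_def matrix_map_def cspace_def)
qed

lemma matrix_map_inverse:
  assumes z: "z \<in> cspace n"
    and UV: "\<And>i j. i < n \<Longrightarrow> j < n \<Longrightarrow> (\<Sum>k<n. V i k * U k j) = (if i = j then 1 else 0)"
  shows "matrix_map n V (matrix_map n U z) = z"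
proof
  fix i
  show "matrix_map n V (matrix_map n U z) i = z i"
  proof (cases "i < n")
    case True
    have "matrix_map n V (matrix_map n U z) i = (\<Sum>k<n. \<Sum>j<n. V i k * U k j * z j)"
      using True by (simp add: matrix_map_def sum_distrib_left mult.assoc)
    also have "\<dots> = (\<Sum>j<n. (\<Sum>k<n. V i k * U k j) * z j)"
      unfolding sum_distrib_right by (rule sum.swap)
    also have "\<dots> = (\<Sum>j<n. if i = j then z j else 0)"
      by (intro sum.cong refl) (simp add: UV True)
    finally show ?thesis using True by simp
  qed (use z in \<open>simp add: matrix_map_def cspace_def\<close>)
qed

lemma unitary_matrix_adjoint:
  "unitary_matrix n U \<Longrightarrow> unitary_matrix n (\<lambda>i j. cnj (U j i))"
  by (auto simp: unitary_matrix_def mult.commute)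

lemma cnorm_unitary:
  assumes U: "unitary_matrix n U"
  shows "cnorm n (matrix_map n U z) = cnorm n z"
proof -
  have "of_real (\<Sum>i<n. (cmod (matrix_map n U z i))\<^sup>2) =
      (\<Sum>i<n. (\<Sum>j<n. U i j * z j) * cnj (\<Sum>k<n. U i k * z k))"
    unfolding of_real_sum complex_norm_square by (simp add: matrix_map_def)
  also have "\<dots> = (\<Sum>i<n. \<Sum>k<n. \<Sum>j<n. cnj (U i k) * U i j * (z j * cnj (z k)))"
    by (simp add: sum_product sum_distrib_left sum_distrib_right mult_ac)
  also have "\<dots> = (\<Sum>k<n. \<Sum>i<n. \<Sum>j<n. cnj (U i k) * U i j * (z j * cnj (z k)))"
    by (rule sum.swap)
  also have "\<dots> = (\<Sum>k<n. \<Sum>j<n. (\<Sum>i<n. cnj (U i k) * U i j) * (z j * cnj (z k)))"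
    unfolding sum_distrib_right by (intro sum.cong refl sum.swap)
  also have "\<dots> = (\<Sum>k<n. \<Sum>j<n. if k = j then z j * cnj (z k) else 0)"
    using U by (intro sum.cong refl) (simp add: unitary_matrix_def)
  also have "\<dots> = of_real (\<Sum>i<n. (cmod (z i))\<^sup>2)"
    unfolding of_real_sum complex_norm_square by simp
  finally show ?thesis
    unfolding cnorm_def of_real_eq_iff by simp
qed

lemma unitary_ball_subset_Aut_ball: "unitary_ball n \<subseteq> Aut_ball n"
proof
  fix \<gamma> assume "\<gamma> \<in> unitary_ball n"
  then obtain U where U: "unitary_matrix n U" and \<gamma>: "\<gamma> = restrict (matrix_map n U) (uball n)"
    by (auto simp: unitary_ball_def)
  define V where "V = (\<lambda>i j. cnj (U j i))"
  have V: "unitary_matrix n V"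
    using unitary_matrix_adjoint[OF U] by (simp add: V_def)
  have in_ball: "matrix_map n W z \<in> uball n" if "unitary_matrix n W" "z \<in> uball n" for W z
    using that cnorm_unitary[of n W z] by (auto simp: uball_def cspace_def matrix_map_def)
  have VU: "matrix_map n V (matrix_map n U z) = z" if "z \<in> uball n" for z
    using U that by (intro matrix_map_inverse) (auto simp: V_def unitary_matrix_def uball_def)
  have UV: "matrix_map n U (matrix_map n V z) = z" if "z \<in> uball n" for z
    using U that by (intro matrix_map_inverse) (auto simp: V_def unitary_matrix_def uball_def)
  have bij: "bij_betw \<gamma> (uball n) (uball n)"
    unfolding \<gamma> by (rule bij_betwI[where g = "matrix_map n V"]) (auto simp: in_ball U V VU UV)
  have inv: "inv_into (uball n) \<gamma> z = matrix_map n V z" if "z \<in> uball n" for z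
    using bij that UV in_ball[OF V that] unfolding \<gamma>
    by (intro inv_into_f_eq) (auto simp: bij_betw_def)
  have "holomorphic_map_on n n (uball n) \<gamma>"
    using holomorphic_map_on_cong[of "uball n" \<gamma> "matrix_map n U"] holomorphic_map_on_matrix_map
    by (simp add: \<gamma>)
  moreover have "holomorphic_map_on n n (uball n) (inv_into (uball n) \<gamma>)"
    by (rule iffD2[OF holomorphic_map_on_cong[OF inv] holomorphic_map_on_matrix_map])
  ultimately show "\<gamma> \<in> Aut_ball n"
    using bij by (simp add: Aut_ball_def Bij_def \<gamma>)
qed

lemma subgroup_Aut_ball: "subgroup (Aut_ball n) (BijGroup (uball n))"
proof -
  interpret B: group "BijGroup (uball n)" by (rule group_BijGroup)
  let ?B = "uball n"
  have bij: "\<gamma> \<in> Bij ?B" if "\<gamma> \<in> Aut_ball n" for \<gamma>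
    using that by (simp add: Aut_ball_def)
  have maps: "\<gamma> ` ?B \<subseteq> ?B" "inv_into ?B \<gamma> ` ?B \<subseteq> ?B" if "\<gamma> \<in> Bij ?B" for \<gamma>
    using that bij_betw_inv_into[of \<gamma> ?B ?B] by (auto simp: Bij_def bij_betw_def)
  have id: "(\<lambda>z\<in>?B. z) \<in> Aut_ball n"
  proof -
    have "unitary_matrix n (\<lambda>i j. if i = j then 1 else 0)"
      by (simp add: unitary_matrix_def if_distrib[of cnj] if_distrib[of "\<lambda>x. x * _"] cong: if_cong)
    moreover have *: "restrict (matrix_map n (\<lambda>i j. if i = j then 1 else 0)) ?B = (\<lambda>z\<in>?B. z)"
      by (intro restrict_ext ext)
        (auto simp: matrix_map_def uball_def cspace_def if_distrib[of "\<lambda>x. x * _"] cong: if_cong)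
    ultimately show ?thesis
      by (intro subsetD[OF unitary_ball_subset_Aut_ball]) (auto simp: unitary_ball_def simp flip: *)
  qed
  have inv: "restrict (inv_into ?B \<gamma>) ?B \<in> Aut_ball n" if \<gamma>: "\<gamma> \<in> Aut_ball n" for \<gamma>
  proof -
    let ?i = "restrict (inv_into ?B \<gamma>) ?B"
    have i: "?i \<in> Bij ?B" by (rule restrict_inv_into_Bij[OF bij[OF \<gamma>]])
    have "inv_into ?B ?i z = \<gamma> z" if z: "z \<in> ?B" for z
      using i bij[OF \<gamma>] z by (intro inv_into_f_eq) (auto simp: Bij_def bij_betw_def)
    then have "holomorphic_map_on n n ?B (inv_into ?B ?i)"
      using holomorphic_map_on_cong[of ?B "inv_into ?B ?i" \<gamma>] \<gamma> by (simp add: Aut_ball_def)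
    moreover have "holomorphic_map_on n n ?B ?i"
      using holomorphic_map_on_cong[of ?B ?i "inv_into ?B \<gamma>"] \<gamma> by (simp add: Aut_ball_def)
    ultimately show ?thesis using i by (simp add: Aut_ball_def)
  qed
  have mult: "compose ?B \<gamma> \<delta> \<in> Aut_ball n" if \<gamma>: "\<gamma> \<in> Aut_ball n" and \<delta>: "\<delta> \<in> Aut_ball n" for \<gamma> \<delta>
  proof -
    have c: "compose ?B \<gamma> \<delta> \<in> Bij ?B" by (rule compose_Bij[OF bij[OF \<gamma>] bij[OF \<delta>]])
    have "holomorphic_map_on n n ?B (\<lambda>z. \<gamma> (\<delta> z))"
      by (rule holomorphic_map_on_compose[where F = \<delta> and G = \<gamma>, OF uball_subset uball_subset])
        (use \<gamma> \<delta> maps[OF bij[OF \<delta>]] in \<open>simp_all add: Aut_ball_def\<close>)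
    then have 1: "holomorphic_map_on n n ?B (compose ?B \<gamma> \<delta>)"
      using holomorphic_map_on_cong[of ?B "compose ?B \<gamma> \<delta>" "\<lambda>z. \<gamma> (\<delta> z)"] by (simp add: compose_eq)
    have "holomorphic_map_on n n ?B (\<lambda>z. inv_into ?B \<delta> (inv_into ?B \<gamma> z))"
      by (rule holomorphic_map_on_compose[where F = "inv_into ?B \<gamma>" and G = "inv_into ?B \<delta>",
            OF uball_subset uball_subset])
        (use \<gamma> \<delta> maps[OF bij[OF \<gamma>]] in \<open>simp_all add: Aut_ball_def\<close>)
    note 2 = this
    have "inv_into ?B (compose ?B \<gamma> \<delta>) z = inv_into ?B \<delta> (inv_into ?B \<gamma> z)" if z: "z \<in> ?B" for z
    proof (rule inv_into_f_eq)
      show "inj_on (compose ?B \<gamma> \<delta>) ?B" using c by (simp add: Bij_def bij_betw_def)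
      have 1: "inv_into ?B \<gamma> z \<in> ?B" using maps[OF bij[OF \<gamma>]] z by blast
      then show 2: "inv_into ?B \<delta> (inv_into ?B \<gamma> z) \<in> ?B" using maps[OF bij[OF \<delta>]] by blast
      show "compose ?B \<gamma> \<delta> (inv_into ?B \<delta> (inv_into ?B \<gamma> z)) = z"
        using bij[OF \<gamma>] bij[OF \<delta>] 1 2 z
        by (simp add: compose_eq Bij_def bij_betw_def f_inv_into_f)
    qed
    from iffD2[OF holomorphic_map_on_cong[OF this] 2]
    have "holomorphic_map_on n n ?B (inv_into ?B (compose ?B \<gamma> \<delta>))" .
    with 1 c show ?thesis by (simp add: Aut_ball_def)
  qed
  show ?thesis
  proof (rule B.subgroupI)
    show "Aut_ball n \<subseteq> carrier (BijGroup ?B)" using bij by (auto simp: BijGroup_def)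
    show "Aut_ball n \<noteq> {}" using id by blast
    show "inv\<^bsub>BijGroup ?B\<^esub> \<gamma> \<in> Aut_ball n" if "\<gamma> \<in> Aut_ball n" for \<gamma>
      using inv[OF that] inv_BijGroup[OF bij[OF that]] by simp
    show "\<gamma> \<otimes>\<^bsub>BijGroup ?B\<^esub> \<delta> \<in> Aut_ball n" if "\<gamma> \<in> Aut_ball n" "\<delta> \<in> Aut_ball n" for \<gamma> \<delta>
      using mult[OF that] bij that by (simp add: BijGroup_def)
  qed
qed

theorem group_Aut_group: "group (Aut_group n)"
  unfolding Aut_group_def by (rule subgroup.subgroup_is_group[OF subgroup_Aut_ball group_BijGroup])

text \<open>Properness is the usual condition that preimages of compact sets are compact.\<close>

lemma proper_holomorphic_map_alt:
  "proper_holomorphic_map n N f \<longleftrightarrow>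
    holomorphic_map_on n N (uball n) f \<and> f \<in> uball n \<rightarrow> uball N \<and>
    (\<forall>K. compact K \<and> K \<subseteq> uball N \<longrightarrow> compact {z \<in> uball n. f z \<in> K})"
proof -
  have eq: "proper_map (top_of_set (uball n)) (top_of_set (uball N)) f \<longleftrightarrow>
    f \<in> uball n \<rightarrow> uball N \<and> (\<forall>K. compact K \<and> K \<subseteq> uball N \<longrightarrow> compact {z \<in> uball n. f z \<in> K})"
    (is "?P \<longleftrightarrow> ?Q")
    if hol: "holomorphic_map_on n N (uball n) f"
  proof
    assume P: ?P
    then have "f \<in> uball n \<rightarrow> uball N"
      using proper_map_imp_subset_topspace by fastforce
    moreover have "compact {z \<in> uball n. f z \<in> K}" if "compact K" "K \<subseteq> uball N" for K
      using compactin_proper_map_preimage[OF P, of K] that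
      by (simp add: compactin_subtopology)
    ultimately show ?Q by blast
  next
    assume Q: ?Q
    have cont: "continuous_on (uball n) f"
      by (rule holomorphic_map_on_imp_continuous_on[OF uball_subset hol])
    have "metrizable_space (top_of_set (uball N))"
      by (simp add: metrizable_space_subtopology metrizable_space_euclidean)
    then have k: "k_space (top_of_set (uball N))"
      by (rule metrizable_imp_k_space)
    have kc: "kc_space (top_of_set (uball N))"
      by (simp add: Hausdorff_imp_kc_space Hausdorff_space_subtopology)
    show ?P
    proof (rule compact_imp_proper_map[OF k kc])
      show "f \<in> topspace (top_of_set (uball n)) \<rightarrow> topspace (top_of_set (uball N))"
        using Q by simp
      show "continuous_map (top_of_set (uball n)) (top_of_set (uball N)) f \<or> kc_space (top_of_set (uball n))"
        using cont Q by (auto simp: continuous_map_in_subtopology)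
      show "compactin (top_of_set (uball n)) {x \<in> topspace (top_of_set (uball n)). f x \<in> K}"
        if "compactin (top_of_set (uball N)) K" for K
        using Q that by (auto simp: compactin_subtopology)
    qed
  qed
  then show ?thesis by (auto simp: proper_holomorphic_map_def)
qed

end

theory Submission
  imports Defs "HOL-Complex_Analysis.Complex_Analysis"
begin

text \<open>
  First let \<open>G\<close> be unitary. A map \<open>f\<close> is sought whose squared norm, as a function on the ball,
  remembers exactly \<open>G\<close>. Let \<open>S\<close> be a finite \<open>G\<close>-invariant set of vectors of norm greater than
  \<open>1\<close>. The product \<open>A\<close> of the functions \<open>\<bar>1 - \<langle>z, x\<rangle>\<bar>\<^sup>2\<close> over \<open>x \<in> S\<close>, suitably scaled, is
  \<open>G\<close>-invariant and its zeros in the ball recover \<open>S\<close>: a unitary map that preserves \<open>A\<close> maps \<open>S\<close>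
  into itself (\<open>hyperplane_form_preserved\<close>). If \<open>S\<close> consists of the orbits of enough vectors on
  the moment curve, a unitary map with this property belongs to \<open>G\<close>, by the pigeonhole principle
  and the Vandermonde determinant (\<open>matrix_map_eq_on_moment_vectors\<close>).

  To turn \<open>A\<close> into a proper map, one has to complete it to a function that is \<open>1\<close> on the sphere
  and a squared norm of a polynomial map. By Lagrange's identity there is a function \<open>D\<close> of
  \<open>\<parallel>z\<parallel>\<^sup>2\<close> alone, equal to \<open>1\<close> on the sphere, such that \<open>D - A\<close> is a squared norm (\<open>sos_forms\<close>);
  then \<open>A + \<parallel>z\<parallel>\<^sup>2 (D - A)\<close> is as desired. Listing the components over the whole orbit makes the
  map equivariant: elements of \<open>G\<close> permute the components (\<open>equivariant_symmetrization\<close>).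

  That no further automorphism \<open>\<gamma>\<close> of the ball satisfies \<open>f \<circ> \<gamma> = \<psi> \<circ> f\<close> needs two facts. By
  Schwarz's lemma, automorphisms are compositions of unitary maps with explicit involutions
  (\<open>Aut_ball_fixing_0\<close>, \<open>Aut_ball_decomp\<close>). And if \<open>f\<close> has degree \<open>d\<close>, no constant or linear
  terms and homogeneous components of degree \<open>d\<close> without common zero except the origin, then
  comparing poles on a complex line shows that \<open>\<gamma>\<close> fixes the origin (\<open>equivariant_fixes_0\<close>); a
  further factor and summand in \<open>prescribed_norm\<close> provide these features. So \<open>\<gamma>\<close> and \<open>\<psi>\<close> are
  unitary, and \<open>\<gamma>\<close> preserves the squared norm of \<open>f\<close>.

  An arbitrary finite \<open>G\<close> has a fixed point \<open>p\<close>, the unique minimum point of an invariant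
  function (\<open>finite_group_fixed_point\<close>). The involution that exchanges \<open>p\<close> and \<open>0\<close> conjugates
  \<open>G\<close> to a unitary group, and composing the polynomial map of that group with the involution
  gives a rational one.
\<close>

section \<open>The Hermitian inner product\<close>

definition cinner :: "nat \<Rightarrow> (nat \<Rightarrow> complex) \<Rightarrow> (nat \<Rightarrow> complex) \<Rightarrow> complex"
  where "cinner n z w = (\<Sum>i<n. z i * cnj (w i))"

lemma cnorm_sq: "(cnorm n z)\<^sup>2 = (\<Sum>i<n. (cmod (z i))\<^sup>2)"
  by (simp add: cnorm_def sum_nonneg)

lemma cinner_self: "cinner n z z = of_real ((cnorm n z)\<^sup>2)"
  by (simp only: cinner_def cnorm_sq of_real_sum complex_norm_square)

lemma cinner_commute: "cinner n w z = cnj (cinner n z w)"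
  by (simp add: cinner_def mult.commute)

lemma cinner_comb_left:
  "cinner n (\<lambda>i. a * z i + c * w i) u = a * cinner n z u + c * cinner n w u"
  by (simp add: cinner_def ring_distribs sum.distrib sum_distrib_left mult.assoc)

lemma cinner_comb_right:
  "cinner n u (\<lambda>i. a * z i + c * w i) = cnj a * cinner n u z + cnj c * cinner n u w"
  by (simp add: cinner_def ring_distribs sum.distrib sum_distrib_left mult_ac)

lemma cinner_scale_left: "cinner n (\<lambda>i. a * z i) u = a * cinner n z u"
  using cinner_comb_left[of n a z 0 z u] by simp

lemma cinner_scale_right: "cinner n u (\<lambda>i. a * z i) = cnj a * cinner n u z"
  using cinner_comb_right[of n u a z 0 z] by simp

lemma cnorm_scale: "cnorm n (\<lambda>i. a * z i) = cmod a * cnorm n z"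
  by (simp add: cnorm_def norm_mult power_mult_distrib real_sqrt_mult flip: sum_distrib_left)

lemma cnorm_comb_sq:
  "(cnorm n (\<lambda>i. a * z i + c * w i))\<^sup>2 =
    (cmod a)\<^sup>2 * (cnorm n z)\<^sup>2 + (cmod c)\<^sup>2 * (cnorm n w)\<^sup>2 + 2 * Re (a * cnj c * cinner n z w)"
proof -
  have "complex_of_real ((cnorm n (\<lambda>i. a * z i + c * w i))\<^sup>2) =
      a * cnj a * cinner n z z + c * cnj c * cinner n w w
      + (a * cnj c * cinner n z w + cnj (a * cnj c * cinner n z w))"
    unfolding cinner_self[symmetric] cinner_comb_left cinner_comb_right
      cinner_commute[of n w z] by (simp add: algebra_simps)
  also have "\<dots> = complex_of_real ((cmod a)\<^sup>2 * (cnorm n z)\<^sup>2 + (cmod c)\<^sup>2 * (cnorm n w)\<^sup>2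
      + 2 * Re (a * cnj c * cinner n z w))"
    unfolding complex_add_cnj cinner_self complex_norm_square[symmetric] by simp
  finally show ?thesis by (simp only: of_real_eq_iff)
qed

text \<open>Beyond the Cauchy--Schwarz inequality, this writes its defect as a sum of squared moduli of
  functions that are linear in \<open>z\<close>; the components of the map constructed below arise in this way.\<close>

lemma lagrange_identity:
  "(\<Sum>i<n. \<Sum>j<n. (cmod (z i * w j - z j * w i))\<^sup>2) =
    2 * ((cnorm n z)\<^sup>2 * (cnorm n w)\<^sup>2 - (cmod (cinner n z w))\<^sup>2)"
proof -
  have 1: "(\<Sum>i<n. \<Sum>j<n. z i * cnj (z i) * (w j * cnj (w j))) = cinner n z z * cinner n w w"
    by (simp add: cinner_def sum_product)
  have 2: "(\<Sum>i<n. \<Sum>j<n. z j * cnj (z j) * (w i * cnj (w i))) = cinner n z z * cinner n w w"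
    by (subst sum.swap) (simp add: cinner_def sum_product)
  have 3: "(\<Sum>i<n. \<Sum>j<n. z i * cnj (w i) * (w j * cnj (z j))) = cinner n z w * cinner n w z"
    by (simp add: cinner_def sum_product)
  have 4: "(\<Sum>i<n. \<Sum>j<n. z j * cnj (w j) * (w i * cnj (z i))) = cinner n z w * cinner n w z"
    by (subst sum.swap) (simp add: cinner_def sum_product)
  have "complex_of_real (\<Sum>i<n. \<Sum>j<n. (cmod (z i * w j - z j * w i))\<^sup>2) =
      (\<Sum>i<n. \<Sum>j<n. z i * cnj (z i) * (w j * cnj (w j)) + z j * cnj (z j) * (w i * cnj (w i))
        - z i * cnj (w i) * (w j * cnj (z j)) - z j * cnj (w j) * (w i * cnj (z i)))"
    unfolding of_real_sum complex_norm_square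
    by (intro sum.cong refl) (simp add: algebra_simps)
  also have "\<dots> = 2 * (cinner n z z * cinner n w w - cinner n z w * cnj (cinner n z w))"
    unfolding sum_subtractf sum.distrib 1 2 3 4 cinner_commute[of n w z] by simp
  also have "\<dots> = complex_of_real (2 * ((cnorm n z)\<^sup>2 * (cnorm n w)\<^sup>2 - (cmod (cinner n z w))\<^sup>2))"
    unfolding cinner_self complex_norm_square[symmetric] by simp
  finally show ?thesis by (simp only: of_real_eq_iff)
qed

lemma cinner_le: "cmod (cinner n z w) \<le> cnorm n z * cnorm n w"
proof (rule power2_le_imp_le)
  have "0 \<le> (\<Sum>i<n. \<Sum>j<n. (cmod (z i * w j - z j * w i))\<^sup>2)"
    by (intro sum_nonneg) auto
  then show "(cmod (cinner n z w))\<^sup>2 \<le> (cnorm n z * cnorm n w)\<^sup>2"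
    unfolding lagrange_identity power_mult_distrib by simp
qed simp

text \<open>The equality case of the Cauchy--Schwarz inequality.\<close>

lemma eq_of_cinner_eq:
  assumes "z \<in> cspace n" "w \<in> cspace n" "(cnorm n z)\<^sup>2 \<le> r" "(cnorm n w)\<^sup>2 \<le> r" "Re (cinner n z w) = r"
  shows "z = w"
proof -
  have "(cnorm n (\<lambda>i. 1 * z i + (- 1) * w i))\<^sup>2 \<le> 0"
    unfolding cnorm_comb_sq using assms(3-5) by simp
  then have "cnorm n (\<lambda>i. z i - w i) = 0" by simp
  with assms show ?thesis by (simp add: cnorm_diff_eq_0_iff)
qed

lemma uballD: "z \<in> uball n \<Longrightarrow> z \<in> cspace n" "z \<in> uball n \<Longrightarrow> cnorm n z < 1"
  by (auto simp: uball_def)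

lemma zero_in_uball: "(\<lambda>i. 0) \<in> uball n"
  by (simp add: uball_def cspace_def cnorm_def)

lemma cspace_eqI: "z \<in> cspace n \<Longrightarrow> w \<in> cspace n \<Longrightarrow> (\<And>i. i < n \<Longrightarrow> z i = w i) \<Longrightarrow> z = w"
  by (auto simp: cspace_def fun_eq_iff) (metis leI)

lemma cnorm_eq_0: "z \<in> cspace n \<Longrightarrow> cnorm n z = 0 \<longleftrightarrow> z = (\<lambda>i. 0)"
  using cnorm_diff_eq_0_iff[of z n "\<lambda>i. 0"] by (simp add: cspace_def)

lemma scale_in_cspace: "z \<in> cspace n \<Longrightarrow> (\<lambda>i. t * z i) \<in> cspace n"
  by (simp add: cspace_def)

lemma scale_in_uball: "z \<in> uball n \<Longrightarrow> cmod t \<le> 1 \<Longrightarrow> (\<lambda>i. t * z i) \<in> uball n"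
  using mult_left_le_one_le[of "cnorm n z" "cmod t"]
  by (auto simp: uball_def cnorm_scale cspace_def)

lemma cinner_less_1: "cnorm n z < 1 \<Longrightarrow> cnorm n b < 1 \<Longrightarrow> cmod (cinner n z b) < 1"
  using cinner_le[of n z b] mult_strict_mono[of "cnorm n z" 1 "cnorm n b" 1] by simp

lemma one_minus_cinner_nz: "cnorm n z < 1 \<Longrightarrow> cnorm n b < 1 \<Longrightarrow> 1 - cinner n z b \<noteq> 0"
  using cinner_less_1[of n z b] by force

section \<open>The involutive automorphisms of the ball\<close>

text \<open>The factor \<open>1 + s\<close> arises from \<open>(1 - s) / \<parallel>b\<parallel>\<^sup>2 = 1 / (1 + s)\<close>, so that the usual formula with the
  orthogonal projection onto the line through \<open>b\<close> also makes sense for \<open>b = 0\<close>.\<close>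

definition mobius :: "nat \<Rightarrow> (nat \<Rightarrow> complex) \<Rightarrow> (nat \<Rightarrow> complex) \<Rightarrow> nat \<Rightarrow> complex"
  where "mobius n b z = (let s = complex_of_real (sqrt (1 - (cnorm n b)\<^sup>2)); l = cinner n z b in
    (\<lambda>i. ((1 - l / (1 + s)) * b i + (- s) * z i) / (1 - l)))"

lemma mobius_in_cspace: "b \<in> cspace n \<Longrightarrow> z \<in> cspace n \<Longrightarrow> mobius n b z \<in> cspace n"
  by (simp add: mobius_def cspace_def Let_def)

context
  fixes n :: nat and b :: "nat \<Rightarrow> complex"
  assumes b: "cnorm n b < 1"
begin

private abbreviation s :: complex where "s \<equiv> complex_of_real (sqrt (1 - (cnorm n b)\<^sup>2))"

private lemma s_sq: "s * s = 1 - of_real ((cnorm n b)\<^sup>2)"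
proof -
  have "(cnorm n b)\<^sup>2 \<le> 1" using b by (simp add: abs_square_le_1)
  then show ?thesis by (simp flip: of_real_mult)
qed

private lemma s_plus_1: "1 + s \<noteq> 0"
proof -
  have "(cnorm n b)\<^sup>2 \<le> 1" using b by (simp add: abs_square_le_1)
  then have "1 + sqrt (1 - (cnorm n b)\<^sup>2) > 0" by (simp add: add_pos_nonneg)
  then show ?thesis by (metis of_real_1 of_real_add of_real_eq_0_iff less_irrefl)
qed

lemma mobius_eq:
  "mobius n b z = (\<lambda>i. (1 - cinner n z b / (1 + s)) / (1 - cinner n z b) * b i + (- s / (1 - cinner n z b)) * z i)"
  by (simp only: mobius_def Let_def add_divide_distrib times_divide_eq_left)

lemma one_minus_cinner_mobius:
  assumes "1 - cinner n z b \<noteq> 0"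
  shows "1 - cinner n (mobius n b z) b = of_real (1 - (cnorm n b)\<^sup>2) / (1 - cinner n z b)"
proof -
  define l where "l = cinner n z b"
  define m where "m = l / (1 + s)"
  have l: "l = m * (1 + s)" using s_plus_1 by (simp add: m_def)
  have *: "D * (1 - (p / D * q + (- t / D) * k)) = D - p * q + t * k" if "D \<noteq> 0" for D p q t k :: complex
    using that by (simp add: field_simps)
  have "(1 - l) * (1 - cinner n (mobius n b z) b) = 1 - l - (1 - m) * (1 - s * s) + s * l"
    using *[of "1 - l" "1 - m" "1 - s * s" s l] assms
    unfolding mobius_eq cinner_comb_left l_def[symmetric] m_def[symmetric]
    by (simp add: cinner_self s_sq l_def)
  also have "\<dots> = s * s" unfolding l by (simp add: algebra_simps)
  finally show ?thesis using assms unfolding s_sq l_def[symmetric]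
    by (simp add: field_simps)
qed

lemma mobius_involution:
  assumes "1 - cinner n z b \<noteq> 0"
  shows "mobius n b (mobius n b z) = z"
proof
  fix i
  have nz: "1 - (cnorm n b)\<^sup>2 \<noteq> 0" using b by (simp add: power2_eq_1_iff) (smt (verit) cnorm_nonneg)
  define l where "l = cinner n z b"
  define m where "m = l / (1 + s)"
  have l: "l = m * (1 + s)" using s_plus_1 by (simp add: m_def)
  define D where "D = 1 - l"
  have D: "D \<noteq> 0" using assms by (simp add: D_def l_def)
  have ss: "s * s \<noteq> 0" using nz unfolding s_sq by (metis eq_iff_diff_eq_0 of_real_1 of_real_eq_iff)
  then have s0: "s \<noteq> 0" by auto
  have 1: "1 - cinner n (mobius n b z) b = s * s / D"
    using one_minus_cinner_mobius[OF assms] s_sq by (simp add: D_def l_def)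
  then have 2: "cinner n (mobius n b z) b = 1 - s * s / D" by (simp add: algebra_simps)
  have 3: "mobius n b z i = ((1 - m) * b i - s * z i) / D"
    by (simp add: mobius_def Let_def l_def D_def m_def)
  have "mobius n b (mobius n b z) i =
      ((1 - (1 - s * s / D) / (1 + s)) * b i - s * (((1 - m) * b i - s * z i) / D)) / (s * s / D)"
    unfolding mobius_def[of n b "mobius n b z"] Let_def 1 unfolding 2 3 by simp
  also have "(1 - s * s / D) / (1 + s) = (D - s * s) / (D * (1 + s))"
    using D by (simp add: field_simps)
  also have "(D - s * s) / (D * (1 + s)) = (1 - s - m) / D"
    using D s_plus_1 by (simp add: frac_eq_eq) (simp add: D_def l algebra_simps)
  also have "((1 - (1 - s - m) / D) * b i - s * (((1 - m) * b i - s * z i) / D)) / (s * s / D)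
     = ((D - (1 - s - m)) * b i - s * ((1 - m) * b i - s * z i)) / (s * s)"
    using D s0 by (simp add: field_simps)
  also have "(D - (1 - s - m)) * b i - s * ((1 - m) * b i - s * z i) = s * s * z i"
    by (simp add: D_def l algebra_simps)
  finally show "mobius n b (mobius n b z) i = z i" using s0 by simp
qed

lemma mobius_norm:
  assumes nz: "1 - cinner n z b \<noteq> 0"
  shows "1 - (cnorm n (mobius n b z))\<^sup>2 =
    (1 - (cnorm n b)\<^sup>2) * (1 - (cnorm n z)\<^sup>2) / (cmod (1 - cinner n z b))\<^sup>2"
proof -
  define l where "l = cinner n z b"
  define m where "m = l / (1 + s)"
  have l: "l = m * (1 + s)" using s_plus_1 by (simp add: m_def)
  have l': "cnj l = cnj m * (1 + s)" by (simp add: l)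
  have D: "1 - l \<noteq> 0" "1 - cnj l \<noteq> 0" using nz by (auto simp: l_def)
  have *: "(p / D * (p' / D' * q + (- t / D') * k') + (- t / D) * (p' / D' * k + (- t / D') * Z)) * (D * D')
      = p * p' * q - t * p * k' - t * p' * k + t * t * Z"
    if "D \<noteq> 0" "D' \<noteq> 0" for D D' p p' q t k k' Z :: complex
    using that by (simp add: divide_simps) (simp add: algebra_simps)
  have "cinner n (mobius n b z) (mobius n b z) * ((1 - l) * (1 - cnj l)) =
    (1 - m) * (1 - cnj m) * (1 - s * s) - s * (1 - m) * cnj l - s * (1 - cnj m) * l + s * s * cinner n z z"
    unfolding mobius_eq cinner_comb_left cinner_comb_right l_def[symmetric] m_def[symmetric]
    using *[OF D, of "1 - m" "1 - cnj m" "1 - s * s" s "cnj l" l "cinner n z z"]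
    by (simp add: s_sq cinner_self[of n b] cinner_commute[of n b z] l_def[symmetric] m_def)
  also have "\<dots> = (1 - l) * (1 - cnj l) - s * s * (1 - cinner n z z)"
    unfolding l' unfolding l by (simp add: algebra_simps)
  finally have "(1 - cinner n (mobius n b z) (mobius n b z)) * ((1 - l) * cnj (1 - l)) =
      s * s * (1 - cinner n z z)"
    by (simp add: algebra_simps)
  then have "complex_of_real ((1 - (cnorm n (mobius n b z))\<^sup>2) * (cmod (1 - l))\<^sup>2) =
      complex_of_real ((1 - (cnorm n b)\<^sup>2) * (1 - (cnorm n z)\<^sup>2))"
    unfolding s_sq cinner_self complex_norm_square[symmetric] by simp
  then have "(1 - (cnorm n (mobius n b z))\<^sup>2) * (cmod (1 - l))\<^sup>2 =
      (1 - (cnorm n b)\<^sup>2) * (1 - (cnorm n z)\<^sup>2)" by (simp only: of_real_eq_iff)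
  then show ?thesis using D by (simp add: field_simps l_def)
qed

text \<open>On the complex line through \<open>b\<close> the involution is a fractional linear map of one variable,
  with a pole at \<open>t = 1 / \<parallel>b\<parallel>\<^sup>2\<close>.\<close>

lemma mobius_line:
  "mobius n b (\<lambda>i. t * b i) = (\<lambda>i. (1 - t) / (1 - t * of_real ((cnorm n b)\<^sup>2)) * b i)"
proof
  fix i
  define r where "r = complex_of_real ((cnorm n b)\<^sup>2)"
  have "r = (1 - s) * (1 + s)" using s_sq by (simp add: r_def algebra_simps)
  then have "t * r / (1 + s) = t * (1 - s)" using s_plus_1 by simp
  then have "mobius n b (\<lambda>i. t * b i) i = ((1 - t * (1 - s)) * b i + (- s) * (t * b i)) / (1 - t * r)"
    by (simp only: mobius_def Let_def cinner_scale_left cinner_self r_def)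
  also have "(1 - t * (1 - s)) * b i + (- s) * (t * b i) = (1 - t) * b i" by (simp add: algebra_simps)
  finally show "mobius n b (\<lambda>i. t * b i) i = (1 - t) / (1 - t * of_real ((cnorm n b)\<^sup>2)) * b i"
    by (simp add: r_def)
qed

lemma mobius_self: "mobius n b b = (\<lambda>i. 0)"
proof -
  have nz: "1 - cinner n b b \<noteq> 0" using b by (rule one_minus_cinner_nz) (rule b)
  have "(1 + s) * (1 - s) = 1 - s * s" by (simp add: algebra_simps)
  also have "\<dots> = cinner n b b" unfolding s_sq cinner_self by simp
  finally have "1 - cinner n b b / (1 + s) = s"
    using s_plus_1 by (simp add: field_simps)
  then show ?thesis
    by (simp add: mobius_def Let_def)
qed

end

lemma mobius_zero: "mobius n b (\<lambda>i. 0) = b"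
  by (simp add: mobius_def Let_def cinner_def)

lemma mobius_in_uball:
  assumes "b \<in> uball n" "z \<in> uball n"
  shows "mobius n b z \<in> uball n"
proof -
  have b: "cnorm n b < 1" and z: "cnorm n z < 1" using assms by (auto dest: uballD)
  have "(cnorm n b)\<^sup>2 < 1" "(cnorm n z)\<^sup>2 < 1" using b z by (simp_all add: abs_square_less_1)
  then have "1 - (cnorm n (mobius n b z))\<^sup>2 > 0"
    unfolding mobius_norm[OF b one_minus_cinner_nz[OF z b]]
    using one_minus_cinner_nz[OF z b] by (simp add: divide_pos_pos)
  then have "cnorm n (mobius n b z) < 1" by (simp add: abs_square_less_1)
  then show ?thesis using assms mobius_in_cspace uball_def by blast
qed

section \<open>Holomorphic functions of several variables\<close>

lemma holomorphic_fun_on_const: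
  assumes "S \<subseteq> cspace n"
  shows "holomorphic_fun_on n S (\<lambda>z. c)"
  unfolding holomorphic_fun_on_slopes[OF assms]
  by (intro ballI exI[of _ "\<lambda>_. 0"] exI[of _ "\<lambda>_ _. 0"]) simp

lemma holomorphic_fun_on_coordinate:
  assumes "S \<subseteq> cspace n" "k < n"
  shows "holomorphic_fun_on n S (\<lambda>z. z k)"
  unfolding holomorphic_fun_on_slopes[OF assms(1)]
  by (intro ballI exI[of _ "\<lambda>i. if i = k then 1 else 0"] exI[of _ "\<lambda>_ i. if i = k then 1 else 0"])
    (use assms(2) in \<open>simp add: if_distrib[of "\<lambda>x. x * _"] cong: if_cong\<close>)

lemma holomorphic_fun_on_add:
  assumes S: "S \<subseteq> cspace n" and g: "holomorphic_fun_on n S g" and h: "holomorphic_fun_on n S h"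
  shows "holomorphic_fun_on n S (\<lambda>z. g z + h z)"
  unfolding holomorphic_fun_on_slopes[OF S]
proof
  fix z assume z: "z \<in> S"
  obtain a b where b: "\<forall>i<n. ((\<lambda>w. b w i) \<longlongrightarrow> a i) (at z within S)"
    and eq: "\<forall>w\<in>S. g w - g z = (\<Sum>i<n. b w i * (w i - z i))"
    by (rule holomorphic_fun_on_slopesE[OF S g z])
  obtain a' b' where b': "\<forall>i<n. ((\<lambda>w. b' w i) \<longlongrightarrow> a' i) (at z within S)"
    and eq': "\<forall>w\<in>S. h w - h z = (\<Sum>i<n. b' w i * (w i - z i))"
    by (rule holomorphic_fun_on_slopesE[OF S h z])
  show "\<exists>a b. (\<forall>i<n. ((\<lambda>w. b w i) \<longlongrightarrow> a i) (at z within S)) \<and>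
       (\<forall>w\<in>S. g w + h w - (g z + h z) = (\<Sum>i<n. b w i * (w i - z i)))"
  proof (intro exI conjI allI impI ballI)
    show "((\<lambda>w. b w i + b' w i) \<longlongrightarrow> a i + a' i) (at z within S)" if "i < n" for i
      by (intro tendsto_intros b[rule_format] b'[rule_format] that)
    fix w assume w: "w \<in> S"
    have "g w + h w - (g z + h z) = (g w - g z) + (h w - h z)" by simp
    also have "\<dots> = (\<Sum>i<n. b w i * (w i - z i)) + (\<Sum>i<n. b' w i * (w i - z i))"
      using eq eq' w by simp
    finally show "g w + h w - (g z + h z) = (\<Sum>i<n. (b w i + b' w i) * (w i - z i))"
      by (simp only: distrib_right sum.distrib)
  qed
qed

lemma holomorphic_fun_on_mult:
  assumes S: "S \<subseteq> cspace n" and g: "holomorphic_fun_on n S g" and h: "holomorphic_fun_on n S h"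
  shows "holomorphic_fun_on n S (\<lambda>z. g z * h z)"
  unfolding holomorphic_fun_on_slopes[OF S]
proof
  fix z assume z: "z \<in> S"
  have hz: "(h \<longlongrightarrow> h z) (at z within S)"
    using holomorphic_fun_on_imp_continuous_on[OF S h] z by (simp add: continuous_on_def)
  obtain a b where b: "\<forall>i<n. ((\<lambda>w. b w i) \<longlongrightarrow> a i) (at z within S)"
    and eq: "\<forall>w\<in>S. g w - g z = (\<Sum>i<n. b w i * (w i - z i))"
    by (rule holomorphic_fun_on_slopesE[OF S g z])
  obtain a' b' where b': "\<forall>i<n. ((\<lambda>w. b' w i) \<longlongrightarrow> a' i) (at z within S)"
    and eq': "\<forall>w\<in>S. h w - h z = (\<Sum>i<n. b' w i * (w i - z i))"
    by (rule holomorphic_fun_on_slopesE[OF S h z])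
  show "\<exists>a b. (\<forall>i<n. ((\<lambda>w. b w i) \<longlongrightarrow> a i) (at z within S)) \<and>
       (\<forall>w\<in>S. g w * h w - g z * h z = (\<Sum>i<n. b w i * (w i - z i)))"
  proof (intro exI conjI allI impI ballI)
    show "((\<lambda>w. h w * b w i + g z * b' w i) \<longlongrightarrow> h z * a i + g z * a' i) (at z within S)" if "i < n" for i
      by (intro tendsto_intros b[rule_format] b'[rule_format] that hz)
    fix w assume w: "w \<in> S"
    have "g w * h w - g z * h z = h w * (g w - g z) + g z * (h w - h z)" by (simp add: algebra_simps)
    also have "\<dots> = h w * (\<Sum>i<n. b w i * (w i - z i)) + g z * (\<Sum>i<n. b' w i * (w i - z i))"
      using eq eq' w by simp
    finally show "g w * h w - g z * h z = (\<Sum>i<n. (h w * b w i + g z * b' w i) * (w i - z i))"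
      by (simp only: distrib_right sum.distrib sum_distrib_left mult.assoc)
  qed
qed

lemma holomorphic_fun_on_inverse:
  assumes S: "S \<subseteq> cspace n" and g: "holomorphic_fun_on n S g" and nz: "\<And>z. z \<in> S \<Longrightarrow> g z \<noteq> 0"
  shows "holomorphic_fun_on n S (\<lambda>z. inverse (g z))"
  unfolding holomorphic_fun_on_slopes[OF S]
proof
  fix z assume z: "z \<in> S"
  have gz: "(g \<longlongrightarrow> g z) (at z within S)"
    using holomorphic_fun_on_imp_continuous_on[OF S g] z by (simp add: continuous_on_def)
  obtain a b where b: "\<forall>i<n. ((\<lambda>w. b w i) \<longlongrightarrow> a i) (at z within S)"
    and eq: "\<forall>w\<in>S. g w - g z = (\<Sum>i<n. b w i * (w i - z i))"
    by (rule holomorphic_fun_on_slopesE[OF S g z])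
  show "\<exists>a b. (\<forall>i<n. ((\<lambda>w. b w i) \<longlongrightarrow> a i) (at z within S)) \<and>
       (\<forall>w\<in>S. inverse (g w) - inverse (g z) = (\<Sum>i<n. b w i * (w i - z i)))"
  proof (intro exI conjI allI impI ballI)
    show "((\<lambda>w. (- inverse (g w) * inverse (g z)) * b w i) \<longlongrightarrow> (- inverse (g z) * inverse (g z)) * a i) (at z within S)"
      if "i < n" for i
      by (intro tendsto_intros b[rule_format] that gz nz z)
    fix w assume w: "w \<in> S"
    have "inverse (g w) - inverse (g z) = (- inverse (g w) * inverse (g z)) * (g w - g z)"
      using nz[OF z] nz[OF w] by (simp add: field_simps)
    also have "\<dots> = (- inverse (g w) * inverse (g z)) * (\<Sum>i<n. b w i * (w i - z i))"
      using eq w by simp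
    finally show "inverse (g w) - inverse (g z) =
        (\<Sum>i<n. (- inverse (g w) * inverse (g z)) * b w i * (w i - z i))"
      by (simp only: sum_distrib_left mult.assoc)
  qed
qed

lemma holomorphic_fun_on_sum:
  assumes "S \<subseteq> cspace n" "\<And>i. i \<in> I \<Longrightarrow> holomorphic_fun_on n S (g i)"
  shows "holomorphic_fun_on n S (\<lambda>z. \<Sum>i\<in>I. g i z)"
  using assms(2)
  by (induction I rule: infinite_finite_induct)
    (simp_all add: holomorphic_fun_on_const[OF assms(1)] holomorphic_fun_on_add[OF assms(1)])

lemma holomorphic_fun_on_cinner:
  assumes "S \<subseteq> cspace n"
  shows "holomorphic_fun_on n S (\<lambda>z. cinner n z b)"
  unfolding cinner_def
  by (intro holomorphic_fun_on_sum holomorphic_fun_on_mult holomorphic_fun_on_coordinate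
      holomorphic_fun_on_const assms) auto

lemma mobius_in_Aut_ball:
  assumes b: "b \<in> uball n"
  shows "restrict (mobius n b) (uball n) \<in> Aut_ball n"
proof -
  let ?B = "uball n"
  have b1: "cnorm n b < 1" using b by (rule uballD)
  have nz: "1 - cinner n z b \<noteq> 0" if "z \<in> ?B" for z
    by (rule one_minus_cinner_nz[OF uballD(2)[OF that] b1])
  have inv: "mobius n b (mobius n b z) = z" if "z \<in> ?B" for z
    by (rule mobius_involution[OF b1 nz[OF that]])
  have bij: "bij_betw (restrict (mobius n b) ?B) ?B ?B"
    by (rule bij_betwI[where g = "mobius n b"]) (auto simp: mobius_in_uball[OF b] inv)
  have inv_into: "inv_into ?B (restrict (mobius n b) ?B) z = mobius n b z" if "z \<in> ?B" for z
    using bij that inv mobius_in_uball[OF b that]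
    by (intro inv_into_f_eq) (auto simp: bij_betw_def)
  have hol: "holomorphic_map_on n n ?B (mobius n b)"
    unfolding holomorphic_map_on_def
  proof (intro conjI allI impI)
    show "mobius n b \<in> ?B \<rightarrow> cspace n" using mobius_in_uball[OF b] uball_subset by blast
    fix j assume j: "j < n"
    define s where "s = complex_of_real (sqrt (1 - (cnorm n b)\<^sup>2))"
    have "holomorphic_fun_on n ?B (\<lambda>z. ((1 + cinner n z b * (- 1 / (1 + s))) * b j + (- s) * z j)
          * inverse (1 + (- 1) * cinner n z b))"
      by (intro holomorphic_fun_on_mult holomorphic_fun_on_add holomorphic_fun_on_const
          holomorphic_fun_on_inverse holomorphic_fun_on_cinner holomorphic_fun_on_coordinate uball_subset j)
        (use nz in simp)
    moreover have "(\<lambda>z. ((1 + cinner n z b * (- 1 / (1 + s))) * b j + (- s) * z j)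
          * inverse (1 + (- 1) * cinner n z b)) = (\<lambda>z. mobius n b z j)"
      by (simp add: mobius_def Let_def s_def divide_inverse)
    ultimately show "holomorphic_fun_on n ?B (\<lambda>z. mobius n b z j)" by simp
  qed
  have "holomorphic_map_on n n ?B (restrict (mobius n b) ?B)"
    using holomorphic_map_on_cong[of ?B "restrict (mobius n b) ?B" "mobius n b"] hol by simp
  moreover have "holomorphic_map_on n n ?B (inv_into ?B (restrict (mobius n b) ?B))"
    by (rule iffD2[OF holomorphic_map_on_cong[OF inv_into] hol])
  ultimately show ?thesis using bij by (simp add: Aut_ball_def Bij_def)
qed

section \<open>Automorphisms of the ball\<close>

lemma continuous_line: "continuous_on UNIV (\<lambda>t i. t * z i :: complex)"
  by (intro continuous_on_coordinatewise_then_product continuous_intros)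

lemma filterlim_line:
  assumes z: "z \<in> cspace n" "z \<noteq> (\<lambda>i. 0)" and t: "cmod t0 * cnorm n z < 1"
  shows "filterlim (\<lambda>t i. t * z i) (at (\<lambda>i. t0 * z i) within uball n) (at t0)"
  unfolding filterlim_at
proof
  have "((\<lambda>t. cmod t * cnorm n z) \<longlongrightarrow> cmod t0 * cnorm n z) (at t0)" by (intro tendsto_intros)
  then have "\<forall>\<^sub>F t in at t0. cmod t * cnorm n z < 1" using t by (rule order_tendstoD)
  moreover have "\<forall>\<^sub>F t in at t0. t \<noteq> t0" by (simp add: eventually_at_filter)
  ultimately show "\<forall>\<^sub>F t in at t0. (\<lambda>i. t * z i) \<in> uball n \<and> (\<lambda>i. t * z i) \<noteq> (\<lambda>i. t0 * z i)"
  proof eventually_elim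
    case (elim t)
    obtain i where "z i \<noteq> 0" using z by auto
    then have "(\<lambda>i. t * z i) \<noteq> (\<lambda>i. t0 * z i)" using elim by (metis mult_cancel_right)
    with elim z show ?case by (simp add: uball_def cnorm_scale scale_in_cspace)
  qed
  have "isCont (\<lambda>t i. t * z i) t0"
    using continuous_line[of z] by (simp add: continuous_on_eq_continuous_at)
  then show "((\<lambda>t i. t * z i) \<longlongrightarrow> (\<lambda>i. t0 * z i)) (at t0)" by (rule isContD)
qed

lemma holomorphic_slice:
  assumes g: "holomorphic_fun_on n (uball n) g" and z: "z \<in> cspace n" "cnorm n z \<le> 1"
  shows "(\<lambda>t. g (\<lambda>i. t * z i)) holomorphic_on ball 0 1"
proof (cases "z = (\<lambda>i. 0)")
  case False
  have "\<exists>D. ((\<lambda>t. g (\<lambda>i. t * z i)) has_field_derivative D) (at t0)" if t0: "t0 \<in> ball 0 1" for t0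
  proof -
    have small: "cmod t0 * cnorm n z < 1"
      using t0 z(2) mult_right_le_one_le[of "cmod t0" "cnorm n z"] by simp
    then have in_ball: "(\<lambda>i. t0 * z i) \<in> uball n"
      using z by (simp add: uball_def cnorm_scale scale_in_cspace)
    obtain a b where b: "\<forall>i<n. ((\<lambda>w. b w i) \<longlongrightarrow> a i) (at (\<lambda>i. t0 * z i) within uball n)"
      and eq: "\<forall>w\<in>uball n. g w - g (\<lambda>i. t0 * z i) = (\<Sum>i<n. b w i * (w i - t0 * z i))"
      by (rule holomorphic_fun_on_slopesE[OF uball_subset g in_ball])
    note lim = filterlim_line[OF z(1) False small]
    have "((\<lambda>t. \<Sum>i<n. b (\<lambda>i. t * z i) i * z i) \<longlongrightarrow> (\<Sum>i<n. a i * z i)) (at t0)"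
      by (intro tendsto_sum tendsto_mult tendsto_const filterlim_compose[OF b[rule_format] lim]) auto
    moreover have "\<forall>\<^sub>F t in at t0. (\<Sum>i<n. b (\<lambda>i. t * z i) i * z i) =
        (g (\<lambda>i. t * z i) - g (\<lambda>i. t0 * z i)) / (t - t0)"
    proof -
      have "\<forall>\<^sub>F t in at t0. (\<lambda>i. t * z i) \<in> uball n" "\<forall>\<^sub>F t in at t0. t \<noteq> t0"
        using lim by (auto simp: filterlim_at eventually_conj_iff) (simp add: eventually_at_filter)
      then show ?thesis
      proof eventually_elim
        case (elim t)
        have "(\<Sum>i<n. b (\<lambda>i. t * z i) i * (t * z i - t0 * z i)) =
            (\<Sum>i<n. b (\<lambda>i. t * z i) i * z i) * (t - t0)"
          unfolding sum_distrib_right by (intro sum.cong refl) (simp add: algebra_simps)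
        then show ?case using bspec[OF eq elim(1)] elim(2) by (simp add: eq_divide_eq)
      qed
    qed
    ultimately show ?thesis unfolding has_field_derivative_iff
      by (intro exI) (rule Lim_transform_eventually)
  qed
  then show ?thesis by (simp add: holomorphic_on_open)
qed simp

text \<open>Restriction to a complex line and pairing with a vector of norm at most 1 reduce maps between
  balls to self-maps of the disc, where Schwarz's lemma applies.\<close>

lemma ball_map_slice:
  assumes F: "holomorphic_map_on n N (uball n) F" "F \<in> uball n \<rightarrow> uball N"
    and z: "z \<in> cspace n" "cnorm n z \<le> 1" and w: "cnorm N w \<le> 1"
  shows "(\<lambda>t. cinner N (F (\<lambda>i. t * z i)) w) holomorphic_on ball 0 1"
    and "cmod t < 1 \<Longrightarrow> cmod (cinner N (F (\<lambda>i. t * z i)) w) < 1"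
proof -
  show "(\<lambda>t. cinner N (F (\<lambda>i. t * z i)) w) holomorphic_on ball 0 1"
    unfolding cinner_def
    by (intro holomorphic_on_sum holomorphic_on_mult holomorphic_on_const
        holomorphic_slice[where n = n and g = "\<lambda>z. F z _"] z)
      (use F in \<open>simp add: holomorphic_map_on_def\<close>)
  assume "cmod t < 1"
  then have "(\<lambda>i. t * z i) \<in> uball n"
    using z mult_right_le_one_le[of "cmod t" "cnorm n z"] by (simp add: uball_def cnorm_scale scale_in_cspace)
  then have "cnorm N (F (\<lambda>i. t * z i)) < 1" using F by (auto dest: uballD)
  moreover have "cmod (cinner N (F (\<lambda>i. t * z i)) w) \<le> cnorm N (F (\<lambda>i. t * z i)) * 1"
    by (rule order_trans[OF cinner_le mult_left_mono[OF w]]) simp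
  ultimately show "cmod (cinner N (F (\<lambda>i. t * z i)) w) < 1" by simp
qed

lemma ball_map_schwarz:
  assumes F: "holomorphic_map_on n N (uball n) F" "F \<in> uball n \<rightarrow> uball N"
    and F0: "F (\<lambda>i. 0) = (\<lambda>i. 0)" and z: "z \<in> uball n"
  shows "cnorm N (F z) \<le> cnorm n z"
proof (cases "cnorm n z = 0 \<or> cnorm N (F z) = 0")
  case True
  then show ?thesis using cnorm_eq_0[OF uballD(1)[OF z]] F0 by (auto simp: cnorm_def[of _ "\<lambda>i. 0"])
next
  case False
  define s where "s = cnorm n z"
  define r where "r = cnorm N (F z)"
  have s: "0 < s" "s < 1" and r: "0 < r"
    using False z by (simp_all add: s_def r_def less_le[of 0] uballD)
  define x where "x = (\<lambda>i. of_real (1 / s) * z i)"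
  define w where "w = (\<lambda>i. of_real (1 / r) * F z i)"
  have x: "x \<in> cspace n" "cnorm n x \<le> 1"
    unfolding x_def cnorm_scale s_def[symmetric]
    using s by (simp_all only: scale_in_cspace[OF uballD(1)[OF z]]) (simp add: norm_divide)
  have w: "cnorm N w \<le> 1" using r unfolding w_def cnorm_scale r_def[symmetric] by (simp add: norm_divide)
  have sx: "(\<lambda>i. of_real s * x i) = z" using s by (simp add: x_def fun_eq_iff)
  have "cmod (cinner N (F (\<lambda>i. of_real s * x i)) w) \<le> cmod (of_real s)"
    by (rule Schwarz_Lemma(1)[OF ball_map_slice(1)[OF F x w] _ ball_map_slice(2)[OF F x w]])
      (use s in \<open>simp_all add: F0 cinner_def\<close>)
  also have "cinner N (F (\<lambda>i. of_real s * x i)) w = of_real r"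
    unfolding sx w_def cinner_scale_right cinner_self r_def[symmetric] using r by (simp add: power2_eq_square)
  finally show ?thesis using s r by (simp add: s_def r_def)
qed

text \<open>A norm-preserving map attains equality in Schwarz's lemma on every complex line through the
  origin, so \<open>\<langle>F (t z), F z\<rangle> = t \<parallel>z\<parallel>\<^sup>2\<close>. As \<open>F (t z)\<close> and \<open>t F z\<close> have the same norm, this is equality in
  the Cauchy--Schwarz inequality.\<close>

lemma norm_preserving_homogeneous:
  assumes F: "holomorphic_map_on n N (uball n) F" "F \<in> uball n \<rightarrow> uball N"
    and norm: "\<And>z. z \<in> uball n \<Longrightarrow> cnorm N (F z) = cnorm n z"
    and z: "z \<in> uball n" and t: "cmod t \<le> 1"
  shows "F (\<lambda>i. t * z i) = (\<lambda>i. t * F z i)"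
proof -
  have FN: "F z \<in> cspace N" if "z \<in> uball n" for z using F that by (auto dest: uballD)
  have F0: "F (\<lambda>i. 0) = (\<lambda>i. 0)"
    using norm[OF zero_in_uball] cnorm_eq_0[OF FN[OF zero_in_uball]] by (simp add: cnorm_def)
  show ?thesis
  proof (cases "cnorm n z = 0")
    case True
    then show ?thesis using cnorm_eq_0[OF uballD(1)[OF z]] F0 by simp
  next
    case False
    define s where "s = cnorm n z"
    have s: "0 < s" "s < 1" using False z by (simp_all add: s_def less_le[of 0] uballD)
    define x where "x = (\<lambda>i. of_real (1 / s) * z i)"
    define w where "w = (\<lambda>i. of_real (1 / s) * F z i)"
    define h where "h t = cinner N (F (\<lambda>i. t * x i)) w" for t
    have x: "x \<in> cspace n" "cnorm n x \<le> 1"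
      unfolding x_def cnorm_scale s_def[symmetric]
      using s by (simp_all only: scale_in_cspace[OF uballD(1)[OF z]]) (simp add: norm_divide)
    have w: "cnorm N w \<le> 1" using s unfolding w_def cnorm_scale norm[OF z] s_def[symmetric] by (simp add: norm_divide)
    have sx: "(\<lambda>i. of_real s * x i) = z" using s by (simp add: x_def fun_eq_iff)
    have hs: "h (of_real s) = of_real s"
      unfolding h_def sx w_def cinner_scale_right cinner_self norm[OF z] s_def[symmetric]
      using s by (simp add: power2_eq_square)
    have "\<exists>\<alpha>. (\<forall>t. norm t < 1 \<longrightarrow> h t = \<alpha> * t) \<and> norm \<alpha> = 1"
      unfolding h_def
      by (rule Schwarz_Lemma(3)[OF ball_map_slice(1)[OF F x w] _ ball_map_slice(2)[OF F x w], of 0])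
        (use s hs in \<open>auto simp: F0 cinner_def h_def intro!: exI[of _ "of_real s"]\<close>)
    then obtain \<alpha> where \<alpha>: "h t = \<alpha> * t" if "norm t < 1" for t by blast
    have "\<alpha> = 1" using \<alpha>[of "of_real s"] hs s by simp
    moreover have ts: "cmod (t * of_real s) < 1"
      using le_less_trans[OF mult_left_mono[OF t, of s], of 1] s by (simp add: norm_mult mult.commute)
    ultimately have "h (t * of_real s) = t * of_real s" using \<alpha> by simp
    moreover have "(\<lambda>i. t * of_real s * x i) = (\<lambda>i. t * z i)" using s by (simp add: x_def fun_eq_iff)
    ultimately have h: "cinner N (F (\<lambda>i. t * z i)) (F z) = t * of_real (s\<^sup>2)"
      using s by (simp add: h_def w_def cinner_scale_right[of N _ "1 / of_real s", simplified] divide_simps power2_eq_square)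
    have tz: "(\<lambda>i. t * z i) \<in> uball n" by (rule scale_in_uball[OF z t])
    show ?thesis
    proof (rule eq_of_cinner_eq)
      show "F (\<lambda>i. t * z i) \<in> cspace N" by (rule FN[OF tz])
      show "(\<lambda>i. t * F z i) \<in> cspace N" by (rule scale_in_cspace[OF FN[OF z]])
      show "(cnorm N (F (\<lambda>i. t * z i)))\<^sup>2 \<le> (cmod t * s)\<^sup>2"
        by (simp add: norm[OF tz] cnorm_scale s_def)
      show "(cnorm N (\<lambda>i. t * F z i))\<^sup>2 \<le> (cmod t * s)\<^sup>2"
        by (simp add: norm[OF z] cnorm_scale s_def)
      have "cnj t * (t * of_real (s\<^sup>2)) = of_real ((cmod t * s)\<^sup>2)"
        by (simp only: power_mult_distrib of_real_mult complex_norm_square) (simp only: mult_ac)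
      then show "Re (cinner N (F (\<lambda>i. t * z i)) (\<lambda>i. t * F z i)) = (cmod t * s)\<^sup>2"
        unfolding cinner_scale_right h by simp
    qed
  qed
qed

lemma matrix_map_comb:
  "matrix_map n U (\<lambda>i. a * z i + c * w i) = (\<lambda>i. a * matrix_map n U z i + c * matrix_map n U w i)"
  by (auto simp: matrix_map_def fun_eq_iff distrib_left sum.distrib sum_distrib_left mult_ac)

lemma matrix_map_scale: "matrix_map n U (\<lambda>i. a * z i) = (\<lambda>i. a * matrix_map n U z i)"
  using matrix_map_comb[of n U a z 0 z] by simp

lemma matrix_map_in_cspace: "matrix_map n U z \<in> cspace n"
  by (simp add: matrix_map_def cspace_def)

lemma matrix_map_in_uball:
  assumes "unitary_matrix n U" "z \<in> uball n"
  shows "matrix_map n U z \<in> uball n"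
  using assms cnorm_unitary[of n U z] by (simp add: uball_def matrix_map_in_cspace)

lemma unitary_inverse:
  assumes U: "unitary_matrix n U" and z: "z \<in> cspace n"
  shows "matrix_map n (\<lambda>i j. cnj (U j i)) (matrix_map n U z) = z"
    and "matrix_map n U (matrix_map n (\<lambda>i j. cnj (U j i)) z) = z"
  using U by (auto intro!: matrix_map_inverse[OF z] simp: unitary_matrix_def)

lemma cinner_norm_preserving:
  assumes "\<And>z. z \<in> cspace n \<Longrightarrow> cnorm n (matrix_map n U z) = cnorm n z"
    and z: "z \<in> cspace n" "w \<in> cspace n"
  shows "cinner n (matrix_map n U z) (matrix_map n U w) = cinner n z w"
proof -
  have norm: "(cnorm n (matrix_map n U (\<lambda>i. 1 * z i + c * w i)))\<^sup>2 = (cnorm n (\<lambda>i. 1 * z i + c * w i))\<^sup>2" for c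
    using z by (subst assms(1)) (auto simp: cspace_def)
  have *: "Re (cnj c * cinner n (matrix_map n U z) (matrix_map n U w)) = Re (cnj c * cinner n z w)" for c
    using norm[of c] unfolding matrix_map_comb cnorm_comb_sq by (simp add: assms(1) z)
  show ?thesis using *[of 1] *[of \<i>] by (simp add: complex_eq_iff)
qed

lemma cinner_unitary:
  assumes "unitary_matrix n U" "z \<in> cspace n" "w \<in> cspace n"
  shows "cinner n (matrix_map n U z) (matrix_map n U w) = cinner n z w"
  using assms by (intro cinner_norm_preserving cnorm_unitary)

text \<open>Polarization makes the columns orthonormal. Then the adjoint of \<open>U\<close> is a left inverse of
  \<open>U\<close>; it is a right inverse as well because \<open>U\<close> is onto, which gives the rows.\<close>

lemma unitary_matrixI:
  assumes norm: "\<And>z. z \<in> uball n \<Longrightarrow> cnorm n (matrix_map n U z) = cnorm n z"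
    and surj: "uball n \<subseteq> matrix_map n U ` uball n"
  shows "unitary_matrix n U"
proof -
  have norm': "cnorm n (matrix_map n U z) = cnorm n z" if z: "z \<in> cspace n" for z
  proof -
    define r where "r = 1 / (1 + cnorm n z)"
    have "1 + cnorm n z > 0" using cnorm_nonneg[of n z] by linarith
    then have r: "r > 0" "r * cnorm n z < 1" by (auto simp: r_def)
    then have "(\<lambda>i. of_real r * z i) \<in> uball n"
      using z by (simp add: uball_def cnorm_scale scale_in_cspace)
    from norm[OF this] r show ?thesis by (simp add: matrix_map_scale cnorm_scale)
  qed
  define e :: "nat \<Rightarrow> nat \<Rightarrow> complex" where "e i = (\<lambda>k. if k = i then 1 else 0)" for i
  have e: "e i \<in> cspace n" if "i < n" for i using that by (simp add: e_def cspace_def)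
  have Ue: "matrix_map n V (e i) k = V k i" if "i < n" "k < n" for V i k
    using that by (simp add: matrix_map_def e_def if_distrib[of "\<lambda>x. _ * x"] cong: if_cong)
  have columns: "(\<Sum>k<n. cnj (U k i) * U k j) = (if i = j then 1 else 0)" if "i < n" "j < n" for i j
  proof -
    have "(\<Sum>k<n. cnj (U k i) * U k j) = cinner n (matrix_map n U (e j)) (matrix_map n U (e i))"
      using that by (simp add: cinner_def Ue mult.commute)
    also have "\<dots> = cinner n (e j) (e i)"
      using that e by (intro cinner_norm_preserving norm')
    finally show ?thesis using that
      by (simp add: cinner_def e_def if_distrib[of cnj] if_distrib[of "\<lambda>x. _ * x"] cong: if_cong)
  qed
  define V where "V = (\<lambda>i j. cnj (U j i))"
  have VU: "matrix_map n V (matrix_map n U z) = z" if "z \<in> cspace n" for z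
    using columns by (intro matrix_map_inverse[OF that]) (simp add: V_def)
  have "(\<Sum>k<n. U i k * cnj (U j k)) = (if i = j then 1 else 0)" if ij: "i < n" "j < n" for i j
  proof -
    define x where "x = (\<lambda>k. 1 / 2 * e j k)"
    have "cnorm n (e j) = 1" using ij by (simp add: cnorm_def e_def if_distrib[of "\<lambda>x. (cmod x)\<^sup>2"] cong: if_cong)
    then have "cnorm n x = 1 / 2" by (simp only: x_def cnorm_scale) (simp add: norm_divide)
    then have "x \<in> uball n" using e[OF ij(2)] by (simp add: uball_def x_def cspace_def)
    then obtain z where z: "z \<in> uball n" "x = matrix_map n U z" using surj by blast
    have "matrix_map n U (matrix_map n V x) = x"
      using VU[of z] z by (simp add: uballD)
    then have "matrix_map n U (matrix_map n V (e j)) i = e j i"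
      unfolding x_def matrix_map_scale by (simp add: fun_eq_iff)
    moreover have "matrix_map n U (matrix_map n V (e j)) i = (\<Sum>k<n. U i k * cnj (U j k))"
      unfolding matrix_map_def[of n U] using ij by (simp add: Ue) (simp add: V_def)
    ultimately show ?thesis by (simp add: e_def)
  qed
  with columns show ?thesis by (simp add: unitary_matrix_def)
qed

lemma Aut_ballD:
  assumes "F \<in> Aut_ball n"
  shows "bij_betw F (uball n) (uball n)" "F \<in> extensional (uball n)"
    "holomorphic_map_on n n (uball n) F" "holomorphic_map_on n n (uball n) (inv_into (uball n) F)"
  using assms by (auto simp: Aut_ball_def Bij_def)

lemma Aut_ball_in_uball: "F \<in> Aut_ball n \<Longrightarrow> z \<in> uball n \<Longrightarrow> F z \<in> uball n"
  using Aut_ballD(1) bij_betwE by blast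

lemma Aut_ball_compose:
  "F \<in> Aut_ball n \<Longrightarrow> H \<in> Aut_ball n \<Longrightarrow> compose (uball n) F H \<in> Aut_ball n"
  using subgroup.m_closed[OF subgroup_Aut_ball, of F n H]
  by (auto simp: BijGroup_def Aut_ball_def)

lemma subgroup_Aut_groupD:
  assumes G: "subgroup G (Aut_group n)"
  shows "\<gamma> \<in> G \<Longrightarrow> \<gamma> \<in> Aut_ball n"
    and "(\<lambda>z\<in>uball n. z) \<in> G"
    and "\<delta> \<in> G \<Longrightarrow> \<gamma> \<in> G \<Longrightarrow> compose (uball n) \<delta> \<gamma> \<in> G"
proof -
  show aut: "\<gamma> \<in> Aut_ball n" if "\<gamma> \<in> G" for \<gamma>
    using subgroup.mem_carrier[OF G that] by (simp add: Aut_group_def)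
  show "(\<lambda>z\<in>uball n. z) \<in> G"
    using subgroup.one_closed[OF G] by (simp add: Aut_group_def BijGroup_def)
  show "compose (uball n) \<delta> \<gamma> \<in> G" if "\<delta> \<in> G" "\<gamma> \<in> G"
    using subgroup.m_closed[OF G that] that[THEN aut]
    by (simp add: Aut_group_def BijGroup_def Aut_ball_def)
qed

lemma Aut_ball_eqI:
  "F \<in> Aut_ball n \<Longrightarrow> H \<in> Aut_ball n \<Longrightarrow> (\<And>z. z \<in> uball n \<Longrightarrow> F z = H z) \<Longrightarrow> F = H"
  by (rule extensionalityI[where A = "uball n"]) (auto dest: Aut_ballD)

text \<open>By Schwarz's lemma for the map and for its inverse, the map preserves the norm, hence it is
  homogeneous of degree 1. Letting \<open>t\<close> tend to \<open>0\<close> in \<open>F z = F (t z) / t\<close> then identifies \<open>F\<close> with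
  its derivative at \<open>0\<close>.\<close>

lemma Aut_ball_fixing_0:
  assumes F: "F \<in> Aut_ball n" and F0: "F (\<lambda>i. 0) = (\<lambda>i. 0)"
  shows "\<exists>U. unitary_matrix n U \<and> F = restrict (matrix_map n U) (uball n)"
proof -
  note bij = Aut_ballD(1)[OF F] and hol = Aut_ballD(3)[OF F] and hol' = Aut_ballD(4)[OF F]
  have maps: "F \<in> uball n \<rightarrow> uball n" "inv_into (uball n) F \<in> uball n \<rightarrow> uball n"
    using bij bij_betw_inv_into[OF bij] by (auto simp: bij_betw_def)
  have inv: "inv_into (uball n) F (F z) = z" if "z \<in> uball n" for z
    using bij that by (simp add: bij_betw_inv_into_left)
  have norm: "cnorm n (F z) = cnorm n z" if z: "z \<in> uball n" for z
  proof (rule antisym)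
    show "cnorm n (F z) \<le> cnorm n z" by (rule ball_map_schwarz[OF hol maps(1) F0 z])
    have "F z \<in> uball n" using maps z by blast
    from ball_map_schwarz[OF hol' maps(2) _ this] show "cnorm n z \<le> cnorm n (F z)"
      using inv[OF zero_in_uball] inv[OF z] by (simp add: F0)
  qed
  note hom = norm_preserving_homogeneous[OF hol maps(1) norm]
  have "\<exists>a. \<forall>z\<in>uball n. F z j = (\<Sum>i<n. a i * z i)" if j: "j < n" for j
  proof -
    have "holomorphic_fun_on n (uball n) (\<lambda>z. F z j)"
      using hol j by (simp add: holomorphic_map_on_def)
    then obtain a b where b: "\<forall>i<n. ((\<lambda>w. b w i) \<longlongrightarrow> a i) (at (\<lambda>i. 0) within uball n)"
      and eq: "\<forall>w\<in>uball n. F w j - F (\<lambda>i. 0) j = (\<Sum>i<n. b w i * (w i - 0))"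
      by (rule holomorphic_fun_on_slopesE[OF uball_subset _ zero_in_uball])
    have "F z j = (\<Sum>i<n. a i * z i)" if z: "z \<in> uball n" for z
    proof (cases "z = (\<lambda>i. 0)")
      case False
      have lim: "filterlim (\<lambda>t i. t * z i) (at (\<lambda>i. 0) within uball n) (at 0)"
        using filterlim_line[OF uballD(1)[OF z] False, of 0] by simp
      have 1: "((\<lambda>t. \<Sum>i<n. b (\<lambda>i. t * z i) i * z i) \<longlongrightarrow> (\<Sum>i<n. a i * z i)) (at 0)"
        by (intro tendsto_sum tendsto_mult tendsto_const filterlim_compose[OF b[rule_format] lim]) auto
      have "\<forall>\<^sub>F t in at (0::complex). cmod t < 1"
        by (rule order_tendstoD(2)[OF tendsto_norm_zero]) (auto intro: tendsto_ident_at)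
      moreover have "\<forall>\<^sub>F t in at (0::complex). t \<noteq> 0" by (simp add: eventually_at_filter)
      ultimately have "\<forall>\<^sub>F t in at 0. (\<Sum>i<n. b (\<lambda>i. t * z i) i * z i) = F z j"
      proof eventually_elim
        case (elim t)
        have "F (\<lambda>i. t * z i) j = (\<Sum>i<n. b (\<lambda>i. t * z i) i * (t * z i))"
          using bspec[OF eq scale_in_uball[OF z, of t]] elim by (simp add: F0)
        also have "\<dots> = t * (\<Sum>i<n. b (\<lambda>i. t * z i) i * z i)"
          by (simp add: sum_distrib_left mult_ac)
        finally show ?case using hom[OF _ z, of t] elim by simp
      qed
      from Lim_transform_eventually[OF 1 this] show ?thesis
        by (simp add: tendsto_const_iff)
    qed (simp add: F0)
    then show ?thesis by blast
  qed
  then obtain U where U: "F z j = (\<Sum>i<n. U j i * z i)" if "j < n" "z \<in> uball n" for j z by metis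
  have FU: "F z = matrix_map n U z" if z: "z \<in> uball n" for z
  proof (rule cspace_eqI[OF _ matrix_map_in_cspace])
    show "F z \<in> cspace n" using z maps by (auto dest: uballD)
    show "F z i = matrix_map n U z i" if "i < n" for i using U[OF that z] that by (simp add: matrix_map_def)
  qed
  have "unitary_matrix n U"
  proof (rule unitary_matrixI)
    show "cnorm n (matrix_map n U z) = cnorm n z" if "z \<in> uball n" for z
      using norm[OF that] FU[OF that] by simp
    show "uball n \<subseteq> matrix_map n U ` uball n"
      using bij FU by (auto simp: bij_betw_def)
  qed
  moreover have "F = restrict (matrix_map n U) (uball n)"
    by (rule extensionalityI[OF Aut_ballD(2)[OF F]]) (auto simp: FU)
  ultimately show ?thesis by blast
qed

text \<open>Composing \<open>F\<close> with the involution that exchanges \<open>0\<close> and the zero of \<open>F\<close> gives an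
  automorphism that fixes \<open>0\<close>.\<close>

lemma Aut_ball_decomp:
  assumes F: "F \<in> Aut_ball n"
  obtains b U where "b \<in> uball n" "unitary_matrix n U"
    "F b = (\<lambda>i. 0)" "\<And>z. z \<in> uball n \<Longrightarrow> F z = matrix_map n U (mobius n b z)"
proof -
  have "(\<lambda>i. 0) \<in> F ` uball n"
    using Aut_ballD(1)[OF F] zero_in_uball by (simp add: bij_betw_def)
  then obtain b where b: "b \<in> uball n" "F b = (\<lambda>i. 0)" by (metis imageE)
  let ?H = "compose (uball n) F (restrict (mobius n b) (uball n))"
  have "?H \<in> Aut_ball n" by (rule Aut_ball_compose[OF F mobius_in_Aut_ball[OF b(1)]])
  moreover have "?H (\<lambda>i. 0) = (\<lambda>i. 0)" using b zero_in_uball by (simp add: compose_eq mobius_zero)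
  ultimately obtain U where U: "unitary_matrix n U" "?H = restrict (matrix_map n U) (uball n)"
    using Aut_ball_fixing_0 by blast
  have "F z = matrix_map n U (mobius n b z)" if z: "z \<in> uball n" for z
  proof -
    have bz: "mobius n b z \<in> uball n" by (rule mobius_in_uball[OF b(1) z])
    have inv: "mobius n b (mobius n b z) = z"
      using b z by (intro mobius_involution one_minus_cinner_nz) (auto dest: uballD)
    have "?H (mobius n b z) = F z" using bz by (simp add: compose_eq inv)
    then show ?thesis using U bz by simp
  qed
  with b U that show thesis by blast
qed

lemma Aut_ball_norm:
  assumes F: "F \<in> Aut_ball n"
  obtains b where "b \<in> uball n" "\<And>z. z \<in> uball n \<Longrightarrow>
    1 - (cnorm n (F z))\<^sup>2 = (1 - (cnorm n b)\<^sup>2) * (1 - (cnorm n z)\<^sup>2) / (cmod (1 - cinner n z b))\<^sup>2"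
proof -
  obtain b U where b: "b \<in> uball n" and U: "unitary_matrix n U"
    and F: "\<And>z. z \<in> uball n \<Longrightarrow> F z = matrix_map n U (mobius n b z)"
    using Aut_ball_decomp[OF F] by metis
  show thesis
  proof (rule that[OF b])
    fix z assume z: "z \<in> uball n"
    show "1 - (cnorm n (F z))\<^sup>2 = (1 - (cnorm n b)\<^sup>2) * (1 - (cnorm n z)\<^sup>2) / (cmod (1 - cinner n z b))\<^sup>2"
      unfolding F[OF z] cnorm_unitary[OF U]
      by (rule mobius_norm[OF uballD(2)[OF b] one_minus_cinner_nz[OF uballD(2)[OF z] uballD(2)[OF b]]])
  qed
qed

section \<open>Finite groups of automorphisms have a fixed point\<close>

lemma continuous_on_cnorm: "continuous_on S (cnorm n)"
  unfolding cnorm_def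
  by (intro continuous_intros continuous_on_subset[OF continuous_on_product_coordinates]) auto

lemma compact_closed_uball: "compact {z \<in> cspace n. cnorm n z \<le> r}"
proof -
  define S :: "nat \<Rightarrow> complex set" where "S i = (if i < n then cball 0 r else {0})" for i
  have "compactin (product_topology (\<lambda>i. euclidean) UNIV) (PiE UNIV S)"
    unfolding compactin_PiE by (auto simp: S_def)
  then have "compact (PiE UNIV S)" by (simp add: euclidean_product_topology)
  then have "compact (PiE UNIV S \<inter> {z. cnorm n z \<le> r})"
    by (rule compact_Int_closed) (intro closed_Collect_le continuous_on_cnorm continuous_on_const)
  also have "PiE UNIV S \<inter> {z. cnorm n z \<le> r} = {z \<in> cspace n. cnorm n z \<le> r}"
  proof -
    have "z \<in> PiE UNIV S" if "z \<in> cspace n" "cnorm n z \<le> r" for z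
      using that norm_le_cnorm[of _ n z] by (force simp: S_def cspace_def)
    moreover have "z \<in> cspace n" if "z \<in> PiE UNIV S" for z
      unfolding cspace_def
    proof (intro CollectI allI impI)
      fix i assume "n \<le> i"
      then show "z i = 0" using PiE_mem[OF that, of i] by (simp add: S_def)
    qed
    ultimately show ?thesis by blast
  qed
  finally show ?thesis .
qed

text \<open>The sum of \<open>1 / (1 - \<parallel>\<gamma> z\<parallel>\<^sup>2)\<close> over the group is invariant, tends to infinity at the sphere and
  so attains a minimum \<open>r\<close>. By the formula for \<open>1 - \<parallel>\<gamma> z\<parallel>\<^sup>2\<close> it has the form \<open>q z / (1 - \<parallel>z\<parallel>\<^sup>2)\<close> with
  \<open>q\<close> a sum of squared moduli of affine functions. So \<open>q z - r (1 - \<parallel>z\<parallel>\<^sup>2)\<close> is a strictly convex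
  function on the ball with minimum \<open>0\<close>: the minimum is attained at one point only, which the group fixes.\<close>

lemma finite_group_fixed_point:
  assumes G: "subgroup G (Aut_group n)" and fin: "finite G"
  obtains p where "p \<in> uball n" "\<And>\<gamma>. \<gamma> \<in> G \<Longrightarrow> \<gamma> p = p"
proof -
  let ?B = "uball n"
  note aut = subgroup_Aut_groupD(1)[OF G] and id = subgroup_Aut_groupD(2)[OF G] and mult = subgroup_Aut_groupD(3)[OF G]
  define h where "h z = (\<Sum>\<gamma>\<in>G. 1 / (1 - (cnorm n (\<gamma> z))\<^sup>2))" for z
  have sq1: "(cnorm n z)\<^sup>2 < 1" if "z \<in> ?B" for z using uballD(2)[OF that] by (simp add: abs_square_less_1)
  have h_inv: "h (\<gamma> z) = h z" if \<gamma>: "\<gamma> \<in> G" and z: "z \<in> ?B" for \<gamma> z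
  proof -
    have "inj_on (\<lambda>\<delta>. compose ?B \<delta> \<gamma>) G"
    proof (rule inj_onI)
      fix \<delta> \<delta>' assume *: "\<delta> \<in> G" "\<delta>' \<in> G" "compose ?B \<delta> \<gamma> = compose ?B \<delta>' \<gamma>"
      show "\<delta> = \<delta>'"
      proof (rule Aut_ball_eqI[OF aut[OF *(1)] aut[OF *(2)]])
        fix w assume "w \<in> ?B"
        then obtain v where "v \<in> ?B" "\<gamma> v = w"
          using Aut_ballD(1)[OF aut[OF \<gamma>]] by (metis bij_betw_def imageE)
        then show "\<delta> w = \<delta>' w" using fun_cong[OF *(3), of v] by (simp add: compose_eq)
      qed
    qed
    then have "bij_betw (\<lambda>\<delta>. compose ?B \<delta> \<gamma>) G G"
      using fin \<gamma> mult by (intro bij_betw_imageI endo_inj_surj) auto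
    then have "h z = (\<Sum>\<delta>\<in>G. 1 / (1 - (cnorm n (compose ?B \<delta> \<gamma> z))\<^sup>2))"
      unfolding h_def by (rule sum.reindex_bij_betw[symmetric])
    then show ?thesis using z by (simp add: h_def compose_eq)
  qed
  have ge: "1 / (1 - (cnorm n z)\<^sup>2) \<le> h z" if z: "z \<in> ?B" for z
  proof -
    have "(\<lambda>\<gamma>. 1 / (1 - (cnorm n (\<gamma> z))\<^sup>2)) (\<lambda>z\<in>?B. z) \<le> h z"
      unfolding h_def
      by (rule member_le_sum[OF id _ fin]) (simp add: less_imp_le[OF sq1[OF Aut_ball_in_uball[OF aut z]]])
    then show ?thesis using z by simp
  qed
  have "h (\<lambda>i. 0) \<ge> 1" using ge[OF zero_in_uball] by (simp add: cnorm_def)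
  define c where "c = h (\<lambda>i. 0)"
  have c: "c \<ge> 1" using \<open>h (\<lambda>i. 0) \<ge> 1\<close> by (simp add: c_def)
  \<comment> \<open>Outside this ball the identity alone contributes more than the value of the sum at the origin.\<close>
  define K where "K = {z \<in> cspace n. cnorm n z \<le> sqrt (1 - 1 / c)}"
  have "sqrt (1 - 1 / c) < 1" using c by simp
  then have KB: "K \<subseteq> ?B" unfolding K_def uball_def by (blast intro: le_less_trans)
  have "continuous_on ?B h"
    unfolding h_def
  proof (intro continuous_on_sum continuous_on_divide continuous_on_const continuous_on_diff continuous_on_power ballI)
    fix \<gamma> assume \<gamma>: "\<gamma> \<in> G"
    have "continuous_on ?B \<gamma>"
      by (rule holomorphic_map_on_imp_continuous_on[OF uball_subset Aut_ballD(3)[OF aut[OF \<gamma>]]])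
    then show "continuous_on ?B (\<lambda>z. cnorm n (\<gamma> z))"
      by (rule continuous_on_compose2[OF continuous_on_cnorm]) auto
    show "1 - (cnorm n (\<gamma> z))\<^sup>2 \<noteq> 0" if "z \<in> ?B" for z
      using sq1[OF Aut_ball_in_uball[OF aut[OF \<gamma>] that]] by simp
  qed
  then have "continuous_on K h" by (rule continuous_on_subset[OF _ KB])
  moreover have "(\<lambda>i. 0) \<in> K" using c by (simp add: K_def cspace_def cnorm_def)
  ultimately obtain p where p: "p \<in> K" and min: "\<And>z. z \<in> K \<Longrightarrow> h p \<le> h z"
    using continuous_attains_inf[of K h] compact_closed_uball[of n] unfolding K_def by blast
  have pB: "p \<in> ?B" using p KB by blast
  have hp: "h p \<le> h z" if z: "z \<in> ?B" for z
  proof (cases "z \<in> K")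
    case False
    then have "sqrt (1 - 1 / c) < cnorm n z" using z by (simp add: K_def uballD)
    then have "1 - 1 / c < (cnorm n z)\<^sup>2" by (meson not_le real_le_rsqrt)
    then have "1 - (cnorm n z)\<^sup>2 < 1 / c" by simp
    then have "c < 1 / (1 - (cnorm n z)\<^sup>2)" using c sq1[OF z] by (simp add: field_simps)
    also have "\<dots> \<le> h z" by (rule ge[OF z])
    finally show ?thesis using min[OF \<open>(\<lambda>i. 0) \<in> K\<close>] by (simp add: c_def)
  qed (rule min)
  have "\<forall>\<gamma>\<in>G. \<exists>b. b \<in> ?B \<and> (\<forall>z\<in>?B. 1 - (cnorm n (\<gamma> z))\<^sup>2 =
      (1 - (cnorm n b)\<^sup>2) * (1 - (cnorm n z)\<^sup>2) / (cmod (1 - cinner n z b))\<^sup>2)"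
    by (meson Aut_ball_norm aut)
  from bchoice[OF this] obtain b where b_all: "\<forall>\<gamma>\<in>G. b \<gamma> \<in> ?B \<and> (\<forall>z\<in>?B. 1 - (cnorm n (\<gamma> z))\<^sup>2 =
      (1 - (cnorm n (b \<gamma>))\<^sup>2) * (1 - (cnorm n z)\<^sup>2) / (cmod (1 - cinner n z (b \<gamma>)))\<^sup>2)"
    by blast
  have b: "b \<gamma> \<in> ?B" "\<And>z. z \<in> ?B \<Longrightarrow> 1 - (cnorm n (\<gamma> z))\<^sup>2 =
      (1 - (cnorm n (b \<gamma>))\<^sup>2) * (1 - (cnorm n z)\<^sup>2) / (cmod (1 - cinner n z (b \<gamma>)))\<^sup>2"
    if "\<gamma> \<in> G" for \<gamma> using b_all that by blast+
  define q where "q z = (\<Sum>\<gamma>\<in>G. (cmod (1 - cinner n z (b \<gamma>)))\<^sup>2 / (1 - (cnorm n (b \<gamma>))\<^sup>2))" for z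
  have hq: "h z * (1 - (cnorm n z)\<^sup>2) = q z" if z: "z \<in> ?B" for z
    unfolding h_def q_def sum_distrib_right
  proof (rule sum.cong)
    fix \<gamma> assume \<gamma>: "\<gamma> \<in> G"
    show "1 / (1 - (cnorm n (\<gamma> z))\<^sup>2) * (1 - (cnorm n z)\<^sup>2) =
        (cmod (1 - cinner n z (b \<gamma>)))\<^sup>2 / (1 - (cnorm n (b \<gamma>))\<^sup>2)"
      unfolding b(2)[OF \<gamma> z] using sq1[OF z] sq1[OF b(1)[OF \<gamma>]] by simp
  qed simp
  define k where "k z = q z - h p * (1 - (cnorm n z)\<^sup>2)" for z
  have k_eq: "k z = (h z - h p) * (1 - (cnorm n z)\<^sup>2)" if "z \<in> ?B" for z
    using hq[OF that] by (simp add: k_def algebra_simps)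
  have uniq: "z = p" if z: "z \<in> ?B" and hz: "h z = h p" for z
  proof (rule ccontr)
    assume "z \<noteq> p"
    define m where "m = (\<lambda>i. 1 / 2 * z i + 1 / 2 * p i)"
    \<comment> \<open>The squared norm of the midpoint is strictly below the mean of the two, which contradicts minimality.\<close>
    define d where "d = (\<lambda>i. 1 * z i + (- 1) * p i)"
    have "cnorm n d \<noteq> 0"
      using cnorm_diff_eq_0_iff[OF uballD(1)[OF z] uballD(1)[OF pB]] \<open>z \<noteq> p\<close> by (simp add: d_def)
    then have d: "(cnorm n d)\<^sup>2 > 0" by simp
    have m: "(cnorm n m)\<^sup>2 = (cnorm n z)\<^sup>2 / 2 + (cnorm n p)\<^sup>2 / 2 - (cnorm n d)\<^sup>2 / 4"
      unfolding m_def d_def cnorm_comb_sq by (simp add: norm_divide power_divide field_simps)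
    then have "(cnorm n m)\<^sup>2 < 1" using sq1[OF z] sq1[OF pB] d by linarith
    then have mB: "m \<in> ?B" using uballD(1)[OF z] uballD(1)[OF pB]
      by (simp add: uball_def m_def cspace_def abs_square_less_1)
    have "q m \<le> (\<Sum>\<gamma>\<in>G. (cmod (1 - cinner n z (b \<gamma>)))\<^sup>2 / (1 - (cnorm n (b \<gamma>))\<^sup>2) / 2 +
        (cmod (1 - cinner n p (b \<gamma>)))\<^sup>2 / (1 - (cnorm n (b \<gamma>))\<^sup>2) / 2)"
      unfolding q_def
    proof (rule sum_mono)
      fix \<gamma> assume \<gamma>: "\<gamma> \<in> G"
      have convex: "(cmod (u / 2 + v / 2))\<^sup>2 \<le> (cmod u)\<^sup>2 / 2 + (cmod v)\<^sup>2 / 2" for u v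
      proof -
        have "(cmod u)\<^sup>2 / 2 + (cmod v)\<^sup>2 / 2 - (cmod (u / 2 + v / 2))\<^sup>2 = (cmod (u / 2 - v / 2))\<^sup>2"
          by (simp add: cmod_power2) (simp add: power2_eq_square field_simps)
        then show ?thesis by (smt (verit) zero_le_power2)
      qed
      have "1 - cinner n m (b \<gamma>) = (1 - cinner n z (b \<gamma>)) / 2 + (1 - cinner n p (b \<gamma>)) / 2"
        unfolding m_def cinner_comb_left by (simp add: field_simps)
      then have "(cmod (1 - cinner n m (b \<gamma>)))\<^sup>2 \<le>
          (cmod (1 - cinner n z (b \<gamma>)))\<^sup>2 / 2 + (cmod (1 - cinner n p (b \<gamma>)))\<^sup>2 / 2"
        by (simp only: convex)
      from divide_right_mono[OF this, of "1 - (cnorm n (b \<gamma>))\<^sup>2"] sq1[OF b(1)[OF \<gamma>]]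
      show "(cmod (1 - cinner n m (b \<gamma>)))\<^sup>2 / (1 - (cnorm n (b \<gamma>))\<^sup>2) \<le>
        (cmod (1 - cinner n z (b \<gamma>)))\<^sup>2 / (1 - (cnorm n (b \<gamma>))\<^sup>2) / 2 +
        (cmod (1 - cinner n p (b \<gamma>)))\<^sup>2 / (1 - (cnorm n (b \<gamma>))\<^sup>2) / 2"
        by (simp add: add_divide_distrib mult.commute)
    qed
    also have "\<dots> = q z / 2 + q p / 2"
      by (simp add: q_def sum.distrib sum_divide_distrib)
    finally have "k m \<le> k z / 2 + k p / 2 - h p * (cnorm n d)\<^sup>2 / 4"
      unfolding k_def m by (simp add: field_simps)
    then have "k m \<le> - (h p * (cnorm n d)\<^sup>2 / 4)"
      by (simp add: k_eq[OF z] k_eq[OF pB] hz)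
    moreover have "k m \<ge> 0" using hp[OF mB] sq1[OF mB] by (simp add: k_eq[OF mB])
    moreover have "h p > 0"
    proof -
      have "0 < 1 / (1 - (cnorm n p)\<^sup>2)" using sq1[OF pB] by simp
      then show ?thesis using ge[OF pB] by linarith
    qed
    then have "h p * (cnorm n d)\<^sup>2 / 4 > 0" using d by simp
    ultimately show False by linarith
  qed
  show thesis
  proof (rule that[OF pB])
    show "\<gamma> p = p" if "\<gamma> \<in> G" for \<gamma>
      by (rule uniq[OF Aut_ball_in_uball[OF aut[OF that] pB] h_inv[OF that pB]])
  qed
qed

section \<open>Polynomial functions with prescribed order and degree\<close>

lemma polynomial_fun_on_const: "polynomial_fun_on n S (\<lambda>z. a)"
  unfolding polynomial_fun_on_def
  by (intro exI[of _ "{\<lambda>_. 0}"] exI[of _ "\<lambda>_. a"]) simp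

lemma polynomial_fun_on_coordinate:
  assumes "k < n"
  shows "polynomial_fun_on n S (\<lambda>z. z k)"
proof -
  have "(\<Prod>i<n. z i ^ (if i = k then 1 else 0)) = z k" for z :: "nat \<Rightarrow> complex"
    using assms by (simp add: if_distrib[of "\<lambda>m. _ ^ m"] cong: if_cong)
  then show ?thesis unfolding polynomial_fun_on_def
    by (intro exI[of _ "{\<lambda>i. if i = k then 1 else 0}"] exI[of _ "\<lambda>_. 1"]) simp
qed

lemma polynomial_fun_on_add:
  assumes "polynomial_fun_on n S g" "polynomial_fun_on n S h"
  shows "polynomial_fun_on n S (\<lambda>z. g z + h z)"
proof -
  let ?m = "\<lambda>\<alpha> z. \<Prod>i<n. (z i :: complex) ^ \<alpha> i"
  obtain A c where A: "finite A" and g: "\<And>z. z \<in> S \<Longrightarrow> g z = (\<Sum>\<alpha>\<in>A. c \<alpha> * ?m \<alpha> z)"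
    using assms(1) by (auto simp: polynomial_fun_on_def)
  obtain B e where B: "finite B" and h: "\<And>z. z \<in> S \<Longrightarrow> h z = (\<Sum>\<alpha>\<in>B. e \<alpha> * ?m \<alpha> z)"
    using assms(2) by (auto simp: polynomial_fun_on_def)
  have restr: "(\<Sum>\<alpha>\<in>A \<union> B. (if \<alpha> \<in> C then c \<alpha> else 0) * ?m \<alpha> z) = (\<Sum>\<alpha>\<in>C. c \<alpha> * ?m \<alpha> z)"
    if "C \<subseteq> A \<union> B" for C c z
  proof -
    have "(\<Sum>\<alpha>\<in>A \<union> B. (if \<alpha> \<in> C then c \<alpha> else 0) * ?m \<alpha> z)
        = (\<Sum>\<alpha>\<in>A \<union> B. if \<alpha> \<in> C then c \<alpha> * ?m \<alpha> z else 0)" by (intro sum.cong) auto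
    also have "\<dots> = (\<Sum>\<alpha>\<in>(A \<union> B) \<inter> C. c \<alpha> * ?m \<alpha> z)"
      using A B by (intro sum.inter_restrict[symmetric]) auto
    finally show ?thesis using that by (simp add: Int_absorb1)
  qed
  show ?thesis
    unfolding polynomial_fun_on_def
  proof (intro exI conjI ballI)
    show "finite (A \<union> B)" using A B by simp
    fix z assume "z \<in> S"
    then show "g z + h z =
        (\<Sum>\<alpha>\<in>A \<union> B. ((if \<alpha> \<in> A then c \<alpha> else 0) + (if \<alpha> \<in> B then e \<alpha> else 0)) * ?m \<alpha> z)"
      by (simp only: g h distrib_right sum.distrib restr[OF Un_upper1] restr[OF Un_upper2])
  qed
qed

lemma polynomial_fun_on_mult:
  assumes "polynomial_fun_on n S g" "polynomial_fun_on n S h"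
  shows "polynomial_fun_on n S (\<lambda>z. g z * h z)"
proof -
  let ?m = "\<lambda>\<alpha> z. \<Prod>i<n. (z i :: complex) ^ \<alpha> i"
  obtain A c where A: "finite A" and g: "\<And>z. z \<in> S \<Longrightarrow> g z = (\<Sum>\<alpha>\<in>A. c \<alpha> * ?m \<alpha> z)"
    using assms(1) by (auto simp: polynomial_fun_on_def)
  obtain B e where B: "finite B" and h: "\<And>z. z \<in> S \<Longrightarrow> h z = (\<Sum>\<alpha>\<in>B. e \<alpha> * ?m \<alpha> z)"
    using assms(2) by (auto simp: polynomial_fun_on_def)
  define k where "k = (\<lambda>(\<alpha>, \<beta>) (i :: nat). \<alpha> i + \<beta> i :: nat)"
  define w where "w = (\<lambda>(\<alpha>, \<beta>). c \<alpha> * e \<beta>)"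
  show ?thesis
    unfolding polynomial_fun_on_def
  proof (intro exI conjI ballI)
    show "finite (k ` (A \<times> B))" using A B by simp
    fix z assume z: "z \<in> S"
    have "g z * h z = (\<Sum>x\<in>A \<times> B. w x * ?m (k x) z)"
      unfolding g[OF z] h[OF z] sum_product sum.cartesian_product
      by (intro sum.cong refl) (auto simp: w_def k_def power_add prod.distrib)
    also have "\<dots> = (\<Sum>\<kappa>\<in>k ` (A \<times> B). \<Sum>x\<in>{x \<in> A \<times> B. k x = \<kappa>}. w x * ?m (k x) z)"
      using A B by (intro sum.image_gen) simp
    also have "\<dots> = (\<Sum>\<kappa>\<in>k ` (A \<times> B). (\<Sum>x\<in>{x \<in> A \<times> B. k x = \<kappa>}. w x) * ?m \<kappa> z)"
      unfolding sum_distrib_right by (intro sum.cong refl) simp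
    finally show "g z * h z = (\<Sum>\<kappa>\<in>k ` (A \<times> B). (\<Sum>x\<in>{x \<in> A \<times> B. k x = \<kappa>}. w x) * ?m \<kappa> z)" .
  qed
qed

lemma polynomial_fun_on_sum:
  "(\<And>i. i \<in> I \<Longrightarrow> polynomial_fun_on n S (g i)) \<Longrightarrow> polynomial_fun_on n S (\<lambda>z. \<Sum>i\<in>I. g i z)"
  by (induction I rule: infinite_finite_induct)
    (simp_all add: polynomial_fun_on_const polynomial_fun_on_add)

lemma polynomial_fun_on_prod:
  "(\<And>i. i \<in> I \<Longrightarrow> polynomial_fun_on n S (g i)) \<Longrightarrow> polynomial_fun_on n S (\<lambda>z. \<Prod>i\<in>I. g i z)"
  by (induction I rule: infinite_finite_induct)
    (simp_all add: polynomial_fun_on_const polynomial_fun_on_mult)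

lemma polynomial_fun_on_power:
  "polynomial_fun_on n S g \<Longrightarrow> polynomial_fun_on n S (\<lambda>z. g z ^ m)"
  by (induction m) (simp_all add: polynomial_fun_on_const polynomial_fun_on_mult)

lemma polynomial_fun_on_subset:
  "polynomial_fun_on n T g \<Longrightarrow> S \<subseteq> T \<Longrightarrow> polynomial_fun_on n S g"
  unfolding polynomial_fun_on_def by blast

lemma holomorphic_fun_on_power:
  assumes "S \<subseteq> cspace n" "holomorphic_fun_on n S g"
  shows "holomorphic_fun_on n S (\<lambda>z. g z ^ m)"
  using assms by (induction m) (simp_all add: holomorphic_fun_on_const holomorphic_fun_on_mult)

lemma holomorphic_fun_on_prod:
  assumes "S \<subseteq> cspace n" "\<And>i. i \<in> I \<Longrightarrow> holomorphic_fun_on n S (g i)"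
  shows "holomorphic_fun_on n S (\<lambda>z. \<Prod>i\<in>I. g i z)"
  using assms(2)
  by (induction I rule: infinite_finite_induct)
    (simp_all add: holomorphic_fun_on_const[OF assms(1)] holomorphic_fun_on_mult[OF assms(1)])

lemma polynomial_imp_holomorphic:
  assumes p: "polynomial_fun_on n S p" and S: "S \<subseteq> cspace n"
  shows "holomorphic_fun_on n S p"
proof -
  obtain A c where p: "\<And>z. z \<in> S \<Longrightarrow> p z = (\<Sum>\<alpha>\<in>A. c \<alpha> * (\<Prod>i<n. z i ^ \<alpha> i))"
    using p by (auto simp: polynomial_fun_on_def)
  have "holomorphic_fun_on n S (\<lambda>z. \<Sum>\<alpha>\<in>A. c \<alpha> * (\<Prod>i<n. z i ^ \<alpha> i))"
    by (intro holomorphic_fun_on_sum holomorphic_fun_on_mult holomorphic_fun_on_const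
        holomorphic_fun_on_prod holomorphic_fun_on_power holomorphic_fun_on_coordinate S) auto
  moreover have "holomorphic_fun_on n S p \<longleftrightarrow>
      holomorphic_fun_on n S (\<lambda>z. \<Sum>\<alpha>\<in>A. c \<alpha> * (\<Prod>i<n. z i ^ \<alpha> i))"
    unfolding holomorphic_fun_on_def
    by (intro ball_cong refl ex_cong1 Lim_cong_within) (auto simp: p)
  ultimately show ?thesis by simp
qed

lemma polynomial_matrix_map:
  assumes "polynomial_fun_on n UNIV p"
  shows "polynomial_fun_on n UNIV (\<lambda>z. p (matrix_map n U z))"
proof -
  obtain A c where p: "\<And>z. p z = (\<Sum>\<alpha>\<in>A. c \<alpha> * (\<Prod>i<n. z i ^ \<alpha> i))"
    using assms by (auto simp: polynomial_fun_on_def)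
  show ?thesis
    unfolding p by (intro polynomial_fun_on_sum polynomial_fun_on_mult polynomial_fun_on_const
        polynomial_fun_on_prod polynomial_fun_on_power)
      (auto simp: matrix_map_def intro!: polynomial_fun_on_sum polynomial_fun_on_mult polynomial_fun_on_const
        polynomial_fun_on_coordinate)
qed

text \<open>On every line through the origin \<open>p\<close> restricts to a polynomial of degree at most \<open>d\<close> that
  vanishes to order at least \<open>l\<close> at the origin. So \<open>p\<close> has no terms of degree below \<open>l\<close> or above
  \<open>d\<close>, and it is homogeneous if \<open>l = d\<close>.\<close>

definition graded :: "nat \<Rightarrow> nat \<Rightarrow> nat \<Rightarrow> ((nat \<Rightarrow> complex) \<Rightarrow> complex) \<Rightarrow> bool"
  where "graded n l d p \<longleftrightarrow> polynomial_fun_on n UNIV p \<and>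
    (\<forall>z. \<exists>q. degree q \<le> d \<and> monom 1 l dvd q \<and> (\<forall>t. p (\<lambda>i. t * z i) = poly q t))"

lemma graded_polynomial: "graded n l d p \<Longrightarrow> polynomial_fun_on n UNIV p"
  by (simp add: graded_def)

lemma graded_lineE:
  assumes "graded n l d p"
  obtains q where "degree q \<le> d" "monom 1 l dvd q" "\<And>t. p (\<lambda>i. t * z i) = poly q t"
  using assms by (auto simp: graded_def)

lemma gradedI:
  assumes "polynomial_fun_on n UNIV p"
    and "\<And>z. \<exists>q. degree q \<le> d \<and> monom 1 l dvd q \<and> (\<forall>t. p (\<lambda>i. t * z i) = poly q t)"
  shows "graded n l d p"
  using assms by (simp add: graded_def)

lemma graded_const: "graded n 0 0 (\<lambda>z. a)"
  by (intro gradedI polynomial_fun_on_const exI[of _ "[:a:]"]) (simp add: monom_0)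

lemma graded_zero: "graded n l d (\<lambda>z. 0)"
  by (intro gradedI polynomial_fun_on_const exI[of _ 0]) simp

lemma graded_coordinate:
  assumes "k < n"
  shows "graded n 1 1 (\<lambda>z. z k)"
proof (rule gradedI)
  show "\<exists>q. degree q \<le> 1 \<and> monom 1 1 dvd q \<and> (\<forall>t. t * z k = poly q t)" for z
  proof (intro exI conjI allI)
    show "degree (monom (z k) 1) \<le> 1" by (rule degree_monom_le)
    show "monom 1 1 dvd monom (z k) 1" by (rule dvdI[of _ _ "[:z k:]"]) (simp add: mult_monom flip: monom_0)
    show "t * z k = poly (monom (z k) 1) t" for t by (simp add: poly_monom mult.commute)
  qed
qed (rule polynomial_fun_on_coordinate[OF assms])

lemma graded_add:
  assumes "graded n l d p" "graded n l d q"
  shows "graded n l d (\<lambda>z. p z + q z)"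
proof (rule gradedI)
  show "polynomial_fun_on n UNIV (\<lambda>z. p z + q z)"
    using assms by (intro polynomial_fun_on_add) (auto dest: graded_polynomial)
  fix z
  obtain f where "degree f \<le> d" "monom 1 l dvd f" "\<And>t. p (\<lambda>i. t * z i) = poly f t"
    by (rule graded_lineE[OF assms(1), where z = z]) blast
  moreover obtain g where "degree g \<le> d" "monom 1 l dvd g" "\<And>t. q (\<lambda>i. t * z i) = poly g t"
    by (rule graded_lineE[OF assms(2), where z = z]) blast
  ultimately show "\<exists>f. degree f \<le> d \<and> monom 1 l dvd f \<and> (\<forall>t. p (\<lambda>i. t * z i) + q (\<lambda>i. t * z i) = poly f t)"
    by (intro exI[of _ "f + g"]) (simp add: degree_add_le dvd_add)
qed

lemma graded_mult:
  assumes "graded n l d p" "graded n l' d' q"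
  shows "graded n (l + l') (d + d') (\<lambda>z. p z * q z)"
proof (rule gradedI)
  show "polynomial_fun_on n UNIV (\<lambda>z. p z * q z)"
    using assms by (intro polynomial_fun_on_mult) (auto dest: graded_polynomial)
  fix z
  obtain f where f: "degree f \<le> d" "monom 1 l dvd f" "\<And>t. p (\<lambda>i. t * z i) = poly f t"
    by (rule graded_lineE[OF assms(1), where z = z]) blast
  obtain g where g: "degree g \<le> d'" "monom 1 l' dvd g" "\<And>t. q (\<lambda>i. t * z i) = poly g t"
    by (rule graded_lineE[OF assms(2), where z = z]) blast
  have "degree (f * g) \<le> d + d'" using f g degree_mult_le[of f g] by linarith
  moreover have "monom 1 (l + l') dvd f * g"
    using mult_dvd_mono[OF f(2) g(2)] by (simp add: mult_monom)
  ultimately show "\<exists>f. degree f \<le> d + d' \<and> monom 1 (l + l') dvd f \<and>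
      (\<forall>t. p (\<lambda>i. t * z i) * q (\<lambda>i. t * z i) = poly f t)"
    using f g by (intro exI[of _ "f * g"]) simp
qed

lemma graded_mono:
  assumes "graded n l d p" "l' \<le> l" "d \<le> d'"
  shows "graded n l' d' p"
proof (rule gradedI)
  show "polynomial_fun_on n UNIV p" using assms by (auto dest: graded_polynomial)
  fix z
  obtain f where f: "degree f \<le> d" "monom 1 l dvd f" "\<And>t. p (\<lambda>i. t * z i) = poly f t"
    by (rule graded_lineE[OF assms(1), where z = z]) blast
  have "monom 1 l' dvd (monom 1 l :: complex poly)"
    by (rule dvdI[of _ _ "monom 1 (l - l')"]) (use assms in \<open>simp add: mult_monom\<close>)
  then show "\<exists>f. degree f \<le> d' \<and> monom 1 l' dvd f \<and> (\<forall>t. p (\<lambda>i. t * z i) = poly f t)"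
    using f assms by (intro exI[of _ f]) (auto intro: dvd_trans)
qed

lemma graded_scale: "graded n l d p \<Longrightarrow> graded n l d (\<lambda>z. a * p z)"
  using graded_mult[OF graded_const[of n a]] by fastforce

lemma graded_sum:
  "(\<And>i. i \<in> I \<Longrightarrow> graded n l d (p i)) \<Longrightarrow> graded n l d (\<lambda>z. \<Sum>i\<in>I. p i z)"
  by (induction I rule: infinite_finite_induct) (simp_all add: graded_zero graded_add)

lemma graded_matrix_map:
  assumes "graded n l d p"
  shows "graded n l d (\<lambda>z. p (matrix_map n U z))"
proof (rule gradedI)
  show "polynomial_fun_on n UNIV (\<lambda>z. p (matrix_map n U z))"
    by (rule polynomial_matrix_map[OF graded_polynomial[OF assms]])
  show "\<exists>q. degree q \<le> d \<and> monom 1 l dvd q \<and> (\<forall>t. p (matrix_map n U (\<lambda>i. t * z i)) = poly q t)" for z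
    unfolding matrix_map_scale using assms by (simp add: graded_def)
qed

lemma graded_homogeneous:
  assumes "graded n d d p"
  shows "p (\<lambda>i. t * z i) = t ^ d * p z"
proof -
  obtain q where q: "degree q \<le> d" "monom 1 d dvd q" "\<And>t. p (\<lambda>i. t * z i) = poly q t"
    by (rule graded_lineE[OF assms, where z = z]) blast
  obtain r where r: "q = monom 1 d * r" using q(2) by (rule dvdE)
  have "\<exists>a. r = [:a:]"
  proof (cases "r = 0")
    case False
    then have "degree q = d + degree r" unfolding r by (simp add: degree_mult_eq degree_monom_eq)
    then show ?thesis using q(1) degree_eq_zeroE[of r] by auto
  qed (auto intro: exI[of _ 0])
  then obtain a where "r = [:a:]" by blast
  then have "poly q t = t ^ d * a" for t by (simp add: r poly_monom)
  then show ?thesis using q(3)[of t] q(3)[of 1] by simp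
qed

section \<open>Sums of squared moduli of polynomials\<close>

text \<open>The squared norms of polynomial maps with components of degree between \<open>l\<close> and \<open>d\<close>. They
  are closed under sums and products (direct sums and tensor products of the maps), so that maps
  can be built without naming their components.\<close>

definition sos :: "nat \<Rightarrow> nat \<Rightarrow> nat \<Rightarrow> ((nat \<Rightarrow> complex) \<Rightarrow> real) \<Rightarrow> bool"
  where "sos n l d H \<longleftrightarrow>
    (\<exists>ps. (\<forall>p\<in>set ps. graded n l d p) \<and> (\<forall>z. H z = (\<Sum>p\<leftarrow>ps. (cmod (p z))\<^sup>2)))"

lemma sos_zero: "sos n l d (\<lambda>z. 0)"
  unfolding sos_def by (intro exI[of _ "[]"]) simp

lemma sos_square: "graded n l d p \<Longrightarrow> sos n l d (\<lambda>z. (cmod (p z))\<^sup>2)"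
  unfolding sos_def by (intro exI[of _ "[p]"]) simp

lemma sos_const: "0 \<le> a \<Longrightarrow> sos n 0 0 (\<lambda>z. a)"
  using sos_square[OF graded_const[of n "of_real (sqrt a)"]] by simp

lemma sos_add:
  assumes "sos n l d H" "sos n l d K"
  shows "sos n l d (\<lambda>z. H z + K z)"
proof -
  obtain ps qs where "\<forall>p\<in>set ps. graded n l d p" "\<And>z. H z = (\<Sum>p\<leftarrow>ps. (cmod (p z))\<^sup>2)"
    "\<forall>p\<in>set qs. graded n l d p" "\<And>z. K z = (\<Sum>p\<leftarrow>qs. (cmod (p z))\<^sup>2)"
    using assms by (auto simp: sos_def)
  then show ?thesis unfolding sos_def by (intro exI[of _ "ps @ qs"]) auto
qed

lemma sos_sum:
  "(\<And>i. i \<in> I \<Longrightarrow> sos n l d (H i)) \<Longrightarrow> sos n l d (\<lambda>z. \<Sum>i\<in>I. H i z)"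
  by (induction I rule: infinite_finite_induct) (simp_all add: sos_zero sos_add)

lemma sos_mult:
  assumes "sos n l d H" "sos n l' d' K"
  shows "sos n (l + l') (d + d') (\<lambda>z. H z * K z)"
proof -
  obtain ps qs where *: "\<forall>p\<in>set ps. graded n l d p" "\<And>z. H z = (\<Sum>p\<leftarrow>ps. (cmod (p z))\<^sup>2)"
    "\<forall>p\<in>set qs. graded n l' d' p" "\<And>z. K z = (\<Sum>p\<leftarrow>qs. (cmod (p z))\<^sup>2)"
    using assms by (auto simp: sos_def)
  define rs where "rs = concat (map (\<lambda>p. map (\<lambda>q z. p z * q z) qs) ps)"
  have "(\<Sum>p\<leftarrow>ps. (cmod (p z))\<^sup>2) * (\<Sum>p\<leftarrow>qs. (cmod (p z))\<^sup>2) = (\<Sum>r\<leftarrow>rs. (cmod (r z))\<^sup>2)" for z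
    unfolding rs_def
    by (induction ps) (simp_all add: distrib_right o_def norm_mult power_mult_distrib sum_list_const_mult)
  moreover have "graded n (l + l') (d + d') r" if "r \<in> set rs" for r
    using that * by (auto simp: rs_def intro: graded_mult)
  ultimately show ?thesis unfolding sos_def using * by (intro exI[of _ rs]) auto
qed

lemma sos_mono:
  assumes "sos n l d H" "l' \<le> l" "d \<le> d'"
  shows "sos n l' d' H"
  using assms unfolding sos_def by (meson graded_mono)

lemma sos_scale:
  assumes "sos n l d H" "0 \<le> a"
  shows "sos n l d (\<lambda>z. a * H z)"
  using sos_mult[OF sos_const[OF assms(2)] assms(1)] by simp

lemma sos_norm_sq: "sos n 1 1 (\<lambda>z. (cnorm n z)\<^sup>2)"
  unfolding cnorm_sq by (intro sos_sum sos_square graded_coordinate) simp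

lemma sos_norm_power: "sos n m m (\<lambda>z. ((cnorm n z)\<^sup>2) ^ m)"
  using sos_mult[OF sos_norm_sq] sos_const[of 1] by (induction m) auto

lemma sos_nonneg: "sos n l d H \<Longrightarrow> 0 \<le> H z"
  unfolding sos_def by (auto intro!: sum_list_nonneg)

lemma graded_cinner: "graded n 1 1 (\<lambda>z. cinner n z x)"
  unfolding cinner_def
  by (intro graded_sum) (subst mult.commute, intro graded_scale graded_coordinate, simp)

section \<open>Forms attached to finite sets of vectors\<close>

text \<open>Its zeros are the points of the affine hyperplanes \<open>\<langle>z, x\<rangle> = 1\<close> with \<open>x \<in> S\<close>. If \<open>\<parallel>x\<parallel> > 1\<close>,
  such a hyperplane meets the ball. With these constants the next form, which depends on \<open>\<parallel>z\<parallel>\<close>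
  only and equals \<open>1\<close> on the sphere, exceeds this one by a sum of squared moduli.\<close>

definition hyperplane_form :: "nat \<Rightarrow> (nat \<Rightarrow> complex) set \<Rightarrow> (nat \<Rightarrow> complex) \<Rightarrow> real"
  where "hyperplane_form n S z = (\<Prod>x\<in>S. (cmod (1 - cinner n z x))\<^sup>2 / (2 * (1 + (cnorm n x)\<^sup>2)))"

definition radial_form :: "nat \<Rightarrow> (nat \<Rightarrow> complex) set \<Rightarrow> (nat \<Rightarrow> complex) \<Rightarrow> real"
  where "radial_form n S z = (\<Prod>x\<in>S. (1 + (cnorm n x)\<^sup>2 * (cnorm n z)\<^sup>2) / (1 + (cnorm n x)\<^sup>2))"

lemma sos_hyperplane_form_factor:
  "sos n 0 1 (\<lambda>z. (cmod (1 - cinner n z x))\<^sup>2 / (2 * (1 + (cnorm n x)\<^sup>2)))"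
proof -
  have "graded n 0 1 (\<lambda>z. 1 + (- 1) * cinner n z x)"
    by (intro graded_add graded_scale graded_mono[OF graded_const] graded_mono[OF graded_cinner]) auto
  from sos_scale[OF sos_square[OF this], of "1 / (2 * (1 + (cnorm n x)\<^sup>2))"]
  show ?thesis by (simp add: add_nonneg_nonneg)
qed

text \<open>With \<open>l = \<langle>z, x\<rangle>\<close>, \<open>2 (1 + \<parallel>x\<parallel>\<^sup>2)\<close> times this difference is
  \<open>2 + 2 \<parallel>x\<parallel>\<^sup>2 \<parallel>z\<parallel>\<^sup>2 - \<bar>1 - l\<bar>\<^sup>2 = \<bar>1 + l\<bar>\<^sup>2 + 2 (\<parallel>x\<parallel>\<^sup>2 \<parallel>z\<parallel>\<^sup>2 - \<bar>l\<bar>\<^sup>2)\<close> by the parallelogram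
  law, and the last term is a sum of squares by Lagrange's identity.\<close>

lemma sos_form_factor_diff:
  "sos n 0 1 (\<lambda>z. (1 + (cnorm n x)\<^sup>2 * (cnorm n z)\<^sup>2) / (1 + (cnorm n x)\<^sup>2)
      - (cmod (1 - cinner n z x))\<^sup>2 / (2 * (1 + (cnorm n x)\<^sup>2)))"
proof -
  define e where "e = 1 / (2 * (1 + (cnorm n x)\<^sup>2))"
  have pos: "1 + (cnorm n x)\<^sup>2 > 0" by (simp add: add_pos_nonneg)
  have e: "0 \<le> e" using pos by (simp add: e_def)
  have "graded n 0 1 (\<lambda>z. 1 + cinner n z x)"
    by (intro graded_add graded_mono[OF graded_const] graded_mono[OF graded_cinner]) auto
  moreover have "graded n 0 1 (\<lambda>z. x j * z i + (- x i) * z j)" if "i < n" "j < n" for i j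
    by (intro graded_add graded_scale graded_mono[OF graded_coordinate] that) auto
  ultimately have "sos n 0 1 (\<lambda>z. e * ((cmod (1 + cinner n z x))\<^sup>2
      + (\<Sum>i<n. \<Sum>j<n. (cmod (x j * z i + (- x i) * z j))\<^sup>2)))"
    by (intro sos_scale sos_add sos_sum sos_square e) auto
  moreover have "e * ((cmod (1 + cinner n z x))\<^sup>2 + (\<Sum>i<n. \<Sum>j<n. (cmod (x j * z i + (- x i) * z j))\<^sup>2))
      = (1 + (cnorm n x)\<^sup>2 * (cnorm n z)\<^sup>2) / (1 + (cnorm n x)\<^sup>2)
      - (cmod (1 - cinner n z x))\<^sup>2 / (2 * (1 + (cnorm n x)\<^sup>2))" for z
  proof -
    have "(\<Sum>i<n. \<Sum>j<n. (cmod (x j * z i + (- x i) * z j))\<^sup>2) =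
        2 * ((cnorm n z)\<^sup>2 * (cnorm n x)\<^sup>2 - (cmod (cinner n z x))\<^sup>2)"
      unfolding lagrange_identity[symmetric] by (simp add: mult.commute)
    moreover have "(cmod (1 + l))\<^sup>2 + (cmod (1 - l))\<^sup>2 = 2 + 2 * (cmod l)\<^sup>2" for l
      unfolding cmod_power2 by (simp add: power2_eq_square algebra_simps)
    then have "(cmod (1 + cinner n z x))\<^sup>2 = 2 + 2 * (cmod (cinner n z x))\<^sup>2 - (cmod (1 - cinner n z x))\<^sup>2"
      by (metis add_diff_cancel_right')
    ultimately have "(cmod (1 + cinner n z x))\<^sup>2 + (\<Sum>i<n. \<Sum>j<n. (cmod (x j * z i + (- x i) * z j))\<^sup>2) =
        2 * (1 + (cnorm n x)\<^sup>2 * (cnorm n z)\<^sup>2) - (cmod (1 - cinner n z x))\<^sup>2"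
      by (simp add: algebra_simps)
    moreover have "1 / (2 * v) * (2 * p - a) = p / v - a / (2 * v)" if "v > 0" for v p a :: real
      using that by (simp add: field_simps)
    ultimately show ?thesis using pos by (simp only: e_def)
  qed
  ultimately show ?thesis by simp
qed

text \<open>For products of factors, \<open>d D - a A = (d - a) D + a (D - A)\<close> allows for one more vector.\<close>

lemma sos_forms:
  assumes "finite S"
  shows "sos n 0 (card S) (hyperplane_form n S)"
    and "sos n 0 (card S) (\<lambda>z. radial_form n S z - hyperplane_form n S z)"
  using assms
proof (induction S rule: finite_induct)
  case empty
  show "sos n 0 (card {}) (hyperplane_form n {})"
    "sos n 0 (card {}) (\<lambda>z. radial_form n {} z - hyperplane_form n {} z)"
    by (simp_all add: hyperplane_form_def[abs_def] radial_form_def[abs_def] sos_zero sos_const)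
next
  case (insert x S)
  define a where "a z = (cmod (1 - cinner n z x))\<^sup>2 / (2 * (1 + (cnorm n x)\<^sup>2))" for z
  define d where "d z = (1 + (cnorm n x)\<^sup>2 * (cnorm n z)\<^sup>2) / (1 + (cnorm n x)\<^sup>2)" for z
  have a: "sos n 0 1 a" unfolding a_def[abs_def] by (rule sos_hyperplane_form_factor)
  have da: "sos n 0 1 (\<lambda>z. d z - a z)" unfolding a_def d_def by (rule sos_form_factor_diff)
  have A: "hyperplane_form n (insert x S) z = a z * hyperplane_form n S z" for z
    using insert.hyps by (simp add: hyperplane_form_def a_def)
  have D: "radial_form n (insert x S) z = d z * radial_form n S z" for z
    using insert.hyps by (simp add: radial_form_def d_def)
  have card: "card (insert x S) = 1 + card S" using insert.hyps by simp
  show "sos n 0 (card (insert x S)) (hyperplane_form n (insert x S))"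
    using sos_mult[OF a insert.IH(1)] unfolding card by (simp add: A[abs_def])
  have "sos n (0 + 0) (1 + card S) (\<lambda>z. (d z - a z) * ((radial_form n S z - hyperplane_form n S z) + hyperplane_form n S z)
      + a z * (radial_form n S z - hyperplane_form n S z))"
    by (intro sos_add[OF sos_mult sos_mult] da a sos_add insert.IH)
  then show "sos n 0 (card (insert x S)) (\<lambda>z. radial_form n (insert x S) z - hyperplane_form n (insert x S) z)"
    unfolding card A D by (simp add: algebra_simps)
qed

text \<open>The squared norm of the map to be constructed. A map of squared norm \<open>A\<close> together with the
  tensor product of one of squared norm \<open>D - A\<close> with the identity map has squared norm
  \<open>A + u (D - A)\<close>: this equals \<open>D\<close>, hence \<open>1\<close>, on the sphere, and it still depends on \<open>A\<close> inside
  the ball. The factor \<open>u\<^sup>2\<close> removes the constant and linear terms, and the last summand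
  contributes the homogeneous map of the highest degree, which vanishes only at the origin. Both
  features serve to show that automorphisms compatible with the map fix the origin.\<close>

definition prescribed_norm :: "nat \<Rightarrow> (nat \<Rightarrow> complex) set \<Rightarrow> (nat \<Rightarrow> complex) \<Rightarrow> real"
  where "prescribed_norm n S z = (let u = (cnorm n z)\<^sup>2; A = hyperplane_form n S z; D = radial_form n S z in
    1 / 2 * (u ^ 2 * (A + u * (D - A))) + 1 / 2 * u ^ (card S + 3))"

lemma prescribed_norm_polynomials:
  assumes S: "finite S"
  obtains ps where "\<And>p. p \<in> set ps \<Longrightarrow> graded n 2 (card S + 3) p"
    "\<And>z. prescribed_norm n S z = (\<Sum>p\<leftarrow>ps. (cmod (p z))\<^sup>2)"
    "\<And>z. z \<in> cspace n \<Longrightarrow> z \<noteq> (\<lambda>i. 0) \<Longrightarrow> \<exists>p\<in>set ps. graded n (card S + 3) (card S + 3) p \<and> p z \<noteq> 0"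
proof -
  let ?d = "card S + 3"
  let ?u = "\<lambda>z. (cnorm n z)\<^sup>2"
  have 1: "sos n 0 (card S + 1) (hyperplane_form n S)"
    by (rule sos_mono[OF sos_forms(1)[OF S]]) auto
  have 2: "sos n 0 (card S + 1) (\<lambda>z. ?u z * (radial_form n S z - hyperplane_form n S z))"
    by (rule sos_mono[OF sos_mult[OF sos_norm_sq sos_forms(2)[OF S]]]) auto
  have "sos n 2 ?d (\<lambda>z. 1 / 2 * (?u z ^ 2 * (hyperplane_form n S z +
      ?u z * (radial_form n S z - hyperplane_form n S z))))"
    by (rule sos_mono[OF sos_scale[OF sos_mult[OF sos_norm_power sos_add[OF 1 2]]]]) auto
  then obtain ps where ps: "\<forall>p\<in>set ps. graded n 2 ?d p"
    "\<And>z. 1 / 2 * (?u z ^ 2 * (hyperplane_form n S z + ?u z * (radial_form n S z - hyperplane_form n S z)))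
      = (\<Sum>p\<leftarrow>ps. (cmod (p z))\<^sup>2)"
    unfolding sos_def by blast
  have "sos n ?d ?d (\<lambda>z. 1 / 2 * ?u z ^ ?d)" by (intro sos_scale sos_norm_power) simp
  then obtain qs where qs: "\<forall>p\<in>set qs. graded n ?d ?d p"
    "\<And>z. 1 / 2 * ?u z ^ ?d = (\<Sum>p\<leftarrow>qs. (cmod (p z))\<^sup>2)"
    unfolding sos_def by blast
  show thesis
  proof (rule that[of "ps @ qs"])
    show "graded n 2 ?d p" if "p \<in> set (ps @ qs)" for p
      using that ps qs by (auto intro: graded_mono[where l = "?d"])
    show "prescribed_norm n S z = (\<Sum>p\<leftarrow>ps @ qs. (cmod (p z))\<^sup>2)" for z
      unfolding prescribed_norm_def Let_def ps(2) qs(2) by simp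
    fix z assume z: "z \<in> cspace n" "z \<noteq> (\<lambda>i. 0)"
    have "\<exists>p\<in>set qs. p z \<noteq> 0"
    proof (rule ccontr)
      assume "\<not> ?thesis"
      then have "(\<Sum>p\<leftarrow>qs. (cmod (p z))\<^sup>2) = (\<Sum>p\<leftarrow>qs. 0)" by (intro arg_cong[of _ _ sum_list] map_cong) auto
      then have "cnorm n z = 0" unfolding qs(2)[symmetric] by simp
      with z show False by (simp add: cnorm_eq_0)
    qed
    then show "\<exists>p\<in>set (ps @ qs). graded n ?d ?d p \<and> p z \<noteq> 0" using qs by auto
  qed
qed

lemma prescribed_norm_bounds:
  assumes S: "finite S"
  shows "cnorm n z = 1 \<Longrightarrow> prescribed_norm n S z = 1"
    and "cnorm n z < 1 \<Longrightarrow> prescribed_norm n S z < 1"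
proof -
  have pos: "1 + (cnorm n x)\<^sup>2 > 0" for x by (simp add: add_pos_nonneg)
  assume "cnorm n z = 1"
  moreover from this have "radial_form n S z = 1" using pos by (simp add: radial_form_def less_imp_neq[symmetric])
  ultimately show "prescribed_norm n S z = 1" by (simp add: prescribed_norm_def Let_def)
next
  have pos: "1 + (cnorm n x)\<^sup>2 > 0" for x by (simp add: add_pos_nonneg)
  assume "cnorm n z < 1"
  define u A D where "u = (cnorm n z)\<^sup>2" and "A = hyperplane_form n S z" and "D = radial_form n S z"
  have u: "0 \<le> u" "u < 1" using \<open>cnorm n z < 1\<close> by (simp_all add: u_def abs_square_less_1)
  have A: "0 \<le> A" "A \<le> D"
    using sos_nonneg[OF sos_forms(1)[OF S], of n z] sos_nonneg[OF sos_forms(2)[OF S], of n z]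
    by (simp_all add: A_def D_def)
  have "D \<le> 1"
    unfolding D_def radial_form_def
  proof (rule prod_le_1)
    fix x
    have "(cnorm n x)\<^sup>2 * (cnorm n z)\<^sup>2 \<le> (cnorm n x)\<^sup>2 * 1"
      using u by (intro mult_left_mono) (auto simp: u_def)
    then show "0 \<le> (1 + (cnorm n x)\<^sup>2 * (cnorm n z)\<^sup>2) / (1 + (cnorm n x)\<^sup>2) \<and>
        (1 + (cnorm n x)\<^sup>2 * (cnorm n z)\<^sup>2) / (1 + (cnorm n x)\<^sup>2) \<le> 1"
      using pos[of x] by (simp add: divide_simps add_nonneg_nonneg)
  qed
  have "u * (D - A) \<le> 1 * (D - A)" using u A by (intro mult_right_mono) auto
  then have "A + u * (D - A) \<le> 1" using \<open>D \<le> 1\<close> by simp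
  then have "u ^ 2 * (A + u * (D - A)) \<le> u ^ 2 * 1" by (rule mult_left_mono) simp
  also have "\<dots> \<le> u" using u by (simp add: power2_eq_square mult_left_le)
  also have "\<dots> < 1" by (rule u)
  finally have "u ^ 2 * (A + u * (D - A)) < 1" .
  moreover have "u ^ (card S + 3) \<le> 1" using u by (simp add: power_le_one)
  ultimately show "prescribed_norm n S z < 1"
    by (simp add: prescribed_norm_def Let_def flip: u_def A_def D_def)
qed

text \<open>Apart from terms that depend on \<open>u = \<parallel>z\<parallel>\<^sup>2\<close> only, the prescribed norm is half of
  \<open>u\<^sup>2 (1 - u)\<close> times the hyperplane form.\<close>

lemma prescribed_norm_determines_hyperplane_form:
  assumes "prescribed_norm n S z = prescribed_norm n S w" "cnorm n z = cnorm n w" "0 < cnorm n w" "cnorm n w < 1"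
  shows "hyperplane_form n S z = hyperplane_form n S w"
proof -
  define u where "u = (cnorm n w)\<^sup>2"
  have u: "0 < u" "u < 1" using assms by (simp_all add: u_def abs_square_less_1)
  have D: "radial_form n S z = radial_form n S w" by (simp add: radial_form_def assms(2))
  have "u\<^sup>2 * (1 - u) * hyperplane_form n S z = u\<^sup>2 * (1 - u) * hyperplane_form n S w"
    using assms(1) unfolding prescribed_norm_def Let_def assms(2) u_def[symmetric] D
    by (simp add: algebra_simps)
  then show ?thesis using u by simp
qed

lemma prescribed_norm_unitary:
  assumes U: "unitary_matrix n U" and S: "S \<subseteq> cspace n" "matrix_map n U ` S = S" and z: "z \<in> cspace n"
  shows "prescribed_norm n S (matrix_map n U z) = prescribed_norm n S z"
proof -
  have inj: "inj_on (matrix_map n U) S"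
    using unitary_inverse(1)[OF U] S(1) by (intro inj_on_inverseI[where g = "matrix_map n (\<lambda>i j. cnj (U j i))"]) blast
  have "hyperplane_form n S (matrix_map n U z) =
      (\<Prod>x\<in>matrix_map n U ` S. (cmod (1 - cinner n (matrix_map n U z) x))\<^sup>2 / (2 * (1 + (cnorm n x)\<^sup>2)))"
    unfolding S(2) hyperplane_form_def ..
  also have "\<dots> = hyperplane_form n S z"
    unfolding prod.reindex[OF inj] hyperplane_form_def
    by (rule prod.cong) (use S(1) z in \<open>auto simp: cinner_unitary[OF U] cnorm_unitary[OF U]\<close>)
  finally show ?thesis
    by (simp add: prescribed_norm_def radial_form_def cnorm_unitary[OF U])
qed

section \<open>Equivariant maps between balls\<close>

lemma permutation_unitary:
  assumes \<pi>: "bij_betw \<pi> {..<N} {..<N}"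
  shows "unitary_matrix N (\<lambda>k l. if l = \<pi> k then 1 else 0)"
    and "k < N \<Longrightarrow> matrix_map N (\<lambda>k l. if l = \<pi> k then 1 else 0) w k = w (\<pi> k)"
proof -
  have \<pi>N: "\<pi> k < N" if "k < N" for k using bij_betwE[OF \<pi>] that by auto
  have 1: "(\<Sum>k<N. cnj (if i = \<pi> k then 1 else 0) * (if j = \<pi> k then 1 else 0)) = (if i = j then 1 else (0::complex))"
    if "i < N" "j < N" for i j
  proof -
    have "(\<Sum>k<N. cnj (if i = \<pi> k then 1 else 0) * (if j = \<pi> k then 1 else 0)) =
        (\<Sum>m<N. cnj (if i = m then 1 else 0) * (if j = m then 1 else (0::complex)))"
      by (rule sum.reindex_bij_betw[OF \<pi>])
    also have "\<dots> = (\<Sum>m<N. if i = m then (if j = m then 1 else 0) else 0)" by (intro sum.cong) auto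
    also have "\<dots> = (if i = j then 1 else 0)" using that by (simp add: sum.delta)
    finally show ?thesis .
  qed
  have 2: "(\<Sum>k<N. (if k = \<pi> i then 1 else 0) * cnj (if k = \<pi> j then 1 else 0)) = (if i = j then 1 else (0::complex))"
    if "i < N" "j < N" for i j
  proof -
    have "(\<Sum>k<N. (if k = \<pi> i then 1 else 0) * cnj (if k = \<pi> j then 1 else 0)) =
        (\<Sum>k<N. if k = \<pi> i then (if k = \<pi> j then 1 else (0::complex)) else 0)" by (intro sum.cong) auto
    also have "\<dots> = (if \<pi> i = \<pi> j then 1 else 0)" using \<pi>N[OF that(1)] by (simp add: sum.delta)
    also have "\<pi> i = \<pi> j \<longleftrightarrow> i = j" using \<pi> that by (auto simp: bij_betw_def inj_on_def)
    finally show ?thesis .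
  qed
  show "unitary_matrix N (\<lambda>k l. if l = \<pi> k then 1 else 0)"
    unfolding unitary_matrix_def using 1 2 by blast
  show "matrix_map N (\<lambda>k l. if l = \<pi> k then 1 else 0) w k = w (\<pi> k)" if "k < N"
    using \<pi>N[OF that] that by (simp add: matrix_map_def if_distrib[of "\<lambda>x. x * _"] cong: if_cong)
qed

text \<open>The map consists of all components \<open>p \<circ> h\<close>, scaled by \<open>1 / sqrt (card \<G>)\<close>. Since the
  squared norm of the given list is invariant, averaging does not change it. Composition with a
  group element permutes the components, which is a unitary map of the target.\<close>

lemma equivariant_symmetrization:
  fixes ps :: "((nat \<Rightarrow> complex) \<Rightarrow> complex) list" and \<G> :: "((nat \<Rightarrow> complex) \<Rightarrow> nat \<Rightarrow> complex) set"
  assumes fin: "finite \<G>" "\<G> \<noteq> {}"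
    and bij: "\<And>\<gamma>. \<gamma> \<in> \<G> \<Longrightarrow> bij_betw (\<lambda>h. h \<circ> \<gamma>) \<G> \<G>"
    and H: "\<And>z. H z = (\<Sum>p\<leftarrow>ps. (cmod (p z))\<^sup>2)" "\<And>z h. z \<in> cspace n \<Longrightarrow> h \<in> \<G> \<Longrightarrow> H (h z) = H z"
  obtains N f c where "c \<noteq> 0" "\<And>z. f z \<in> cspace N"
    "\<And>z. z \<in> cspace n \<Longrightarrow> (cnorm N (f z))\<^sup>2 = H z"
    "\<And>j. j < N \<Longrightarrow> \<exists>p\<in>set ps. \<exists>h\<in>\<G>. \<forall>z. f z j = c * p (h z)"
    "\<And>p h. p \<in> set ps \<Longrightarrow> h \<in> \<G> \<Longrightarrow> \<exists>j<N. \<forall>z. f z j = c * p (h z)"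
    "\<And>\<gamma>. \<gamma> \<in> \<G> \<Longrightarrow> \<exists>V. unitary_matrix N V \<and> (\<forall>z. f (\<gamma> z) = matrix_map N V (f z))"
proof -
  define L where "L = length ps"
  let ?I = "\<G> \<times> {..<L}"
  define N where "N = card ?I"
  have "finite ?I" using fin by simp
  then obtain e where e: "bij_betw e {..<N} ?I"
    using ex_bij_betw_nat_finite[of ?I] by (auto simp: N_def atLeast0LessThan)
  have eI: "fst (e k) \<in> \<G>" "snd (e k) < L" if "k < N" for k
    using bij_betwE[OF e] that by (auto simp: mem_Times_iff)
  have Ie: "\<exists>k<N. e k = (h, i)" if "h \<in> \<G>" "i < L" for h i
    using e that by (metis (no_types, lifting) SigmaI bij_betw_def imageE lessThan_iff)
  have G0: "card \<G> > 0" using fin by (simp add: card_gt_0_iff)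
  define c where "c = complex_of_real (1 / sqrt (card \<G>))"
  have c: "c \<noteq> 0" "(cmod c)\<^sup>2 * card \<G> = 1"
    using G0 by (simp_all add: c_def norm_divide power_divide)
  define f where "f z = (\<lambda>k. if k < N then c * (ps ! snd (e k)) (fst (e k) z) else 0)" for z
  show thesis
  proof (rule that[of c f N])
    show "c \<noteq> 0" by (rule c)
    show "f z \<in> cspace N" for z by (simp add: f_def cspace_def)
    show "(cnorm N (f z))\<^sup>2 = H z" if z: "z \<in> cspace n" for z
    proof -
      have "(cnorm N (f z))\<^sup>2 = (\<Sum>k<N. (\<lambda>(h, i). (cmod c)\<^sup>2 * (cmod ((ps ! i) (h z)))\<^sup>2) (e k))"
        unfolding cnorm_sq by (intro sum.cong) (auto simp: f_def case_prod_beta norm_mult power_mult_distrib)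
      also have "\<dots> = (\<Sum>(h, i)\<in>?I. (cmod c)\<^sup>2 * (cmod ((ps ! i) (h z)))\<^sup>2)"
        by (rule sum.reindex_bij_betw[OF e])
      also have "\<dots> = (\<Sum>h\<in>\<G>. (cmod c)\<^sup>2 * (\<Sum>i<L. (cmod ((ps ! i) (h z)))\<^sup>2))"
        by (simp add: sum.cartesian_product[symmetric] sum_distrib_left)
      also have "\<dots> = (\<Sum>h\<in>\<G>. (cmod c)\<^sup>2 * H (h z))"
        by (simp add: H(1) sum_list_sum_nth L_def atLeast0LessThan)
      also have "\<dots> = (cmod c)\<^sup>2 * card \<G> * H z"
        using H(2)[OF z] by simp
      finally show ?thesis using c by simp
    qed
    show "\<exists>p\<in>set ps. \<exists>h\<in>\<G>. \<forall>z. f z j = c * p (h z)" if "j < N" for j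
      using eI[OF that] that
      by (intro bexI[of _ "ps ! snd (e j)"] bexI[of _ "fst (e j)"]) (auto simp: f_def L_def)
    show "\<exists>j<N. \<forall>z. f z j = c * p (h z)" if ph: "p \<in> set ps" "h \<in> \<G>" for p h
    proof -
      obtain i where i: "i < L" "p = ps ! i" using ph by (auto simp: in_set_conv_nth L_def)
      then obtain k where "k < N" "e k = (h, i)" using Ie ph by blast
      then show ?thesis using i by (auto simp: f_def)
    qed
    show "\<exists>V. unitary_matrix N V \<and> (\<forall>z. f (\<gamma> z) = matrix_map N V (f z))" if \<gamma>: "\<gamma> \<in> \<G>" for \<gamma>
    proof -
      define \<tau> where "\<tau> = map_prod (\<lambda>h :: (nat \<Rightarrow> complex) \<Rightarrow> nat \<Rightarrow> complex. h \<circ> \<gamma>) (id :: nat \<Rightarrow> nat)"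
      have \<tau>: "bij_betw \<tau> ?I ?I"
        using bij[OF \<gamma>] unfolding \<tau>_def bij_betw_def
        by (intro conjI map_prod_inj_on map_prod_surj_on) auto
      \<comment> \<open>The permutation of the indices that composition with \<open>\<gamma>\<close> induces.\<close>
      define \<pi> where "\<pi> = inv_into {..<N} e \<circ> (\<tau> \<circ> e)"
      have \<pi>: "bij_betw \<pi> {..<N} {..<N}"
        unfolding \<pi>_def by (intro bij_betw_trans[OF bij_betw_trans[OF e \<tau>]] bij_betw_inv_into e)
      have e\<pi>: "e (\<pi> k) = (fst (e k) \<circ> \<gamma>, snd (e k))" if "k < N" for k
      proof -
        have "\<tau> (e k) \<in> ?I" using bij_betwE[OF \<tau>] bij_betwE[OF e] that by blast
        then show ?thesis using bij_betw_inv_into_right[OF e] by (simp add: \<pi>_def) (simp add: \<tau>_def map_prod_def case_prod_beta)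
      qed
      have "f (\<gamma> z) = matrix_map N (\<lambda>k l. if l = \<pi> k then 1 else 0) (f z)" for z
      proof (rule cspace_eqI[OF _ matrix_map_in_cspace])
        show "f (\<gamma> z) \<in> cspace N" by (simp add: f_def cspace_def)
        fix k assume k: "k < N"
        have "\<pi> k < N" using bij_betwE[OF \<pi>] k by auto
        then show "f (\<gamma> z) k = matrix_map N (\<lambda>k l. if l = \<pi> k then 1 else 0) (f z) k"
          unfolding permutation_unitary(2)[OF \<pi> k] using k by (simp add: f_def e\<pi>)
      qed
      then show ?thesis using permutation_unitary(1)[OF \<pi>] by blast
    qed
  qed
qed

text \<open>The preimage of a compact subset of the open ball is closed in the closed ball, and it
  avoids the sphere because the map sends the sphere to the sphere.\<close>

lemma polynomial_proper_mapI:
  assumes poly: "\<And>j. j < N \<Longrightarrow> polynomial_fun_on n UNIV (\<lambda>z. f z j)"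
    and range: "\<And>z. f z \<in> cspace N"
    and sphere: "\<And>z. z \<in> cspace n \<Longrightarrow> cnorm n z = 1 \<Longrightarrow> cnorm N (f z) = 1"
    and ball: "\<And>z. z \<in> uball n \<Longrightarrow> cnorm N (f z) < 1"
  shows "polynomial_proper_map n N f"
proof -
  have hol: "holomorphic_map_on n N S f" if "S \<subseteq> cspace n" for S
    unfolding holomorphic_map_on_def
    using range that polynomial_imp_holomorphic[OF polynomial_fun_on_subset[OF poly], of _ S] by auto
  have "compact {z \<in> uball n. f z \<in> K}" if K: "compact K" "K \<subseteq> uball N" for K
  proof -
    let ?C = "{z \<in> cspace n. cnorm n z \<le> 1}"
    have C: "compact ?C" by (rule compact_closed_uball)
    have "continuous_on ?C f"
      by (rule holomorphic_map_on_imp_continuous_on[OF _ hol]) auto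
    then have "closed (?C \<inter> f -` K)"
      using C K by (intro continuous_closed_preimage compact_imp_closed)
    then have "compact (?C \<inter> (?C \<inter> f -` K))" by (rule compact_Int_closed[OF C])
    also have "?C \<inter> (?C \<inter> f -` K) = {z \<in> uball n. f z \<in> K}"
      using K(2) sphere by (auto simp: uball_def less_le)
    finally show ?thesis .
  qed
  moreover have "f \<in> uball n \<rightarrow> uball N" using ball range by (auto simp: uball_def)
  ultimately have "proper_holomorphic_map n N f"
    unfolding proper_holomorphic_map_alt using hol[OF uball_subset] by blast
  then show ?thesis
    unfolding polynomial_proper_map_def using polynomial_fun_on_subset[OF poly] by auto
qed

section \<open>Elements of the invariant group fix the origin\<close>

lemma poly_eq_on_disc:
  assumes "\<And>t. cmod t < 1 \<Longrightarrow> poly p t = poly q t"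
  shows "p = q"
proof (rule ccontr)
  assume "p \<noteq> q"
  then have "finite {t. poly (p - q) t = 0}" by (intro poly_roots_finite) simp
  moreover have "ball 0 1 \<subseteq> {t. poly (p - q) t = 0}" using assms by auto
  ultimately have "finite (ball (0::complex) 1)" by (rule rev_finite_subset)
  then show False using uncountable_ball[of 1 "0::complex"] countable_finite by auto
qed

text \<open>As \<open>(1 - t)\<^sup>d\<close> does not vanish at \<open>x\<close>, divisibility would make \<open>1 - L\<close> a multiple of
  \<open>(t - x)\<^sup>d\<close>, and by its degree a constant multiple. But the derivative of \<open>1 - L\<close> at \<open>0\<close>
  vanishes, that of \<open>(t - x)\<^sup>d\<close> does not.\<close>

lemma poly_power_root_obstruction:
  fixes L :: "complex poly"
  assumes d: "d \<ge> 1" and x: "x \<noteq> 0" "x \<noteq> 1" and deg: "degree L \<le> d" and low: "monom 1 2 dvd L"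
  shows "\<not> [:- x, 1:] ^ d dvd [:1, - 1:] ^ d * (1 - L)"
proof
  assume dvd: "[:- x, 1:] ^ d dvd [:1, - 1:] ^ d * (1 - L)"
  obtain T where T: "L = monom 1 2 * T" using low by (rule dvdE)
  have L0: "poly L 0 = 0" and L1: "poly (pderiv L) 0 = 0"
    by (simp_all add: T poly_monom pderiv_mult pderiv_monom)
  have Q: "1 - L \<noteq> 0" using L0 by auto
  have P: "poly ([:1, - 1:] ^ d) x \<noteq> 0" using x by simp
  then have P0: "[:1, - 1:] ^ d \<noteq> (0 :: complex poly)" by auto
  have "d \<le> order x ([:1, - 1:] ^ d * (1 - L))"
    using dvd P0 Q by (simp add: order_divides)
  also have "\<dots> = order x (1 - L)"
    using order_0I[OF P] P0 Q by (simp add: order_mult)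
  finally have "[:- x, 1:] ^ d dvd 1 - L" by (simp add: order_divides)
  then obtain R where R: "1 - L = [:- x, 1:] ^ d * R" by (rule dvdE)
  have R0: "R \<noteq> 0" using R Q by auto
  have "degree (1 - L) = d + degree R"
    unfolding R using R0 by (simp add: degree_mult_eq degree_power_eq)
  moreover have "degree (1 - L) \<le> d" using deg by (intro degree_diff_le) auto
  ultimately obtain k where k: "R = [:k:]" using degree_eq_zeroE[of R] by auto
  have "poly (pderiv (1 - L)) 0 = of_nat d * (- x) ^ (d - 1) * k"
    unfolding R k by (simp add: pderiv_mult pderiv_power pderiv_pCons pderiv_smult)
  moreover have "poly (pderiv (1 - L)) 0 = 0" using L1 by (simp add: pderiv_diff)
  ultimately show False using d x R0 k by simp
qed

text \<open>Let \<open>a\<close> and \<open>b\<close> be the zeros of \<open>\<gamma>\<close> and \<open>\<psi>\<close>. On the line through \<open>a\<close>, a component of \<open>f\<close>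
  that is homogeneous of degree \<open>d\<close> turns into \<open>c ((1 - t) / (1 - t \<parallel>a\<parallel>\<^sup>2))\<^sup>d\<close> under composition
  with \<open>\<gamma>\<close>. It is also a component of \<open>\<psi> \<circ> f\<close>, a polynomial divided by \<open>1 - \<langle>f, b\<rangle>\<close>. So if
  \<open>a \<noteq> 0\<close>, the pole of order \<open>d\<close> at \<open>1 / \<parallel>a\<parallel>\<^sup>2\<close> forces \<open>1 - \<langle>f, b\<rangle>\<close> to vanish there to order
  \<open>d\<close>, which is impossible since \<open>f\<close> has degree at most \<open>d\<close> and no linear terms.\<close>

lemma equivariant_fixes_0:
  assumes d: "d \<ge> 1"
    and low: "\<And>j. j < N \<Longrightarrow> graded n 2 d (\<lambda>z. f z j)"
    and top: "\<And>u. u \<in> cspace n \<Longrightarrow> u \<noteq> (\<lambda>i. 0) \<Longrightarrow> \<exists>j<N. graded n d d (\<lambda>z. f z j) \<and> f u j \<noteq> 0"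
    and range: "\<And>z. z \<in> uball n \<Longrightarrow> f z \<in> uball N"
    and \<gamma>: "\<gamma> \<in> Aut_ball n" and \<psi>: "\<psi> \<in> Aut_ball N"
    and eq: "\<And>z. z \<in> uball n \<Longrightarrow> f (\<gamma> z) = \<psi> (f z)"
  shows "\<gamma> (\<lambda>i. 0) = (\<lambda>i. 0)"
proof -
  obtain a U where a: "a \<in> uball n" and U: "unitary_matrix n U" and \<gamma>a: "\<gamma> a = (\<lambda>i. 0)"
    and \<gamma>_eq: "\<And>z. z \<in> uball n \<Longrightarrow> \<gamma> z = matrix_map n U (mobius n a z)"
    using Aut_ball_decomp[OF \<gamma>] by metis
  obtain b V where b: "b \<in> uball N" and V: "unitary_matrix N V"
    and \<psi>_eq: "\<And>w. w \<in> uball N \<Longrightarrow> \<psi> w = matrix_map N V (mobius N b w)"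
    using Aut_ball_decomp[OF \<psi>] by metis
  have "a = (\<lambda>i. 0)"
  proof (rule ccontr)
    assume a0: "a \<noteq> (\<lambda>i. 0)"
    define r where "r = complex_of_real ((cnorm n a)\<^sup>2)"
    have na: "0 < (cnorm n a)\<^sup>2" "(cnorm n a)\<^sup>2 < 1"
      using a a0 cnorm_eq_0[of a n] by (simp_all add: uballD abs_square_less_1)
    then have r: "r \<noteq> 0" "r \<noteq> 1" unfolding r_def by (metis of_real_eq_0_iff less_irrefl, metis of_real_eq_1_iff less_irrefl)
    define u where "u = matrix_map n U a"
    have "cnorm n u \<noteq> 0" using na by (auto simp: u_def cnorm_unitary[OF U])
    then have "u \<noteq> (\<lambda>i. 0)" by (auto simp: cnorm_def)
    then obtain j where j: "j < N" "graded n d d (\<lambda>z. f z j)" "f u j \<noteq> 0"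
      using top[of u] by (auto simp: u_def matrix_map_in_cspace)
    have "\<exists>q. degree q \<le> d \<and> monom 1 2 dvd q \<and> (\<forall>t. f (\<lambda>i. t * a i) k = poly q t)" if "k < N" for k
      using low[OF that] by (simp add: graded_def)
    then have "\<forall>k. \<exists>q. k < N \<longrightarrow> degree q \<le> d \<and> monom 1 2 dvd q \<and> (\<forall>t. f (\<lambda>i. t * a i) k = poly q t)"
      by blast
    from choice[OF this] obtain F where F_all: "\<forall>k<N. degree (F k) \<le> d \<and> monom 1 2 dvd F k \<and>
        (\<forall>t. f (\<lambda>i. t * a i) k = poly (F k) t)" by blast
    then have F: "degree (F k) \<le> d" "monom 1 2 dvd F k" "\<And>t. f (\<lambda>i. t * a i) k = poly (F k) t"
      if "k < N" for k using that by blast+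
    define s where "s = complex_of_real (sqrt (1 - (cnorm N b)\<^sup>2))"
    define L where "L = (\<Sum>k<N. smult (cnj (b k)) (F k))"
    define T where "T = (\<Sum>k<N. smult (V j k) (smult (b k) (1 - smult (1 / (1 + s)) L) - smult s (F k)))"
    have L: "cinner N (f (\<lambda>i. t * a i)) b = poly L t" for t
      by (simp add: cinner_def L_def poly_sum F mult.commute)
    \<comment> \<open>Component \<open>j\<close> of \<open>f \<circ> \<gamma> = \<psi> \<circ> f\<close> on the line through \<open>a\<close>, with denominators cleared.\<close>
    have key: "(1 - t) ^ d * f u j * (1 - poly L t) = (1 - t * r) ^ d * poly T t" if t: "cmod t < 1" for t
    proof -
      have ta: "(\<lambda>i. t * a i) \<in> uball n" using a t by (intro scale_in_uball) auto
      have "t * r \<noteq> 1"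
      proof
        assume "t * r = 1"
        then have "cmod t * (cnorm n a)\<^sup>2 = 1" by (metis norm_mult norm_one norm_of_real r_def abs_of_nonneg zero_le_power2)
        moreover have "cmod t * (cnorm n a)\<^sup>2 < 1 * 1" using t na by (intro mult_strict_mono) auto
        ultimately show False by simp
      qed
      then have tr: "1 - t * r \<noteq> 0" by simp
      define w where "w = f (\<lambda>i. t * a i)"
      have w: "w \<in> uball N" unfolding w_def by (rule range[OF ta])
      have l: "1 - poly L t \<noteq> 0"
        unfolding L[symmetric] w_def[symmetric] using w b by (intro one_minus_cinner_nz) (auto dest: uballD)
      have "\<gamma> (\<lambda>i. t * a i) = (\<lambda>i. (1 - t) / (1 - t * r) * u i)"
        unfolding \<gamma>_eq[OF ta] mobius_line[OF uballD(2)[OF a]] matrix_map_scale u_def r_def ..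
      then have lhs: "f (\<gamma> (\<lambda>i. t * a i)) j = ((1 - t) / (1 - t * r)) ^ d * f u j"
        using graded_homogeneous[OF j(2)] by (simp only:)
      have "\<psi> w j = (\<Sum>k<N. V j k * (((1 - poly L t / (1 + s)) * b k + (- s) * w k) / (1 - poly L t)))"
        using j(1) by (simp add: \<psi>_eq[OF w] matrix_map_def mobius_def Let_def s_def L[symmetric] w_def[symmetric])
      also have "\<dots> = poly T t / (1 - poly L t)"
        unfolding T_def poly_sum sum_divide_distrib
        by (intro sum.cong refl) (simp add: w_def F algebra_simps)
      finally have "((1 - t) / (1 - t * r)) ^ d * f u j = poly T t / (1 - poly L t)"
        using lhs eq[OF ta] by (simp add: w_def)
      then show ?thesis using tr l by (simp add: power_divide field_simps)
    qed
    have "[:1, - 1:] ^ d * smult (f u j) (1 - L) = [:1, - r:] ^ d * T"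
      by (rule poly_eq_on_disc) (use key in \<open>simp add: ac_simps\<close>)
    moreover have "[:1, - r:] = smult (- r) [:- (1 / r), 1:]" using r by simp
    then have "[:- (1 / r), 1:] ^ d dvd [:1, - r:] ^ d"
      by (simp only: smult_power dvd_smult dvd_refl)
    ultimately have "[:- (1 / r), 1:] ^ d dvd [:1, - 1:] ^ d * smult (f u j) (1 - L)" by (metis dvd_mult2)
    then have "[:- (1 / r), 1:] ^ d dvd [:1, - 1:] ^ d * (1 - L)" using j(3) by (simp add: dvd_smult_iff)
    moreover have "degree L \<le> d" unfolding L_def using F(1)
      by (intro degree_sum_le) (auto intro: order_trans[OF degree_smult_le])
    moreover have "monom 1 2 dvd L" unfolding L_def using F(2) by (intro dvd_sum dvd_smult) auto
    ultimately show False using poly_power_root_obstruction[OF d, of "1 / r" L] r by simp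
  qed
  with \<gamma>a show ?thesis by simp
qed

section \<open>Recovering a finite set from its hyperplanes\<close>

lemma eventually_poly_nonzero:
  assumes "p \<noteq> (0 :: complex poly)"
  shows "\<forall>\<^sub>F t in at 0. poly p t \<noteq> 0"
proof -
  have "finite ({t. poly p t = 0} - {0})" using poly_roots_finite[OF assms] by simp
  then have "open (- ({t. poly p t = 0} - {0}))" by (intro open_Compl finite_imp_closed)
  then show ?thesis unfolding eventually_at_topological by (rule_tac exI) (rule conjI, assumption, auto)
qed

text \<open>The point \<open>x / \<parallel>x\<parallel>\<^sup>2\<close> of the hyperplane of \<open>x\<close> lies in the ball. A small shift along the
  moment curve, rescaled so as to stay on the hyperplane, leaves the finitely many other
  hyperplanes: the pairing of the shifted point with \<open>x - y\<close> is a nonzero polynomial in the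
  parameter of the curve.\<close>

lemma hyperplane_point:
  assumes S: "finite S" "S \<subseteq> cspace n" and x: "x \<in> cspace n" "1 < cnorm n x" "x \<notin> S"
  obtains z where "z \<in> uball n" "cinner n z x = 1" "\<And>y. y \<in> S \<Longrightarrow> cinner n z y \<noteq> 1"
proof -
  define c where "c = complex_of_real (1 / (cnorm n x)\<^sup>2)"
  \<comment> \<open>At \<open>t = 0\<close> this is \<open>x / \<parallel>x\<parallel>\<^sup>2\<close>, and \<open>P v\<close> is its pairing with \<open>v\<close> as a polynomial in \<open>t\<close>.\<close>
  define zeta where "zeta t = (\<lambda>i. if i < n then c * x i + t ^ Suc i else 0)" for t :: complex
  define P where "P v = [:c * cinner n x v:] + (\<Sum>i<n. monom (cnj (v i)) (Suc i))" for v
  have P: "cinner n (zeta t) v = poly (P v) t" for t v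
    by (simp add: cinner_def zeta_def P_def poly_sum poly_monom distrib_left distrib_right sum.distrib sum_distrib_left mult_ac)
  have P0: "P v \<noteq> 0" if v: "v \<in> cspace n" "v \<noteq> (\<lambda>i. 0)" for v
  proof -
    obtain i where i: "v i \<noteq> 0" using v by auto
    then have "i < n" using v by (metis (mono_tags) cspace_def mem_Collect_eq not_le)
    then have "coeff (P v) (Suc i) = cnj (v i)"
      by (simp add: P_def coeff_sum if_distrib cong: if_cong)
    then show ?thesis using i by auto
  qed
  have "\<forall>\<^sub>F t in at 0. \<forall>y\<in>S. cinner n (zeta t) (\<lambda>i. 1 * x i + (- 1) * y i) \<noteq> 0"
  proof (rule eventually_ball_finite[OF S(1)], rule ballI)
    fix y assume y: "y \<in> S"
    then have "x \<noteq> y" "y \<in> cspace n" using S x by auto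
    then have "(\<lambda>i. 1 * x i + (- 1) * y i) \<noteq> (\<lambda>i. 0)" by (auto simp: fun_eq_iff)
    moreover have "(\<lambda>i. 1 * x i + (- 1) * y i) \<in> cspace n" using \<open>y \<in> cspace n\<close> x by (simp add: cspace_def)
    ultimately show "\<forall>\<^sub>F t in at 0. cinner n (zeta t) (\<lambda>i. 1 * x i + (- 1) * y i) \<noteq> 0"
      unfolding P by (intro eventually_poly_nonzero P0)
  qed
  moreover have "\<forall>\<^sub>F t in at 0. 0 < cmod (cinner n (zeta t) x) - cnorm n (zeta t)"
  proof (rule order_tendstoD(1))
    have "isCont (\<lambda>t. cmod (cinner n (zeta t) x) - cnorm n (zeta t)) 0"
      unfolding P unfolding cnorm_def zeta_def by (intro continuous_intros) auto
    then show "((\<lambda>t. cmod (cinner n (zeta t) x) - cnorm n (zeta t)) \<longlongrightarrow>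
        cmod (cinner n (zeta 0) x) - cnorm n (zeta 0)) (at 0)" by (rule isContD)
    have "zeta 0 = (\<lambda>i. c * x i)" using x by (auto simp: zeta_def cspace_def)
    moreover have "cinner n (\<lambda>i. c * x i) x = 1"
      unfolding cinner_scale_left cinner_self c_def of_real_mult[symmetric] using x by simp
    moreover have "cnorm n (\<lambda>i. c * x i) = 1 / cnorm n x"
      unfolding cnorm_scale c_def norm_of_real using x by (simp add: power2_eq_square)
    ultimately show "0 < cmod (cinner n (zeta 0) x) - cnorm n (zeta 0)" using x by simp
  qed
  ultimately have "\<forall>\<^sub>F t in at 0. (\<forall>y\<in>S. cinner n (zeta t) (\<lambda>i. 1 * x i + (- 1) * y i) \<noteq> 0) \<and>
      0 < cmod (cinner n (zeta t) x) - cnorm n (zeta t)" by (rule eventually_conj)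
  then obtain t where t: "\<forall>y\<in>S. cinner n (zeta t) (\<lambda>i. 1 * x i + (- 1) * y i) \<noteq> 0"
    "cnorm n (zeta t) < cmod (cinner n (zeta t) x)"
    using eventually_happens[of _ "at (0::complex)"] by auto
  define l where "l = cinner n (zeta t) x"
  have l: "cmod l > 0" using t(2) cnorm_nonneg[of n "zeta t"] unfolding l_def by linarith
  show thesis
  proof (rule that[of "\<lambda>i. 1 / l * zeta t i"])
    have "zeta t \<in> cspace n" by (simp add: zeta_def cspace_def)
    moreover have "cnorm n (\<lambda>i. 1 / l * zeta t i) < 1"
      unfolding cnorm_scale using t(2) l by (simp add: l_def norm_divide)
    ultimately show "(\<lambda>i. 1 / l * zeta t i) \<in> uball n" by (simp add: uball_def scale_in_cspace[of _ n "1 / l", simplified])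
    show "cinner n (\<lambda>i. 1 / l * zeta t i) x = 1"
      unfolding cinner_scale_left using l by (simp add: l_def)
    show "cinner n (\<lambda>i. 1 / l * zeta t i) y \<noteq> 1" if "y \<in> S" for y
    proof
      assume "cinner n (\<lambda>i. 1 / l * zeta t i) y = 1"
      then have "cinner n (zeta t) y = l" unfolding cinner_scale_left using l by (simp add: field_simps)
      then have "cinner n (zeta t) (\<lambda>i. 1 * x i + (- 1) * y i) = 0"
        unfolding cinner_comb_right by (simp add: l_def)
      with t(1) that show False by blast
    qed
  qed
qed

text \<open>If \<open>U x\<close> were not in \<open>S\<close>, some point \<open>z\<close> of the ball would lie on the hyperplane of \<open>U x\<close>
  but on none of those of \<open>S\<close>. With \<open>V\<close> the inverse of \<open>U\<close>, the point \<open>V z\<close> lies on the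
  hyperplane of \<open>x\<close>, so the form vanishes at \<open>V z\<close> but not at \<open>z\<close>.\<close>

lemma hyperplane_form_preserved:
  assumes S: "finite S" "S \<subseteq> cspace n" "\<And>x. x \<in> S \<Longrightarrow> 1 < cnorm n x" and U: "unitary_matrix n U"
    and eq: "\<And>z. z \<in> uball n \<Longrightarrow> z \<noteq> (\<lambda>i. 0) \<Longrightarrow> hyperplane_form n S (matrix_map n U z) = hyperplane_form n S z"
    and x: "x \<in> S"
  shows "matrix_map n U x \<in> S"
proof (rule ccontr)
  assume "matrix_map n U x \<notin> S"
  moreover have "1 < cnorm n (matrix_map n U x)" using S(3)[OF x] by (simp add: cnorm_unitary[OF U])
  ultimately obtain z where z: "z \<in> uball n" "cinner n z (matrix_map n U x) = 1" "\<And>y. y \<in> S \<Longrightarrow> cinner n z y \<noteq> 1"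
    using hyperplane_point[OF S(1,2) matrix_map_in_cspace] by metis
  have zero_iff: "hyperplane_form n S w = 0 \<longleftrightarrow> (\<exists>y\<in>S. cinner n w y = 1)" for w
  proof -
    have "2 * (1 + (cnorm n y)\<^sup>2) \<noteq> 0" for y by (metis add_pos_nonneg less_irrefl mult_pos_pos zero_le_power2 zero_less_numeral zero_less_one)
    then show ?thesis using S(1) by (auto simp: hyperplane_form_def prod_zero_iff)
  qed
  define w where "w = matrix_map n (\<lambda>i j. cnj (U j i)) z"
  have w: "w \<in> uball n" unfolding w_def by (rule matrix_map_in_uball[OF unitary_matrix_adjoint[OF U] z(1)])
  have Uw: "matrix_map n U w = z" unfolding w_def by (rule unitary_inverse(2)[OF U uballD(1)[OF z(1)]])
  have wx: "cinner n w x = 1"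
    using cinner_unitary[OF U uballD(1)[OF w], of x] S(2) x z(2) Uw by auto
  then have "w \<noteq> (\<lambda>i. 0)" by (auto simp: cinner_def)
  from eq[OF w this] have "hyperplane_form n S z = hyperplane_form n S w" by (simp add: Uw)
  moreover have "hyperplane_form n S w = 0" using wx x zero_iff by blast
  ultimately show False using zero_iff[of z] z(3) by auto
qed

section \<open>Vectors on the moment curve\<close>

text \<open>Any \<open>n\<close> of these vectors with different \<open>t > 0\<close> are linearly independent (Vandermonde).
  Starting with the first power of \<open>t\<close> makes their norms distinct also for \<open>n = 1\<close>.\<close>

definition moment_vector :: "nat \<Rightarrow> nat \<Rightarrow> nat \<Rightarrow> complex"
  where "moment_vector n t = (\<lambda>i. if i < n then of_nat t ^ Suc i else 0)"

lemma moment_vector_in_cspace: "moment_vector n t \<in> cspace n"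
  by (simp add: moment_vector_def cspace_def)

lemma cnorm_moment_vector_less:
  assumes "n \<ge> 1" "s < t"
  shows "cnorm n (moment_vector n s) < cnorm n (moment_vector n t)"
  unfolding cnorm_def real_sqrt_less_iff
proof (rule sum_strict_mono)
  show "{..<n} \<noteq> {}" using assms by (simp add: lessThan_empty_iff)
  fix i assume "i \<in> {..<n}"
  then have "cmod (moment_vector n m i) = real m ^ Suc i" for m
    by (simp add: moment_vector_def norm_mult norm_power)
  moreover have "real s ^ Suc i < real t ^ Suc i" using assms by (intro power_strict_mono) auto
  then have "(real s ^ Suc i)\<^sup>2 < (real t ^ Suc i)\<^sup>2" by (rule power_strict_mono) simp_all
  ultimately show "(cmod (moment_vector n s i))\<^sup>2 < (cmod (moment_vector n t i))\<^sup>2"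
    by (simp only:)
qed simp

lemma matrix_map_eq_on_moment_vectors:
  assumes T: "finite T" "card T \<ge> n" "0 \<notin> T"
    and eq: "\<And>t. t \<in> T \<Longrightarrow> matrix_map n U (moment_vector n t) = matrix_map n W (moment_vector n t)"
  shows "matrix_map n U = matrix_map n W"
proof -
  have "U j i = W j i" if j: "j < n" and i: "i < n" for i j
  proof -
    define q where "q = (\<Sum>i<n. monom (U j i - W j i) i)"
    have "poly q (of_nat t) = 0" if t: "t \<in> T" for t
    proof -
      have "of_nat t * poly q (of_nat t) = matrix_map n U (moment_vector n t) j - matrix_map n W (moment_vector n t) j"
        using j by (simp add: q_def poly_sum poly_monom matrix_map_def moment_vector_def sum_distrib_left
            sum_subtractf algebra_simps)
      moreover have "of_nat t \<noteq> (0 :: complex)" using t T(3) by (metis of_nat_eq_0_iff)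
      ultimately show ?thesis using eq[OF t] by simp
    qed
    then have sub: "of_nat ` T \<subseteq> {x. poly q x = 0}" by auto
    have "q = 0"
    proof (rule ccontr)
      assume q: "q \<noteq> 0"
      have "card (of_nat ` T :: complex set) = card T" by (intro card_image inj_onI) simp
      then have "n \<le> card {x. poly q x = 0}"
        using T card_mono[OF poly_roots_finite[OF q] sub] by simp
      also have "\<dots> \<le> degree q" by (rule card_poly_roots_bound[OF q])
      also have "\<dots> \<le> n - 1"
        unfolding q_def by (intro degree_sum_le) (auto intro: order_trans[OF degree_monom_le])
      finally show False using i by simp
    qed
    then have "coeff q i = 0" by simp
    then show ?thesis using i by (simp add: q_def coeff_sum)
  qed
  then show ?thesis by (auto simp: matrix_map_def fun_eq_iff)
qed

section \<open>Finite unitary groups\<close>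

lemma matrix_map_eqI:
  assumes "\<And>z. z \<in> uball n \<Longrightarrow> matrix_map n U z = matrix_map n W z"
  shows "matrix_map n U = matrix_map n W"
proof
  fix z
  define r where "r = 1 / (1 + cnorm n z)"
  have "1 + cnorm n z > 0" using cnorm_nonneg[of n z] by linarith
  then have r: "r > 0" "r * cnorm n z < 1" by (auto simp: r_def)
  define y where "y = (\<lambda>i. if i < n then z i else 0)"
  have y: "y \<in> cspace n" "cnorm n y = cnorm n z" "matrix_map n X y = matrix_map n X z" for X
    by (auto simp: y_def cspace_def cnorm_def matrix_map_def)
  then have "(\<lambda>i. of_real r * y i) \<in> uball n"
    using r by (simp add: uball_def cnorm_scale scale_in_cspace)
  from assms[OF this] r show "matrix_map n U z = matrix_map n W z"
    by (simp add: matrix_map_scale y fun_eq_iff)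
qed

lemma matrix_map_compose:
  "matrix_map n U (matrix_map n W z) = matrix_map n (\<lambda>i j. \<Sum>k<n. U i k * W k j) z"
proof (rule cspace_eqI[OF matrix_map_in_cspace matrix_map_in_cspace])
  fix i assume i: "i < n"
  have "matrix_map n U (matrix_map n W z) i = (\<Sum>k<n. \<Sum>j<n. U i k * W k j * z j)"
    using i by (simp add: matrix_map_def sum_distrib_left mult.assoc)
  also have "\<dots> = (\<Sum>j<n. \<Sum>k<n. U i k * W k j * z j)" by (rule sum.swap)
  finally show "matrix_map n U (matrix_map n W z) i = matrix_map n (\<lambda>i j. \<Sum>k<n. U i k * W k j) z i"
    using i by (simp add: matrix_map_def sum_distrib_right)
qed

lemma restrict_unitary_in_Aut_ball:
  "unitary_matrix n U \<Longrightarrow> restrict (matrix_map n U) (uball n) \<in> Aut_ball n"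
  using unitary_ball_subset_Aut_ball by (auto simp: unitary_ball_def)

text \<open>The members of \<open>\<G>\<close> are linear maps on all of space, so that they can be applied to vectors
  outside the ball. Take for \<open>S\<close> the union of the orbits of sufficiently many moment vectors. A
  compatible automorphism is unitary and preserves the prescribed norm, hence maps \<open>S\<close> into
  itself. Since the norms separate the orbits, it maps each moment vector as some group element
  does, and with \<open>n\<close> times the group order many vectors, one group element serves for \<open>n\<close> of
  them; it then agrees with the automorphism everywhere.\<close>

lemma finite_unitary_group_realized:
  fixes \<G> :: "((nat \<Rightarrow> complex) \<Rightarrow> nat \<Rightarrow> complex) set"
  assumes n: "n \<ge> 1" and fin: "finite \<G>"
    and unitary: "\<And>g. g \<in> \<G> \<Longrightarrow> \<exists>U. unitary_matrix n U \<and> g = matrix_map n U"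
    and one: "e \<in> \<G>" "\<And>z. z \<in> cspace n \<Longrightarrow> e z = z"
    and mult: "\<And>g h. g \<in> \<G> \<Longrightarrow> h \<in> \<G> \<Longrightarrow> g \<circ> h \<in> \<G>"
  shows "\<exists>N f. polynomial_proper_map n N f \<and>
    hermitian_invariant_group n N f = (\<lambda>g. restrict g (uball n)) ` \<G>"
proof -
  have bij: "bij_betw (\<lambda>h. h \<circ> \<gamma>) \<G> \<G>" if \<gamma>: "\<gamma> \<in> \<G>" for \<gamma>
  proof -
    obtain X where X: "unitary_matrix n X" "\<gamma> = matrix_map n X" using unitary[OF \<gamma>] by blast
    have "inj_on (\<lambda>h. h \<circ> \<gamma>) \<G>"
    proof (rule inj_onI)
      fix h h' assume *: "h \<in> \<G>" "h' \<in> \<G>" "h \<circ> \<gamma> = h' \<circ> \<gamma>"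
      obtain U W where UW: "h = matrix_map n U" "h' = matrix_map n W"
        using unitary[OF *(1)] unitary[OF *(2)] by blast
      show "h = h'"
        unfolding UW
      proof (rule matrix_map_eqI)
        fix z assume "z \<in> uball n"
        then have "z = \<gamma> (matrix_map n (\<lambda>i j. cnj (X j i)) z)"
          unfolding X(2) by (intro unitary_inverse(2)[OF X(1), symmetric]) (rule uballD)
        then show "matrix_map n U z = matrix_map n W z"
          using fun_cong[OF *(3)] unfolding UW by (metis comp_apply)
      qed
    qed
    then show ?thesis using fin \<gamma> mult by (intro bij_betw_imageI endo_inj_surj) auto
  qed
  define v where "v = moment_vector n"
  \<comment> \<open>Parameters from \<open>2\<close> on give vectors of norm greater than \<open>1\<close>; their number serves the pigeonhole principle.\<close>
  define T where "T = {2..<2 + n * card \<G>}"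
  define S where "S = (\<Union>h\<in>\<G>. (\<lambda>t. h (v t)) ` T)"
  have v: "v t \<in> cspace n" for t by (simp add: v_def moment_vector_in_cspace)
  have S_fin: "finite S" using fin by (simp add: S_def T_def)
  have S_sub: "S \<subseteq> cspace n"
    using unitary by (auto simp: S_def matrix_map_in_cspace) (metis matrix_map_in_cspace)
  have norm: "cnorm n (h z) = cnorm n z" if "h \<in> \<G>" for h z
    using unitary[OF that] cnorm_unitary by auto
  have S_norm: "1 < cnorm n x" if x: "x \<in> S" for x
  proof -
    obtain h t where "h \<in> \<G>" "t \<in> T" "x = h (v t)" using x unfolding S_def by blast
    moreover have "cmod (v t 0) \<le> cnorm n (v t)" using n by (intro norm_le_cnorm) simp
    moreover have "cmod (v t 0) = real t" using n by (simp add: v_def moment_vector_def)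
    ultimately show ?thesis by (simp add: norm T_def)
  qed
  have S_inv: "\<gamma> ` S = S" if \<gamma>: "\<gamma> \<in> \<G>" for \<gamma>
  proof (rule endo_inj_surj[OF S_fin])
    show "\<gamma> ` S \<subseteq> S"
    proof clarify
      fix x assume "x \<in> S"
      then obtain h t where "h \<in> \<G>" "t \<in> T" "x = h (v t)" unfolding S_def by blast
      then show "\<gamma> x \<in> S" unfolding S_def using mult[OF \<gamma>, of h]
        by (intro UN_I[of "\<gamma> \<circ> h"] image_eqI[of _ _ t]) auto
    qed
    obtain X where X: "unitary_matrix n X" "\<gamma> = matrix_map n X" using unitary[OF \<gamma>] by blast
    show "inj_on \<gamma> S"
      using unitary_inverse(1)[OF X(1)] S_sub X(2)
      by (intro inj_on_inverseI[where g = "matrix_map n (\<lambda>i j. cnj (X j i))"]) auto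
  qed
  define d where "d = card S + 3"
  obtain ps where ps: "\<And>p. p \<in> set ps \<Longrightarrow> graded n 2 d p"
    "\<And>z. prescribed_norm n S z = (\<Sum>p\<leftarrow>ps. (cmod (p z))\<^sup>2)"
    "\<And>z. z \<in> cspace n \<Longrightarrow> z \<noteq> (\<lambda>i. 0) \<Longrightarrow> \<exists>p\<in>set ps. graded n d d p \<and> p z \<noteq> 0"
    unfolding d_def by (rule prescribed_norm_polynomials[OF S_fin]) blast
  have norm_inv: "prescribed_norm n S (h z) = prescribed_norm n S z" if "z \<in> cspace n" "h \<in> \<G>" for z h
    using unitary[OF that(2)] prescribed_norm_unitary[OF _ S_sub _ that(1)] S_inv[OF that(2)] by auto
  have "\<G> \<noteq> {}" using one by auto
  obtain N f c where c: "c \<noteq> 0" and f_space: "\<And>z. f z \<in> cspace N"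
    and f_norm: "\<And>z. z \<in> cspace n \<Longrightarrow> (cnorm N (f z))\<^sup>2 = prescribed_norm n S z"
    and f_comp: "\<And>j. j < N \<Longrightarrow> \<exists>p\<in>set ps. \<exists>h\<in>\<G>. \<forall>z. f z j = c * p (h z)"
    and f_all: "\<And>p h. p \<in> set ps \<Longrightarrow> h \<in> \<G> \<Longrightarrow> \<exists>j<N. \<forall>z. f z j = c * p (h z)"
    and f_equi: "\<And>\<gamma>. \<gamma> \<in> \<G> \<Longrightarrow> \<exists>V. unitary_matrix N V \<and> (\<forall>z. f (\<gamma> z) = matrix_map N V (f z))"
    by (rule equivariant_symmetrization[where \<G> = \<G> and H = "prescribed_norm n S" and ps = ps and n = n])
      (rule fin \<open>\<G> \<noteq> {}\<close> bij ps(2) norm_inv; assumption | blast)+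
  have graded_comp: "graded n l d (\<lambda>z. c * p (h z))" if "graded n l d p" "h \<in> \<G>" for l p h
    using unitary[OF that(2)] graded_scale[OF graded_matrix_map[OF that(1)]] by auto
  have low: "graded n 2 d (\<lambda>z. f z j)" if j: "j < N" for j
  proof -
    obtain p h where "p \<in> set ps" "h \<in> \<G>" "\<forall>z. f z j = c * p (h z)" using f_comp[OF j] by blast
    then show ?thesis using graded_comp[OF ps(1)] by simp
  qed
  have f_ball: "f z \<in> uball N" if z: "z \<in> uball n" for z
  proof -
    have "(cnorm N (f z))\<^sup>2 < 1"
      unfolding f_norm[OF uballD(1)[OF z]] by (rule prescribed_norm_bounds(2)[OF S_fin uballD(2)[OF z]])
    then show ?thesis using f_space by (simp add: uball_def abs_square_less_1)
  qed
  have proper: "polynomial_proper_map n N f"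
  proof (rule polynomial_proper_mapI)
    show "polynomial_fun_on n UNIV (\<lambda>z. f z j)" if "j < N" for j
      by (rule graded_polynomial[OF low[OF that]])
    show "cnorm N (f z) = 1" if "z \<in> cspace n" "cnorm n z = 1" for z
      using f_norm[OF that(1)] prescribed_norm_bounds(1)[OF S_fin that(2)] cnorm_nonneg[of N "f z"]
      by (simp add: power2_eq_1_iff)
    show "cnorm N (f z) < 1" if "z \<in> uball n" for z using f_ball[OF that] by (rule uballD)
  qed (rule f_space)
  have "restrict \<gamma> (uball n) \<in> hermitian_invariant_group n N f" if \<gamma>: "\<gamma> \<in> \<G>" for \<gamma>
  proof -
    obtain X where X: "unitary_matrix n X" "\<gamma> = matrix_map n X" using unitary[OF \<gamma>] by blast
    obtain V where V: "unitary_matrix N V" "\<And>z. f (\<gamma> z) = matrix_map N V (f z)" using f_equi[OF \<gamma>] by blast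
    have "restrict \<gamma> (uball n) \<in> Aut_ball n" unfolding X(2) by (rule restrict_unitary_in_Aut_ball[OF X(1)])
    moreover have "\<forall>z\<in>uball n. f (restrict \<gamma> (uball n) z) = restrict (matrix_map N V) (uball N) (f z)"
      using f_ball by (simp add: V(2))
    ultimately show ?thesis
      unfolding hermitian_invariant_group_def using restrict_unitary_in_Aut_ball[OF V(1)] by blast
  qed
  moreover have "\<exists>g\<in>\<G>. \<gamma> = restrict g (uball n)" if inv: "\<gamma> \<in> hermitian_invariant_group n N f" for \<gamma>
  proof -
    obtain \<psi> where \<gamma>: "\<gamma> \<in> Aut_ball n" and \<psi>: "\<psi> \<in> Aut_ball N"
      and eq: "\<And>z. z \<in> uball n \<Longrightarrow> f (\<gamma> z) = \<psi> (f z)"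
      using inv by (auto simp: hermitian_invariant_group_def)
    have \<gamma>0: "\<gamma> (\<lambda>i. 0) = (\<lambda>i. 0)"
    proof (rule equivariant_fixes_0[OF _ low _ f_ball \<gamma> \<psi> eq])
      show "d \<ge> 1" by (simp add: d_def)
      show "\<exists>j<N. graded n d d (\<lambda>z. f z j) \<and> f u j \<noteq> 0" if u: "u \<in> cspace n" "u \<noteq> (\<lambda>i. 0)" for u
      proof -
        obtain p where p: "p \<in> set ps" "graded n d d p" "p u \<noteq> 0" using ps(3)[OF u] by blast
        obtain j where j: "j < N" "\<forall>z. f z j = c * p (e z)" using f_all[OF p(1) one(1)] by blast
        then show ?thesis using graded_comp[OF p(2) one(1)] p(3) c one(2)[OF u(1)] by auto
      qed
    qed
    obtain U where U: "unitary_matrix n U" "\<gamma> = restrict (matrix_map n U) (uball n)"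
      using Aut_ball_fixing_0[OF \<gamma> \<gamma>0] by blast
    have zero: "(\<lambda>i. 0) \<in> cspace n" by (simp add: cspace_def)
    have "cnorm n (\<lambda>i. 0) = 0" by (simp add: cnorm_def)
    then have "prescribed_norm n S (\<lambda>i. 0) = 0" by (simp add: prescribed_norm_def Let_def)
    then have f0: "f (\<lambda>i. 0) = (\<lambda>i. 0)" using f_norm[OF zero] cnorm_eq_0[OF f_space] by simp
    then have "\<psi> (\<lambda>i. 0) = (\<lambda>i. 0)" using eq[OF zero_in_uball] \<gamma>0 by simp
    then obtain V where V: "unitary_matrix N V" "\<psi> = restrict (matrix_map N V) (uball N)"
      using Aut_ball_fixing_0[OF \<psi>] by blast
    have "matrix_map n U x \<in> S" if x: "x \<in> S" for x
    proof (rule hyperplane_form_preserved[OF S_fin S_sub S_norm U(1) _ x])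
      fix z assume z: "z \<in> uball n" "z \<noteq> (\<lambda>i. 0)"
      show "hyperplane_form n S (matrix_map n U z) = hyperplane_form n S z"
      proof (rule prescribed_norm_determines_hyperplane_form)
        have "f (matrix_map n U z) = matrix_map N V (f z)"
          using eq[OF z(1)] z f_ball by (simp add: U(2) V(2))
        then have "(cnorm N (f (matrix_map n U z)))\<^sup>2 = (cnorm N (f z))\<^sup>2" by (simp add: cnorm_unitary[OF V(1)])
        then show "prescribed_norm n S (matrix_map n U z) = prescribed_norm n S z"
          using f_norm[OF matrix_map_in_cspace] f_norm[OF uballD(1)[OF z(1)]] by simp
        show "cnorm n (matrix_map n U z) = cnorm n z" by (rule cnorm_unitary[OF U(1)])
        show "0 < cnorm n z" using z cnorm_eq_0[OF uballD(1)[OF z(1)]] by (simp add: less_le[of 0])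
        show "cnorm n z < 1" using z by (simp add: uballD)
      qed
    qed
    have "\<exists>h\<in>\<G>. matrix_map n U (v t) = h (v t)" if t: "t \<in> T" for t
    proof -
      have "v t \<in> S" unfolding S_def using t one by (intro UN_I[of e] image_eqI[of _ _ t]) (simp_all add: v)
      then have "matrix_map n U (v t) \<in> S" by (rule \<open>\<And>x. x \<in> S \<Longrightarrow> matrix_map n U x \<in> S\<close>)
      then obtain h t' where h: "h \<in> \<G>" "matrix_map n U (v t) = h (v t')" unfolding S_def by blast
      then have "cnorm n (v t) = cnorm n (v t')" using norm[OF h(1)] cnorm_unitary[OF U(1)] by metis
      then have "t = t'"
        using cnorm_moment_vector_less[OF n, of t t'] cnorm_moment_vector_less[OF n, of t' t]
        unfolding v_def by (metis less_irrefl nat_neq_iff)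
      with h show ?thesis by blast
    qed
    then have "\<forall>t\<in>T. \<exists>h. h \<in> \<G> \<and> matrix_map n U (v t) = h (v t)" by blast
    from bchoice[OF this] obtain h where h: "\<forall>t\<in>T. h t \<in> \<G> \<and> matrix_map n U (v t) = h t (v t)" by blast
    then have "h \<in> T \<rightarrow> \<G>" by blast
    then obtain g where g: "g \<in> \<G>" "card T \<le> card (h -` {g} \<inter> T) * card \<G>"
      using pigeonhole_card[of h T \<G>] fin \<open>\<G> \<noteq> {}\<close> by (auto simp: T_def)
    have "card \<G> > 0" using fin \<open>\<G> \<noteq> {}\<close> by (simp add: card_gt_0_iff)
    then have card: "card (h -` {g} \<inter> T) \<ge> n" using g(2) by (simp add: T_def)
    obtain W where W: "g = matrix_map n W" using unitary[OF g(1)] by blast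
    have agree: "matrix_map n U (moment_vector n t) = matrix_map n W (moment_vector n t)"
      if "t \<in> h -` {g} \<inter> T" for t
      using bspec[OF h, of t] that unfolding W[symmetric] v_def by simp
    have "finite (h -` {g} \<inter> T)" "0 \<notin> h -` {g} \<inter> T" by (simp_all add: T_def)
    then have "matrix_map n U = matrix_map n W"
      by (rule matrix_map_eq_on_moment_vectors[OF _ card _ agree])
    then have "\<gamma> = restrict g (uball n)" by (simp only: U(2) W)
    with g(1) show ?thesis by blast
  qed
  ultimately have "hermitian_invariant_group n N f = (\<lambda>g. restrict g (uball n)) ` \<G>" by blast
  with proper show ?thesis by blast
qed

section \<open>Conjugation\<close>

text \<open>The conjugating involution is the identity when the group is unitary, and otherwise an
  involution that moves a fixed point of the group to the origin.\<close>

lemma conjugate_group_realized: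
  assumes n: "n \<ge> 1" and G: "subgroup G (Aut_group n)" and fin: "finite G"
    and \<phi>: "\<phi> \<in> Aut_ball n" and invol: "\<And>z. z \<in> uball n \<Longrightarrow> \<phi> (\<phi> z) = z"
    and unitary: "\<And>\<gamma>. \<gamma> \<in> G \<Longrightarrow> compose (uball n) \<phi> (compose (uball n) \<gamma> \<phi>) \<in> unitary_ball n"
  shows "\<exists>N f. polynomial_proper_map n N f \<and> hermitian_invariant_group n N f =
    (\<lambda>\<gamma>. compose (uball n) \<phi> (compose (uball n) \<gamma> \<phi>)) ` G"
proof -
  let ?B = "uball n"
  define cj where "cj \<gamma> = compose ?B \<phi> (compose ?B \<gamma> \<phi>)" for \<gamma>
  define \<G> where "\<G> = {g. (\<exists>U. unitary_matrix n U \<and> g = matrix_map n U) \<and> restrict g ?B \<in> cj ` G}"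
  note aut = subgroup_Aut_groupD(1)[OF G] and id = subgroup_Aut_groupD(2)[OF G] and mult = subgroup_Aut_groupD(3)[OF G]
  have \<phi>B: "\<phi> z \<in> ?B" if "z \<in> ?B" for z by (rule Aut_ball_in_uball[OF \<phi> that])
  have image: "(\<lambda>g. restrict g ?B) ` \<G> = cj ` G"
  proof
    show "cj ` G \<subseteq> (\<lambda>g. restrict g ?B) ` \<G>"
    proof clarify
      fix \<gamma> assume \<gamma>: "\<gamma> \<in> G"
      then obtain U where U: "unitary_matrix n U" "cj \<gamma> = restrict (matrix_map n U) ?B"
        using unitary[OF \<gamma>] by (auto simp: cj_def unitary_ball_def)
      have "matrix_map n U \<in> \<G>"
        using U(1) image_eqI[where f = cj, OF U(2)[symmetric] \<gamma>] by (auto simp: \<G>_def)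
      with U(2) show "cj \<gamma> \<in> (\<lambda>g. restrict g ?B) ` \<G>" by blast
    qed
  qed (auto simp: \<G>_def)
  have "inj_on (\<lambda>g. restrict g ?B) \<G>"
  proof (rule inj_onI)
    fix g h assume *: "g \<in> \<G>" "h \<in> \<G>" "restrict g ?B = restrict h ?B"
    obtain U W where UW: "g = matrix_map n U" "h = matrix_map n W" using * by (auto simp: \<G>_def)
    show "g = h" unfolding UW
    proof (rule matrix_map_eqI)
      fix z assume "z \<in> ?B"
      then show "matrix_map n U z = matrix_map n W z" using fun_cong[OF *(3), of z] by (simp add: UW)
    qed
  qed
  moreover have "finite ((\<lambda>g. restrict g ?B) ` \<G>)" unfolding image using fin by simp
  ultimately have "finite \<G>" by (rule finite_imageD[rotated])
  define e where "e = matrix_map n (\<lambda>i j. if i = j then 1 else 0)"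
  have e: "e z = z" if "z \<in> cspace n" for z
    using that by (intro cspace_eqI[of _ n]) (auto simp: e_def matrix_map_in_cspace, auto simp: matrix_map_def
        if_distrib[of "\<lambda>x. x * _"] cong: if_cong)
  have "restrict e ?B = cj (\<lambda>z\<in>?B. z)"
    by (rule extensionalityI[where A = ?B]) (auto simp: cj_def compose_def invol \<phi>B e uballD)
  moreover have "unitary_matrix n (\<lambda>i j. if i = j then 1 else 0)"
    by (simp add: unitary_matrix_def if_distrib[of cnj] if_distrib[of "\<lambda>x. x * _"] cong: if_cong)
  ultimately have "e \<in> \<G>" using id by (auto simp: \<G>_def e_def)
  have closed: "g \<circ> h \<in> \<G>" if gh: "g \<in> \<G>" "h \<in> \<G>" for g h
  proof -
    obtain U W where UW: "g = matrix_map n U" "h = matrix_map n W" "unitary_matrix n W" using gh by (auto simp: \<G>_def)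
    obtain \<gamma> \<delta> where \<gamma>\<delta>: "\<gamma> \<in> G" "restrict g ?B = cj \<gamma>" "\<delta> \<in> G" "restrict h ?B = cj \<delta>"
      using gh by (auto simp: \<G>_def)
    have hB: "h z \<in> ?B" if "z \<in> ?B" for z unfolding UW by (rule matrix_map_in_uball[OF UW(3) that])
    have res: "restrict (g \<circ> h) ?B = cj (compose ?B \<gamma> \<delta>)"
    proof (rule extensionalityI[where A = ?B])
      fix z assume z: "z \<in> ?B"
      have "restrict (g \<circ> h) ?B z = restrict g ?B (restrict h ?B z)" using z hB by simp
      also have "\<dots> = cj \<gamma> (cj \<delta> z)" by (simp add: \<gamma>\<delta>)
      also have "\<dots> = cj (compose ?B \<gamma> \<delta>) z"
        using z by (simp add: cj_def compose_eq \<phi>B Aut_ball_in_uball[OF aut[OF \<gamma>\<delta>(3)]] invol)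
      finally show "restrict (g \<circ> h) ?B z = cj (compose ?B \<gamma> \<delta>) z" .
    qed (auto simp: cj_def)
    obtain X where X: "unitary_matrix n X" "restrict (g \<circ> h) ?B = restrict (matrix_map n X) ?B"
      using unitary[OF mult[OF \<gamma>\<delta>(1,3)]] unfolding res by (auto simp: cj_def unitary_ball_def)
    have gh_eq: "g \<circ> h = matrix_map n (\<lambda>i j. \<Sum>k<n. U i k * W k j)"
      unfolding UW by (auto simp: fun_eq_iff matrix_map_compose)
    also have "\<dots> = matrix_map n X"
    proof (rule matrix_map_eqI)
      fix z assume "z \<in> ?B"
      then show "matrix_map n (\<lambda>i j. \<Sum>k<n. U i k * W k j) z = matrix_map n X z"
        using fun_cong[OF X(2), of z] by (simp add: gh_eq[symmetric])
    qed
    finally show ?thesis using X(1) res mult[OF \<gamma>\<delta>(1,3)] by (auto simp: \<G>_def)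
  qed
  have "\<exists>N f. polynomial_proper_map n N f \<and> hermitian_invariant_group n N f = (\<lambda>g. restrict g ?B) ` \<G>"
    by (rule finite_unitary_group_realized[OF n \<open>finite \<G>\<close> _ \<open>e \<in> \<G>\<close> e closed]) (auto simp: \<G>_def)
  then show ?thesis unfolding image cj_def[abs_def] .
qed

lemma rational_fun_on_quotient:
  "polynomial_fun_on n S p \<Longrightarrow> polynomial_fun_on n S q \<Longrightarrow> (\<And>z. z \<in> S \<Longrightarrow> q z \<noteq> 0) \<Longrightarrow>
    rational_fun_on n S (\<lambda>z. p z / q z)"
  unfolding rational_fun_on_def by blast

lemma rational_fun_on_const: "rational_fun_on n S (\<lambda>z. a)"
  using rational_fun_on_quotient[OF polynomial_fun_on_const polynomial_fun_on_const, of S 1 n a] by simp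

lemma rational_fun_on_add:
  assumes "rational_fun_on n S g" "rational_fun_on n S h"
  shows "rational_fun_on n S (\<lambda>z. g z + h z)"
proof -
  obtain p q p' q' where *: "polynomial_fun_on n S p" "polynomial_fun_on n S q"
    "polynomial_fun_on n S p'" "polynomial_fun_on n S q'"
    "\<forall>z\<in>S. q z \<noteq> 0 \<and> g z = p z / q z" "\<forall>z\<in>S. q' z \<noteq> 0 \<and> h z = p' z / q' z"
    using assms unfolding rational_fun_on_def by blast
  show ?thesis
    unfolding rational_fun_on_def
  proof (intro exI conjI)
    show "polynomial_fun_on n S (\<lambda>z. p z * q' z + p' z * q z)" "polynomial_fun_on n S (\<lambda>z. q z * q' z)"
      by (intro polynomial_fun_on_add polynomial_fun_on_mult *)+
    show "\<forall>z\<in>S. q z * q' z \<noteq> 0 \<and> g z + h z = (p z * q' z + p' z * q z) / (q z * q' z)"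
      using *(5,6) by (auto simp: add_frac_eq)
  qed
qed

lemma rational_fun_on_mult:
  assumes "rational_fun_on n S g" "rational_fun_on n S h"
  shows "rational_fun_on n S (\<lambda>z. g z * h z)"
proof -
  obtain p q p' q' where *: "polynomial_fun_on n S p" "polynomial_fun_on n S q"
    "polynomial_fun_on n S p'" "polynomial_fun_on n S q'"
    "\<forall>z\<in>S. q z \<noteq> 0 \<and> g z = p z / q z" "\<forall>z\<in>S. q' z \<noteq> 0 \<and> h z = p' z / q' z"
    using assms unfolding rational_fun_on_def by blast
  show ?thesis
    unfolding rational_fun_on_def
  proof (intro exI conjI)
    show "polynomial_fun_on n S (\<lambda>z. p z * p' z)" "polynomial_fun_on n S (\<lambda>z. q z * q' z)"
      by (intro polynomial_fun_on_mult *)+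
    show "\<forall>z\<in>S. q z * q' z \<noteq> 0 \<and> g z * h z = (p z * p' z) / (q z * q' z)"
      using *(5,6) by auto
  qed
qed

lemma rational_fun_on_sum:
  "(\<And>i. i \<in> I \<Longrightarrow> rational_fun_on n S (g i)) \<Longrightarrow> rational_fun_on n S (\<lambda>z. \<Sum>i\<in>I. g i z)"
  by (induction I rule: infinite_finite_induct)
    (simp_all add: rational_fun_on_const rational_fun_on_add)

lemma rational_fun_on_prod:
  "(\<And>i. i \<in> I \<Longrightarrow> rational_fun_on n S (g i)) \<Longrightarrow> rational_fun_on n S (\<lambda>z. \<Prod>i\<in>I. g i z)"
  by (induction I rule: infinite_finite_induct)
    (simp_all add: rational_fun_on_const rational_fun_on_mult)

lemma rational_fun_on_power:
  "rational_fun_on n S g \<Longrightarrow> rational_fun_on n S (\<lambda>z. g z ^ m)"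
  by (induction m) (simp_all add: rational_fun_on_const rational_fun_on_mult)

lemma rational_fun_on_mobius:
  assumes p: "polynomial_fun_on n (uball n) p" and b: "b \<in> uball n"
  shows "rational_fun_on n (uball n) (\<lambda>z. p (mobius n b z))"
proof -
  obtain A c where p: "\<And>z. z \<in> uball n \<Longrightarrow> p z = (\<Sum>\<alpha>\<in>A. c \<alpha> * (\<Prod>i<n. z i ^ \<alpha> i))"
    using p by (auto simp: polynomial_fun_on_def)
  have cinner: "polynomial_fun_on n (uball n) (\<lambda>z. cinner n z b)"
    unfolding cinner_def
    by (intro polynomial_fun_on_sum polynomial_fun_on_mult polynomial_fun_on_const polynomial_fun_on_coordinate) simp
  have coord: "rational_fun_on n (uball n) (\<lambda>z. mobius n b z i)" if i: "i < n" for i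
  proof -
    define s where "s = complex_of_real (sqrt (1 - (cnorm n b)\<^sup>2))"
    have "rational_fun_on n (uball n) (\<lambda>z. ((1 + (- 1 / (1 + s)) * cinner n z b) * b i + (- s) * z i)
        / (1 + (- 1) * cinner n z b))"
    proof (rule rational_fun_on_quotient)
      show "polynomial_fun_on n (uball n) (\<lambda>z. (1 + (- 1 / (1 + s)) * cinner n z b) * b i + (- s) * z i)"
        "polynomial_fun_on n (uball n) (\<lambda>z. 1 + (- 1) * cinner n z b)"
        by (intro polynomial_fun_on_add polynomial_fun_on_mult polynomial_fun_on_const cinner
            polynomial_fun_on_coordinate i)+
      show "1 + (- 1) * cinner n z b \<noteq> 0" if "z \<in> uball n" for z
        using one_minus_cinner_nz[OF uballD(2)[OF that] uballD(2)[OF b]] by simp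
    qed
    then show ?thesis by (simp add: mobius_def Let_def s_def)
  qed
  have "rational_fun_on n (uball n) (\<lambda>z. \<Sum>\<alpha>\<in>A. c \<alpha> * (\<Prod>i<n. mobius n b z i ^ \<alpha> i))"
    by (intro rational_fun_on_sum rational_fun_on_mult rational_fun_on_const rational_fun_on_prod
        rational_fun_on_power coord) simp
  then show ?thesis
    using p[OF mobius_in_uball[OF b]] by (simp add: rational_fun_on_def)
qed

lemma rational_proper_map_mobius:
  assumes f: "polynomial_proper_map n N f" and b: "b \<in> uball n"
  shows "rational_proper_map n N (\<lambda>z. f (mobius n b z))"
proof -
  have poly: "\<And>j. j < N \<Longrightarrow> polynomial_fun_on n (uball n) (\<lambda>z. f z j)"
    and hol: "holomorphic_map_on n N (uball n) f" and range: "f \<in> uball n \<rightarrow> uball N"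
    and comp: "\<And>K. compact K \<Longrightarrow> K \<subseteq> uball N \<Longrightarrow> compact {z \<in> uball n. f z \<in> K}"
    using f by (auto simp: polynomial_proper_map_def proper_holomorphic_map_alt)
  have "holomorphic_map_on n n (uball n) (restrict (mobius n b) (uball n))"
    by (rule Aut_ballD(3)[OF mobius_in_Aut_ball[OF b]])
  then have mob: "holomorphic_map_on n n (uball n) (mobius n b)"
    using holomorphic_map_on_cong[of "uball n" "restrict (mobius n b) (uball n)" "mobius n b"] by simp
  have maps: "mobius n b z \<in> uball n" if "z \<in> uball n" for z by (rule mobius_in_uball[OF b that])
  have inv: "mobius n b (mobius n b z) = z" if "z \<in> uball n" for z
    using b that by (intro mobius_involution one_minus_cinner_nz) (auto dest: uballD)
  have "holomorphic_map_on n N (uball n) (\<lambda>z. f (mobius n b z))"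
    by (rule holomorphic_map_on_compose[OF uball_subset uball_subset mob hol]) (use maps in blast)
  moreover have "compact {z \<in> uball n. f (mobius n b z) \<in> K}" if K: "compact K" "K \<subseteq> uball N" for K
  proof -
    have "continuous_on {z \<in> uball n. f z \<in> K} (mobius n b)"
      by (rule continuous_on_subset[OF holomorphic_map_on_imp_continuous_on[OF uball_subset mob]]) auto
    then have "compact (mobius n b ` {z \<in> uball n. f z \<in> K})"
      by (rule compact_continuous_image[OF _ comp[OF K]])
    also have "mobius n b ` {z \<in> uball n. f z \<in> K} = {z \<in> uball n. f (mobius n b z) \<in> K}"
      using maps inv by (auto simp: image_iff) metis
    finally show ?thesis .
  qed
  ultimately show ?thesis
    unfolding rational_proper_map_def proper_holomorphic_map_alt
    using range maps rational_fun_on_mobius[OF poly b] by auto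
qed

theorem theorem6p2:
  fixes n :: nat and G :: "((nat \<Rightarrow> complex) \<Rightarrow> nat \<Rightarrow> complex) set"
  assumes "n \<ge> 1"
    and "subgroup G (Aut_group n)"
    and "finite G"
  shows "(\<exists>N f. rational_proper_map n N f \<and> hermitian_invariant_group n N f = G) \<and>
    (G \<subseteq> unitary_ball n \<longrightarrow>
      (\<exists>N f. polynomial_proper_map n N f \<and> hermitian_invariant_group n N f = G))"
proof (intro conjI impI)
  let ?B = "uball n"
  note aut = subgroup_Aut_groupD(1)[OF assms(2)]
  obtain p where p: "p \<in> ?B" "\<And>\<gamma>. \<gamma> \<in> G \<Longrightarrow> \<gamma> p = p"
    using finite_group_fixed_point[OF assms(2,3)] by metis
  define \<phi> where "\<phi> = restrict (mobius n p) ?B"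
  have \<phi>: "\<phi> \<in> Aut_ball n" unfolding \<phi>_def by (rule mobius_in_Aut_ball[OF p(1)])
  have \<phi>B: "\<phi> z \<in> ?B" if "z \<in> ?B" for z by (rule Aut_ball_in_uball[OF \<phi> that])
  have invol: "\<phi> (\<phi> z) = z" if "z \<in> ?B" for z
    using p that mobius_in_uball[OF p(1) that] unfolding \<phi>_def
    by (simp, intro mobius_involution one_minus_cinner_nz) (auto dest: uballD)
  define cj where "cj \<gamma> = compose ?B \<phi> (compose ?B \<gamma> \<phi>)" for \<gamma>
  have cj_aut: "cj \<gamma> \<in> Aut_ball n" if "\<gamma> \<in> Aut_ball n" for \<gamma>
    unfolding cj_def by (intro Aut_ball_compose \<phi> that)
  have cj: "\<phi> (\<gamma> z) = cj \<gamma> (\<phi> z)" if "z \<in> ?B" for \<gamma> z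
    using that by (simp add: cj_def compose_eq \<phi>B invol)
  have cj_inj: "\<gamma> = \<delta>" if "\<gamma> \<in> Aut_ball n" "\<delta> \<in> Aut_ball n" "cj \<gamma> = cj \<delta>" for \<gamma> \<delta>
    by (rule Aut_ball_eqI[OF that(1,2)]) (metis Aut_ball_in_uball cj invol that)
  have "cj \<gamma> \<in> unitary_ball n" if \<gamma>: "\<gamma> \<in> G" for \<gamma>
  proof -
    have "\<phi> (\<lambda>i. 0) = p" "\<phi> p = (\<lambda>i. 0)"
      using p by (simp_all add: \<phi>_def zero_in_uball mobius_zero mobius_self uballD)
    then have "cj \<gamma> (\<lambda>i. 0) = (\<lambda>i. 0)" using p \<gamma> by (simp add: cj_def compose_eq zero_in_uball)
    from Aut_ball_fixing_0[OF cj_aut[OF aut[OF \<gamma>]] this] show ?thesis by (auto simp: unitary_ball_def)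
  qed
  then obtain N f where f: "polynomial_proper_map n N f" "hermitian_invariant_group n N f = cj ` G"
    using conjugate_group_realized[OF assms \<phi> invol] unfolding cj_def[abs_def] by metis
  have "hermitian_invariant_group n N (\<lambda>z. f (mobius n p z)) = G"
  proof (intro equalityI subsetI)
    fix \<gamma> assume "\<gamma> \<in> hermitian_invariant_group n N (\<lambda>z. f (mobius n p z))"
    then obtain \<psi> where \<gamma>: "\<gamma> \<in> Aut_ball n" and \<psi>: "\<psi> \<in> Aut_ball N"
      and eq: "\<And>z. z \<in> ?B \<Longrightarrow> f (\<phi> (\<gamma> z)) = \<psi> (f (\<phi> z))"
      by (auto simp: hermitian_invariant_group_def \<phi>_def Aut_ball_in_uball)
    have "f (cj \<gamma> z) = \<psi> (f z)" if "z \<in> ?B" for z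
      using eq[OF \<phi>B[OF that]] cj[OF \<phi>B[OF that]] invol[OF that] by simp
    then have "cj \<gamma> \<in> cj ` G"
      using cj_aut[OF \<gamma>] \<psi> unfolding f(2)[symmetric] by (auto simp: hermitian_invariant_group_def)
    then show "\<gamma> \<in> G" using cj_inj[OF \<gamma> aut] by blast
  next
    fix \<gamma> assume \<gamma>: "\<gamma> \<in> G"
    then have "cj \<gamma> \<in> hermitian_invariant_group n N f" unfolding f(2) by simp
    then obtain \<psi> where \<psi>: "\<psi> \<in> Aut_ball N" "\<And>z. z \<in> ?B \<Longrightarrow> f (cj \<gamma> z) = \<psi> (f z)"
      by (auto simp: hermitian_invariant_group_def)
    have "f (mobius n p (\<gamma> z)) = \<psi> (f (mobius n p z))" if z: "z \<in> ?B" for z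
      using \<psi>(2)[OF \<phi>B[OF z]] cj[OF z, of \<gamma>] z Aut_ball_in_uball[OF aut[OF \<gamma>] z] by (simp add: \<phi>_def)
    then show "\<gamma> \<in> hermitian_invariant_group n N (\<lambda>z. f (mobius n p z))"
      using aut[OF \<gamma>] \<psi>(1) by (auto simp: hermitian_invariant_group_def)
  qed
  then show "\<exists>N f. rational_proper_map n N f \<and> hermitian_invariant_group n N f = G"
    using rational_proper_map_mobius[OF f(1) p(1)] by blast
next
  let ?B = "uball n"
  assume U: "G \<subseteq> unitary_ball n"
  note id = subgroup_Aut_groupD(2)[OF assms(2)]
  have aut: "\<gamma> \<in> Aut_ball n" if "\<gamma> \<in> G" for \<gamma>
    using U unitary_ball_subset_Aut_ball that by blast
  have eq: "compose ?B (\<lambda>z\<in>?B. z) (compose ?B \<gamma> (\<lambda>z\<in>?B. z)) = \<gamma>" if "\<gamma> \<in> G" for \<gamma>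
    by (rule extensionalityI[OF _ Aut_ballD(2)[OF aut[OF that]]])
      (auto simp: compose_def Aut_ball_in_uball[OF aut[OF that]])
  have "\<exists>N f. polynomial_proper_map n N f \<and> hermitian_invariant_group n N f =
      (\<lambda>\<gamma>. compose ?B (\<lambda>z\<in>?B. z) (compose ?B \<gamma> (\<lambda>z\<in>?B. z))) ` G"
    by (rule conjugate_group_realized[OF assms aut[OF id]]) (use U in \<open>auto simp: eq\<close>)
  then show "\<exists>N f. polynomial_proper_map n N f \<and> hermitian_invariant_group n N f = G"
    using eq by simp
qed

end
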